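(* Let $D\subset\mathbb{C}^n$ be an open invariant set, $f\in\mathcal{SR}(\Omega_D)$, and let $a=(a_1,\dots,a_n)\in\Omega_D$ and $r_1,\dots,r_n\ge0$ be such that $\overline{B_{r_1}(a_1)}\times\dots\times\overline{B_{r_n}(a_n)}\subset\Omega_D$. Then for any $m=1,\dots,n$ $$f(a)=\sum_{K\in\mathcal{P}(m)}(-1)^{|K^c|}\,\overline{a}_{K^c}\int_{(\mathbb{S}^3)^m}\mathcal{S}^{\llbracket m\rrbracket}_K(f)\Big(a+\sum_{i=1}^mr_i\lambda_i\Big)\,d\sigma^m(\lambda),$$ where $K^c=\{1,\dots,m\}\setminus K$ and $\lambda=(\lambda_1,\dots,\lambda_m)$.
   Context: Sets and products. $\mathbb{H}\cong\mathbb{R}^4$ denotes the quaternions, $\mathbb{S}_\mathbb{H}=\{J\in\mathbb{H}: J^2=-1\}$, $\mathcal{P}(m)$ is the power set of $\llbracket m\rrbracket:=\{1,\dots,m\}$. For $K=\{k_1<\dots<k_p\}$ and quaternions $q_k$, $q_K:=q_{k_1}\cdots q_{k_p}$ (increasing order), $q_\emptyset:=1$; thus $\overline a_K=\overline{a_{k_1}}\cdots\overline{a_{k_p}}$. For $z\in\mathbb{C}^n$ write $z_h=\alpha_h+i\beta_h$ with $\alpha_h,\beta_h\in\mathbb{R}$, and let $\overline z^h$ be $z$ with $z_h$ replaced by $\overline{z_h}$. Stem and slice functions. $D\subset\mathbb{C}^n$ is invariant if $z\in D\iff\overline z^h\in D$ for all $h$. Let $\{e_K\}_{K\in\mathcal{P}(n)}$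 be a basis of $\mathbb{R}^{2^n}$, $e_\emptyset=1$, $e_h:=e_{\{h\}}$. A stem function on $D$ is a continuous $F=\sum_{K\in\mathcal{P}(n)}e_KF_K:D\to\mathbb{H}\otimes\mathbb{R}^{2^n}$ ($F_K$ $\mathbb{H}$-valued) with $F_K(\overline z^h)=(-1)^{|K\cap\{h\}|}F_K(z)$ for all $K,h$. The circularization of $D$ is $\Omega_D=\{(\alpha_1+J_1\beta_1,\dots,\alpha_n+J_n\beta_n): (\alpha_1+i\beta_1,\dots,\alpha_n+i\beta_n)\in D,\ J_1,\dots,J_n\in\mathbb{S}_\mathbb{H}\}$. $F$ induces the slice function $f=\mathcal{I}(F):\Omega_D\to\mathbb{H}$, $f(x)=\sum_{K}J_KF_K(z)$ for $x=(\alpha_h+J_h\beta_h)_h$, $z=(\alpha_h+i\beta_h)_h$; the stem function $F$ is determined by $f$. $\mathcal{S}(\Omega_D)$ is the set of slice functions on $\Omega_D$. Product: $(F\otimes G)(z)=\sum_{H,K}(-1)^{|H\cap K|}e_{K\Delta H}F_K(z)G_H(z)$ ($\Delta$ = symmetric difference) and $\mathcal{I}(F)\odot\mathcal{I}(G):=\mathcal{I}(F\otimes G)$. The coordinate function $x_j$ is the slice function induced by $Z_j(z)=\alpha_j+e_j\beta_j$; $x_K$ is the ordered product of the $x_k$, $k\in K$. Regularity. $\mathcal{J}_h(q\otimes e_K)=(-1)^{|K\cap\{h\}|}q\otimes e_{K\Delta\{h\}}$ and $\overline\partial_h=\frac12(\partial/\partial\alpha_h+\mathcal{J}_h\,\partial/\partial\beta_h)$.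 A $C^1$ stem function $F$ is holomorphic if $\overline\partial_hF=0$ for every $h=1,\dots,n$; $f=\mathcal{I}(F)$ is slice regular if $F$ is holomorphic. $\mathcal{SR}(\Omega_D)$ is the set of slice regular functions. Spherical derivatives and components. For $H\in\mathcal{P}(n)$ let $H^c=\{1,\dots,n\}\setminus H$, $D_H=\{z\in D:\beta_h\ne0\ \forall h\in H\}$, $\Omega_{D_H}$ its circularization, and for $f=\mathcal{I}(F)\in\mathcal{S}(\Omega_D)$ let $f'_{s,H}=\mathcal{I}(F'_H)\in\mathcal{S}(\Omega_{D_H})$, where $F'_H(z)=\big(\prod_{h\in H}\beta_h\big)^{-1}\sum_{K\subset H^c}e_KF_{K\cup H}(z)$. For $K\subset\llbracket m\rrbracket$ define $\mathcal{S}^{\llbracket m\rrbracket}_K(f):=(x_K\odot f)'_{s,\llbracket m\rrbracket}$ on $\Omega_{D_{\llbracket m\rrbracket}}$. When $f$ is slice regular, $\mathcal{S}^{\llbracket m\rrbracket}_K(f)$ extends continuously (in a unique way) to $\Omega_D$ and the extension is denoted by the same symbol. Conventions. $\overline{B_r(q)}=\{x\in\mathbb{H}:|x-q|\le r\}$. $\mathbb{S}^3$ is the unit sphere of $\mathbb{H}\cong\mathbb{R}^4$, $\sigma$ its surface measure normalized by $\sigma(\mathbb{S}^3)=1$, $\sigma^l$ the $l$-fold product measure. For $a\in\mathbb{H}^n$ and quaternions $q_i$ ($i\in I\subset\{1,\dots,n\}$), $a+\sum_{i\in I}q_i$ denotes the point of $\mathbb{H}^n$ obtained from $a$ by replacing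 $a_i$ with $a_i+q_i$ for each $i\in I$. *)

theory Defs
  imports "HOL-Probability.Probability"
begin

section \<open>Quaternions\<close>

codatatype quat = Quat (q_re: real) (q_i: real) (q_j: real) (q_k: real)

lemma quat_eq_iff: "x = y \<longleftrightarrow> q_re x = q_re y \<and> q_i x = q_i y \<and> q_j x = q_j y \<and> q_k x = q_k y"
  using quat.expand by auto

lemma quat_sumsq_eq_0: "(a::real)\<^sup>2 + b\<^sup>2 + c\<^sup>2 + d\<^sup>2 = 0 \<longleftrightarrow> a = 0 \<and> b = 0 \<and> c = 0 \<and> d = 0"
  by (smt (verit) zero_le_power2 zero_eq_power2)

instantiation quat :: real_div_algebra
begin

primcorec zero_quat where
  "q_re 0 = 0" | "q_i 0 = 0" | "q_j 0 = 0" | "q_k 0 = 0"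

primcorec one_quat where
  "q_re 1 = 1" | "q_i 1 = 0" | "q_j 1 = 0" | "q_k 1 = 0"

primcorec plus_quat where
  "q_re (x + y) = q_re x + q_re y"
| "q_i (x + y) = q_i x + q_i y"
| "q_j (x + y) = q_j x + q_j y"
| "q_k (x + y) = q_k x + q_k y"

primcorec uminus_quat where
  "q_re (- x) = - q_re x" | "q_i (- x) = - q_i x" | "q_j (- x) = - q_j x" | "q_k (- x) = - q_k x"

primcorec minus_quat where
  "q_re (x - y) = q_re x - q_re y"
| "q_i (x - y) = q_i x - q_i y"
| "q_j (x - y) = q_j x - q_j y"
| "q_k (x - y) = q_k x - q_k y"

primcorec times_quat where
  "q_re (x * y) = q_re x * q_re y - q_i x * q_i y - q_j x * q_j y - q_k x * q_k y"
| "q_i (x * y) = q_re x * q_i y + q_i x * q_re y + q_j x * q_k y - q_k x * q_j y"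
| "q_j (x * y) = q_re x * q_j y - q_i x * q_k y + q_j x * q_re y + q_k x * q_i y"
| "q_k (x * y) = q_re x * q_k y + q_i x * q_j y - q_j x * q_i y + q_k x * q_re y"

primcorec scaleR_quat where
  "q_re (scaleR r x) = r * q_re x"
| "q_i (scaleR r x) = r * q_i x"
| "q_j (scaleR r x) = r * q_j x"
| "q_k (scaleR r x) = r * q_k x"

primcorec inverse_quat where
  "q_re (inverse x) = q_re x / ((q_re x)\<^sup>2 + (q_i x)\<^sup>2 + (q_j x)\<^sup>2 + (q_k x)\<^sup>2)"
| "q_i (inverse x) = - q_i x / ((q_re x)\<^sup>2 + (q_i x)\<^sup>2 + (q_j x)\<^sup>2 + (q_k x)\<^sup>2)"
| "q_j (inverse x) = - q_j x / ((q_re x)\<^sup>2 + (q_i x)\<^sup>2 + (q_j x)\<^sup>2 + (q_k x)\<^sup>2)"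
| "q_k (inverse x) = - q_k x / ((q_re x)\<^sup>2 + (q_i x)\<^sup>2 + (q_j x)\<^sup>2 + (q_k x)\<^sup>2)"

definition divide_quat :: "quat \<Rightarrow> quat \<Rightarrow> quat" where "divide_quat x y = x * inverse y"

instance
proof
  fix a b :: real and x y z :: quat
  show "x + y + z = x + (y + z)" "x + y = y + x" "0 + x = x" "- x + x = 0" "x - y = x + - y"
    by (auto simp: quat_eq_iff)
  show "a *\<^sub>R (x + y) = a *\<^sub>R x + a *\<^sub>R y" "(a + b) *\<^sub>R x = a *\<^sub>R x + b *\<^sub>R x"
    "a *\<^sub>R b *\<^sub>R x = (a * b) *\<^sub>R x" "1 *\<^sub>R x = x"
    by (auto simp: quat_eq_iff algebra_simps)
  show "x * y * z = x * (y * z)" "(x + y) * z = x * z + y * z" "x * (y + z) = x * y + x * z"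
    "a *\<^sub>R x * y = a *\<^sub>R (x * y)" "x * a *\<^sub>R y = a *\<^sub>R (x * y)"
    by (simp_all add: quat_eq_iff algebra_simps)
  show "1 * x = x" "x * 1 = x" "(0::quat) \<noteq> 1" "inverse (0::quat) = 0"
    by (auto simp: quat_eq_iff)
  show "x div y = x * inverse y"
    by (simp add: divide_quat_def)
  show "x \<noteq> 0 \<Longrightarrow> inverse x * x = 1" "x \<noteq> 0 \<Longrightarrow> x * inverse x = 1"
    using quat_sumsq_eq_0[of "q_re x" "q_i x" "q_j x" "q_k x"]
    by (auto simp: quat_eq_iff power2_eq_square diff_divide_distrib[symmetric]
          add_divide_distrib[symmetric] mult.commute)
qed

end

instantiation quat :: real_normed_div_algebra
begin

definition norm_quat :: "quat \<Rightarrow> real" where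
  "norm_quat x = sqrt ((q_re x)\<^sup>2 + (q_i x)\<^sup>2 + (q_j x)\<^sup>2 + (q_k x)\<^sup>2)"

definition sgn_quat :: "quat \<Rightarrow> quat" where "sgn_quat x = x /\<^sub>R norm x"

definition dist_quat :: "quat \<Rightarrow> quat \<Rightarrow> real" where "dist_quat x y = norm (x - y)"

definition uniformity_quat :: "(quat \<times> quat) filter" where
  "uniformity_quat = (INF e\<in>{0 <..}. principal {(x, y). dist x y < e})"

definition open_quat :: "quat set \<Rightarrow> bool" where
  "open_quat U \<longleftrightarrow> (\<forall>x\<in>U. eventually (\<lambda>(x', y). x' = x \<longrightarrow> y \<in> U) uniformity)"

lemma quat_norm_triangle:
  "norm (x + y) \<le> norm x + norm (y::quat)"
proof -
  let ?f = "\<lambda>(q::quat). (Complex (q_re q) (q_i q), Complex (q_j q) (q_k q))"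
  have n: "norm q = norm (?f q)" for q :: quat
    by (simp add: norm_quat_def norm_Pair cmod_def)
  have "?f (x + y) = ?f x + ?f y"
    by (simp add: complex_eq_iff)
  then show ?thesis
    using norm_triangle_ineq[of "?f x" "?f y"] by (simp only: n)
qed

instance
proof
  fix a :: real and x y :: quat
  show "(norm x = 0) = (x = 0)"
    using quat_sumsq_eq_0[of "q_re x" "q_i x" "q_j x" "q_k x"]
    by (simp add: norm_quat_def quat_eq_iff)
  show "norm (x + y) \<le> norm x + norm y"
    by (rule quat_norm_triangle)
  show "norm (a *\<^sub>R x) = \<bar>a\<bar> * norm x"
    by (simp add: norm_quat_def power_mult_distrib distrib_left[symmetric] real_sqrt_mult)
  show "norm (x * y) = norm x * norm y"
    by (simp add: norm_quat_def real_sqrt_mult[symmetric] power2_eq_square algebra_simps)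
qed (auto simp: sgn_quat_def dist_quat_def uniformity_quat_def open_quat_def)

end

instantiation quat :: euclidean_space
begin

definition inner_quat :: "quat \<Rightarrow> quat \<Rightarrow> real" where
  "inner_quat x y = q_re x * q_re y + q_i x * q_i y + q_j x * q_j y + q_k x * q_k y"

definition Basis_quat :: "quat set" where
  "Basis_quat = {Quat 1 0 0 0, Quat 0 1 0 0, Quat 0 0 1 0, Quat 0 0 0 1}"

instance
proof
  fix x y z :: quat and r :: real
  show "inner x y = inner y x"
    by (simp add: inner_quat_def mult.commute)
  show "inner (x + y) z = inner x z + inner y z"
    by (simp add: inner_quat_def algebra_simps)
  show "inner (r *\<^sub>R x) y = r * inner x y"
    by (simp add: inner_quat_def algebra_simps)
  show "0 \<le> inner x x"
    by (simp add: inner_quat_def)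
  show "(inner x x = 0) = (x = 0)"
    using quat_sumsq_eq_0[of "q_re x" "q_i x" "q_j x" "q_k x"]
    by (simp add: inner_quat_def quat_eq_iff power2_eq_square)
  show "norm x = sqrt (inner x x)"
    by (simp add: norm_quat_def inner_quat_def power2_eq_square)
  show "(Basis :: quat set) \<noteq> {}" "finite (Basis :: quat set)"
    by (auto simp: Basis_quat_def)
  show "inner x y = (if x = y then 1 else 0)" if "x \<in> Basis" "y \<in> Basis"
    using that unfolding Basis_quat_def inner_quat_def
    by (elim insertE emptyE) simp_all
  show "(\<forall>u\<in>Basis. inner x u = 0) \<longleftrightarrow> x = 0"
    unfolding Basis_quat_def ball_simps by (simp add: inner_quat_def) (auto simp: quat_eq_iff)
qed

end

definition qcnj :: "quat \<Rightarrow> quat" where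
  "qcnj q = Quat (q_re q) (- q_i q) (- q_j q) (- q_k q)"

definition imag_units :: "quat set" where
  "imag_units = {J. J\<^sup>2 = -1}"

lemma imag_units_iff: "J \<in> imag_units \<longleftrightarrow> q_re J = 0 \<and> norm J = 1"
proof -
  have "J\<^sup>2 = -1 \<longleftrightarrow> q_re J = 0 \<and> (q_i J)\<^sup>2 + (q_j J)\<^sup>2 + (q_k J)\<^sup>2 = 1"
  proof (cases "q_re J = 0")
    case True
    then show ?thesis
      by (auto simp: quat_eq_iff power2_eq_square)
  next
    case False
    have "\<not> (q_re J)\<^sup>2 = -1"
      by (smt (verit) zero_le_power2)
    then show ?thesis
      using False by (auto simp: quat_eq_iff power2_eq_square)
  qed
  then show ?thesis
    by (auto simp: imag_units_def norm_quat_def)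
qed

section \<open>Index sets and ordered products\<close>

text \<open>The index set \<open>{1,\<dots>,n}\<close> is a finite linearly ordered type \<open>'n\<close> with \<open>CARD('n) = n\<close>;
  \<open>first_idx m\<close> consists of its \<open>m\<close> smallest elements, i.e. it is the segment \<open>{1,\<dots>,m}\<close>.\<close>

definition first_idx :: "nat \<Rightarrow> 'n::{finite,linorder} set" where
  "first_idx m = set (take m (sorted_list_of_set (UNIV :: 'n set)))"

definition ordered_prod :: "('n::{finite,linorder} \<Rightarrow> quat) \<Rightarrow> 'n set \<Rightarrow> quat" where
  "ordered_prod q K = prod_list (map q (sorted_list_of_set K))"

section \<open>Stem functions and slice functions\<close>

text \<open>The real tensor product of the quaternions with the \<open>2^n\<close>-dimensional space with basis
  \<open>e\<^sub>K\<close> is \<open>quat ^ 'n set\<close>: the component \<open>v $ K\<close> is the coefficient of \<open>e\<^sub>K\<close>,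
  and \<open>axis K q\<close> is \<open>e\<^sub>K q\<close>.\<close>

type_synonym 'n cvec = "complex ^ 'n"

type_synonym 'n qvec = "quat ^ 'n"

type_synonym 'n tensor = "quat ^ ('n set)"

definition conj_at :: "'n \<Rightarrow> 'n cvec \<Rightarrow> 'n::finite cvec" where
  "conj_at h z = (\<chi> i. if i = h then cnj (z $ i) else z $ i)"

definition invariant_set :: "'n::finite cvec set \<Rightarrow> bool" where
  "invariant_set D \<longleftrightarrow> (\<forall>z h. z \<in> D \<longleftrightarrow> conj_at h z \<in> D)"

definition stem_function :: "'n::finite cvec set \<Rightarrow> ('n cvec \<Rightarrow> 'n tensor) \<Rightarrow> bool" where
  "stem_function D F \<longleftrightarrow> continuous_on D F \<and>
     (\<forall>z\<in>D. \<forall>K h. F (conj_at h z) $ K = (-1) ^ card (K \<inter> {h}) * F z $ K)"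

definition slice_point :: "'n cvec \<Rightarrow> ('n \<Rightarrow> quat) \<Rightarrow> 'n::finite qvec" where
  "slice_point z J = (\<chi> h. of_real (Re (z $ h)) + J h * of_real (Im (z $ h)))"

definition circularization :: "'n::finite cvec set \<Rightarrow> 'n qvec set" where
  "circularization D = {slice_point z J | z J. z \<in> D \<and> (\<forall>h. J h \<in> imag_units)}"

text \<open>For a stem function the value of \<open>induced D F x\<close> at \<open>x \<in> circularization D\<close> does not depend on
  the chosen representation \<open>x = slice_point z J\<close>; see \<open>induced_slice_point\<close> below.\<close>

definition induced ::
  "'n::{finite,linorder} cvec set \<Rightarrow> ('n cvec \<Rightarrow> 'n tensor) \<Rightarrow> 'n qvec \<Rightarrow> quat" where
  "induced D F x =
     (let (z, J) = (SOME (z, J). z \<in> D \<and> (\<forall>h. J h \<in> imag_units) \<and> x = slice_point z J)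
      in \<Sum>K\<in>UNIV. ordered_prod J K * F z $ K)"

lemma q_sel_of_real [simp]:
  "q_re (of_real t) = t" "q_i (of_real t) = 0" "q_j (of_real t) = 0" "q_k (of_real t) = 0"
  by (simp_all add: of_real_def)

lemma slice_point_eq_cases:
  assumes "slice_point z J = slice_point w I" "J h \<in> imag_units" "I h \<in> imag_units"
  shows "w $ h = z $ h \<and> (Im (z $ h) = 0 \<or> I h = J h) \<or>
         w $ h = cnj (z $ h) \<and> Im (z $ h) \<noteq> 0 \<and> I h = - J h"
proof -
  have eq: "of_real (Re (z $ h)) + J h * of_real (Im (z $ h))
          = of_real (Re (w $ h)) + I h * of_real (Im (w $ h))"
    using assms(1) by (auto simp: slice_point_def vec_eq_iff)
  have re: "Re (z $ h) = Re (w $ h)"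
    using arg_cong[OF eq, of q_re] assms(2,3) by (simp add: imag_units_iff)
  with eq have im: "J h * of_real (Im (z $ h)) = I h * of_real (Im (w $ h))"
    by simp
  have n: "norm (J h) = 1" "norm (I h) = 1"
    using assms(2,3) by (simp_all add: imag_units_iff)
  have "\<bar>Im (z $ h)\<bar> = \<bar>Im (w $ h)\<bar>"
    using arg_cong[OF im, of norm] n by (simp add: norm_mult)
  then consider "Im (w $ h) = Im (z $ h)" | "Im (w $ h) = - Im (z $ h)" "Im (z $ h) \<noteq> 0"
    by linarith
  then show ?thesis
  proof cases
    case 1
    then show ?thesis using im re by (auto simp: complex_eq_iff)
  next
    case 2
    then have "J h * of_real (Im (z $ h)) = (- I h) * of_real (Im (z $ h))"
      using im by simp
    then have "J h = - I h"
      using 2(2) by (metis mult_right_cancel of_real_eq_0_iff)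
    then show ?thesis using 2 re by (auto simp: complex_eq_iff)
  qed
qed

lemma stem_conj_set:
  assumes "stem_function D F" "invariant_set D" "z \<in> D" "finite N"
  shows "(\<chi> i. if i \<in> N then cnj (z $ i) else z $ i) \<in> D \<and>
         F (\<chi> i. if i \<in> N then cnj (z $ i) else z $ i) $ K = (-1) ^ card (K \<inter> N) * F z $ K"
  using assms(4)
proof (induction N)
  case empty
  have "(\<chi> i. z $ i) = z" by (simp add: vec_eq_iff)
  then show ?case using assms(3) by simp
next
  case (insert h N)
  let ?z = "\<lambda>N. (\<chi> i. if i \<in> N then cnj (z $ i) else z $ i)"
  have e: "?z (insert h N) = conj_at h (?z N)"
    using insert.hyps by (auto simp: conj_at_def vec_eq_iff)
  have D: "?z N \<in> D" using insert.IH by blast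
  have "card (K \<inter> insert h N) = card (K \<inter> {h}) + card (K \<inter> N)"
    using insert.hyps
    by (subst card_Un_disjoint[symmetric]) (auto intro: arg_cong[where f=card])
  then have "F (?z (insert h N)) $ K = (-1) ^ card (K \<inter> insert h N) * F z $ K"
    using assms(1) D insert.IH unfolding e
    by (auto simp: stem_function_def power_add mult.assoc)
  moreover have "?z (insert h N) \<in> D"
    using assms(2) D unfolding e invariant_set_def by blast
  ultimately show ?case by blast
qed

lemma ordered_prod_flip:
  fixes I J :: "'n::{finite,linorder} \<Rightarrow> quat"
  assumes "\<And>k. k \<in> K \<Longrightarrow> I k = (if k \<in> N then - J k else J k)"
  shows "ordered_prod I K = (-1) ^ card (K \<inter> N) * ordered_prod J K"
proof -
  have "prod_list (map I xs) = (-1) ^ card (set xs \<inter> N) * prod_list (map J xs)"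
    if "distinct xs" "set xs \<subseteq> K" for xs
    using that
  proof (induction xs)
    case (Cons x xs)
    have c: "J x * (-1) ^ k = (-1) ^ k * J x" for k :: nat
      by (cases "even k") auto
    from Cons have IH: "prod_list (map I xs) = (-1) ^ card (set xs \<inter> N) * prod_list (map J xs)"
      by simp
    show ?case
    proof (cases "x \<in> N")
      case True
      then have "card (set (x # xs) \<inter> N) = Suc (card (set xs \<inter> N))"
        using Cons.prems by simp
      then show ?thesis
        using True Cons.prems assms[of x] by (simp add: IH mult.assoc[symmetric] c)
    next
      case False
      then have "set (x # xs) \<inter> N = set xs \<inter> N" by auto
      then show ?thesis
        using False Cons.prems assms[of x] by (simp add: IH mult.assoc[symmetric] c)
    qed
  qed simp
  from this[of "sorted_list_of_set K"] show ?thesis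
    by (simp add: ordered_prod_def)
qed

lemma stem_real_zero:
  assumes "stem_function D F" "z \<in> D" "k \<in> K" "Im (z $ k) = 0"
  shows "F z $ K = 0"
proof -
  have "conj_at k z = z"
    using assms(4) by (auto simp: conj_at_def vec_eq_iff complex_eq_iff)
  moreover have "K \<inter> {k} = {k}" using assms(3) by auto
  ultimately have "F z $ K = - (F z $ K)"
    using assms(1,2) by (metis (no_types, lifting) card.empty card_insert_disjoint empty_iff
      finite.emptyI mult_minus1 power_one_right One_nat_def stem_function_def)
  then have "2 *\<^sub>R (F z $ K) = 0"
    by (metis add.right_inverse scaleR_2)
  then show ?thesis by simp
qed

lemma induced_slice_point:
  fixes D :: "'n::{finite,linorder} cvec set"
  assumes F: "stem_function D F" and D: "invariant_set D" and z: "z \<in> D"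
    and J: "\<And>h. J h \<in> imag_units"
  shows "induced D F (slice_point z J) = (\<Sum>K\<in>UNIV. ordered_prod J K * F z $ K)"
proof -
  let ?P = "\<lambda>(w, I). w \<in> D \<and> (\<forall>h. I h \<in> imag_units) \<and> slice_point z J = slice_point w I"
  obtain w I where wI: "(SOME p. ?P p) = (w, I)"
    by (cases "SOME p. ?P p")
  have "?P (SOME p. ?P p)"
    by (rule someI[of ?P "(z, J)"]) (use z J in auto)
  then have w: "w \<in> D" and I: "\<And>h. I h \<in> imag_units" and eq: "slice_point z J = slice_point w I"
    unfolding wI by auto
  define N where "N = {h. w $ h \<noteq> z $ h}"
  have cases: "w $ h = z $ h \<and> (Im (z $ h) = 0 \<or> I h = J h) \<or>
         w $ h = cnj (z $ h) \<and> Im (z $ h) \<noteq> 0 \<and> I h = - J h" for h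
    by (rule slice_point_eq_cases[OF eq J I])
  have "w = (\<chi> i. if i \<in> N then cnj (z $ i) else z $ i)"
    using cases by (auto simp: N_def vec_eq_iff)
  then have Fw: "F w $ K = (-1) ^ card (K \<inter> N) * F z $ K" for K
    using stem_conj_set[OF F D z, of N K] by simp
  have "ordered_prod I K * F w $ K = ordered_prod J K * F z $ K" for K
  proof (cases "\<exists>k\<in>K. Im (z $ k) = 0")
    case True
    then have "F z $ K = 0" using stem_real_zero[OF F z] by blast
    then show ?thesis by (simp add: Fw)
  next
    case False
    have "I k = (if k \<in> N then - J k else J k)" if "k \<in> K" for k
      using cases[of k] False that
      by (auto simp: N_def complex_eq_iff)
    then have "ordered_prod I K = (-1) ^ card (K \<inter> N) * ordered_prod J K"
      by (rule ordered_prod_flip)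
    then show ?thesis
      unfolding Fw by (cases "even (card (K \<inter> N))") auto
  qed
  then show ?thesis
    unfolding induced_def using wI by (simp add: Let_def)
qed

text \<open>On an invariant \<open>D\<close> the stem function of \<open>f\<close> is determined by \<open>f\<close>; values outside \<open>D\<close> are
  arbitrary and never used.\<close>

definition stem_of ::
  "'n::{finite,linorder} cvec set \<Rightarrow> ('n qvec \<Rightarrow> quat) \<Rightarrow> 'n cvec \<Rightarrow> 'n tensor" where
  "stem_of D f = (SOME F. stem_function D F \<and> (\<forall>x\<in>circularization D. f x = induced D F x))"

definition tensor_mult :: "'n::finite tensor \<Rightarrow> 'n tensor \<Rightarrow> 'n tensor" where
  "tensor_mult v w =
     (\<Sum>H\<in>UNIV. \<Sum>K\<in>UNIV. axis (sym_diff K H) ((-1) ^ card (H \<inter> K) * v $ K * w $ H))"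

definition slice_mult ::
  "'n::{finite,linorder} cvec set \<Rightarrow> ('n qvec \<Rightarrow> quat) \<Rightarrow> ('n qvec \<Rightarrow> quat)
     \<Rightarrow> 'n qvec \<Rightarrow> quat" where
  "slice_mult D f g = induced D (\<lambda>z. tensor_mult (stem_of D f z) (stem_of D g z))"

definition coord_fun :: "'n::{finite,linorder} cvec set \<Rightarrow> 'n \<Rightarrow> 'n qvec \<Rightarrow> quat" where
  "coord_fun D j =
     induced D (\<lambda>z. axis {} (of_real (Re (z $ j))) + axis {j} (of_real (Im (z $ j))))"

definition coord_prod :: "'n::{finite,linorder} cvec set \<Rightarrow> 'n set \<Rightarrow> 'n qvec \<Rightarrow> quat" where
  "coord_prod D K = foldr (\<lambda>k. slice_mult D (coord_fun D k)) (sorted_list_of_set K) (\<lambda>_. 1)"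

section \<open>Slice regularity\<close>

definition tensor_J :: "'n \<Rightarrow> 'n::finite tensor \<Rightarrow> 'n tensor" where
  "tensor_J h v = (\<Sum>K\<in>UNIV. axis (sym_diff K {h}) ((-1) ^ card (K \<inter> {h}) * v $ K))"

definition C1_on :: "'a::euclidean_space set \<Rightarrow> ('a \<Rightarrow> 'b::real_normed_vector) \<Rightarrow> bool" where
  "C1_on D F \<longleftrightarrow> (\<forall>z\<in>D. F differentiable (at z)) \<and>
     (\<forall>v. continuous_on D (\<lambda>z. frechet_derivative F (at z) v))"

definition dbar :: "'n \<Rightarrow> ('n cvec \<Rightarrow> 'n::finite tensor) \<Rightarrow> 'n cvec \<Rightarrow> 'n tensor" where
  "dbar h F z = (1/2) *\<^sub>R (frechet_derivative F (at z) (axis h 1)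
                         + tensor_J h (frechet_derivative F (at z) (axis h \<i>)))"

definition stem_holomorphic :: "'n::finite cvec set \<Rightarrow> ('n cvec \<Rightarrow> 'n tensor) \<Rightarrow> bool" where
  "stem_holomorphic D F \<longleftrightarrow> C1_on D F \<and> (\<forall>h. \<forall>z\<in>D. dbar h F z = 0)"

definition slice_regular ::
  "'n::{finite,linorder} cvec set \<Rightarrow> ('n qvec \<Rightarrow> quat) \<Rightarrow> bool" where
  "slice_regular D f \<longleftrightarrow> (\<exists>F. stem_function D F \<and> stem_holomorphic D F \<and>
     (\<forall>x\<in>circularization D. f x = induced D F x))"

section \<open>Spherical derivatives and components\<close>

definition nonreal_part :: "'n set \<Rightarrow> 'n cvec set \<Rightarrow> 'n::finite cvec set" where
  "nonreal_part H D = {z\<in>D. \<forall>h\<in>H. Im (z $ h) \<noteq> 0}"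

definition spherical_deriv ::
  "'n::{finite,linorder} cvec set \<Rightarrow> 'n set \<Rightarrow> ('n qvec \<Rightarrow> quat) \<Rightarrow> 'n qvec \<Rightarrow> quat" where
  "spherical_deriv D H f = induced (nonreal_part H D)
     (\<lambda>z. inverse (\<Prod>h\<in>H. Im (z $ h)) *\<^sub>R (\<Sum>K\<in>Pow (- H). axis K (stem_of D f z $ (K \<union> H))))"

text \<open>The continuous extension to \<open>circularization D\<close>; it is unique there because, for open \<open>D\<close>,
  \<open>circularization (nonreal_part H D)\<close> is dense in \<open>circularization D\<close>. Values outside
  \<open>circularization D\<close> are arbitrary.\<close>

definition spherical_component ::
  "'n::{finite,linorder} cvec set \<Rightarrow> nat \<Rightarrow> 'n set \<Rightarrow> ('n qvec \<Rightarrow> quat) \<Rightarrow> 'n qvec \<Rightarrow> quat" where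
  "spherical_component D m K f = (SOME g. continuous_on (circularization D) g \<and>
     (\<forall>x\<in>circularization (nonreal_part (first_idx m) D).
        g x = spherical_deriv D (first_idx m) (slice_mult D (coord_prod D K) f) x))"

section \<open>Normalized surface measure of the unit sphere\<close>

text \<open>The surface measure is the cone measure: up to normalization, a Borel set \<open>A\<close> of the unit sphere
  has the volume of the cone \<open>{t *\<^sub>R x | 0 < t \<le> 1, x \<in> A}\<close>; see \<open>emeasure_sphere_measure\<close>.
  Radial projection is \<open>sgn\<close>.\<close>

definition sphere_measure :: "quat measure" where
  "sphere_measure =
     restrict_space (distr (uniform_measure lborel (cball 0 1)) borel sgn) (sphere 0 1)"

lemma sgn_measurable [measurable]: "sgn \<in> borel_measurable (borel :: quat measure)"
proof -
  have "sgn = (\<lambda>x::quat. x /\<^sub>R norm x)"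
    by (auto simp: sgn_div_norm)
  then show ?thesis by simp
qed

lemma emeasure_sphere_measure:
  assumes "A \<in> sets borel" "A \<subseteq> sphere 0 1"
  shows "emeasure sphere_measure A =
    emeasure lborel {t *\<^sub>R x | t x. 0 < t \<and> t \<le> 1 \<and> x \<in> A} / emeasure lborel (cball (0::quat) 1)"
proof -
  have "cball 0 1 \<inter> sgn -` A = {t *\<^sub>R x | t x. 0 < t \<and> t \<le> 1 \<and> x \<in> A}" (is "?L = ?R")
  proof
    show "?L \<subseteq> ?R"
    proof
      fix x assume x: "x \<in> ?L"
      then have "x \<noteq> 0" using assms(2) by auto
      then have "x = norm x *\<^sub>R sgn x" "0 < norm x"
        by (simp_all add: sgn_div_norm)
      then show "x \<in> ?R" using x by fastforce
    qed
    show "?R \<subseteq> ?L"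
    proof
      fix y assume "y \<in> ?R"
      then obtain t x where y: "y = t *\<^sub>R x" "0 < t" "t \<le> 1" "x \<in> A" by blast
      then have "norm x = 1" using assms(2) by auto
      then show "y \<in> ?L" using y by (simp add: sgn_scaleR sgn_div_norm)
    qed
  qed
  moreover have "sgn -` A \<in> sets (borel :: quat measure)"
    using measurable_sets[OF sgn_measurable assms(1)] by simp
  ultimately show ?thesis
    unfolding sphere_measure_def using assms
    by (simp add: emeasure_restrict_space emeasure_distr)
qed

lemma prob_space_sphere_measure: "prob_space sphere_measure"
proof (rule prob_spaceI)
  have s: "space sphere_measure = sphere 0 1"
    by (simp add: sphere_measure_def space_restrict_space)
  have c: "{t *\<^sub>R x | t x. 0 < t \<and> t \<le> 1 \<and> x \<in> sphere (0::quat) 1} = cball 0 1 - {0}" (is "?L = ?R")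
  proof
    show "?R \<subseteq> ?L"
    proof
      fix x assume "x \<in> ?R"
      then have "x = norm x *\<^sub>R sgn x" "0 < norm x" "norm x \<le> 1" "sgn x \<in> sphere 0 1"
        by (simp_all add: sgn_div_norm)
      then show "x \<in> ?L" by blast
    qed
  qed (auto simp: norm_scaleR)
  have "emeasure lborel (cball (0::quat) 1 - {0}) = emeasure lborel (cball (0::quat) 1)"
    by (simp add: emeasure_Diff)
  moreover have "emeasure lborel (cball (0::quat) 1) \<noteq> 0"
    using emeasure_mono[OF ball_subset_cball[of "0::quat" 1], of lborel]
    by (metis content_ball_pos[of 1 "0::quat"] emeasure_lborel_ball_finite ennreal_0 le_zero_eq
        less_irrefl less_numeral_extra(1) measure_def enn2real_0 sets_lborel borel_closed closed_cball)
  moreover have "emeasure lborel (cball (0::quat) 1) \<noteq> \<infinity>"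
    using emeasure_lborel_cball_finite[of "0::quat" 1] by simp
  ultimately show "emeasure sphere_measure (space sphere_measure) = 1"
    unfolding s
    by (subst emeasure_sphere_measure)
       (simp_all add: c[simplified] ennreal_divide_self less_top zero_less_iff_neq_zero)
qed

end

theory Submission
  imports Defs "HOL-Complex_Analysis.Cauchy_Integral_Formula" "HOL-Real_Asymp.Real_Asymp"
begin

text \<open>
Let \<open>M\<close> be the set of the first \<open>m\<close> indices, write \<open>S\<^sub>K\<close> for the spherical components and \<open>\<beta>\<^sub>M\<close> for the product of
the imaginary parts \<open>\<beta>\<^sub>h\<close>, \<open>h \<in> M\<close>. The formula combines a pointwise identity with a mean value property.

\<^emph>\<open>Pointwise identity.\<close> The component \<open>T\<close> of the stem function of \<open>x\<^sub>K \<odot> f\<close> is, for \<open>K \<subseteq> T\<close>, the sum over \<open>P \<subseteq> K\<close>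
of \<open>\<alpha>\<^bsub>K - P\<^esub> * \<beta>\<^sub>P * F\<^bsub>T - P\<^esub>\<close> (lemma \<open>tensor_mult_coord_stem\<close>). Dividing the components \<open>L \<union> M\<close> by \<open>\<beta>\<^sub>M\<close> gives \<open>S\<^sub>K\<close> at
points without real coordinates. If this is inserted into the alternating sum of the \<open>cnj a\<^bsub>M - K\<^esub> * S\<^sub>K a\<close>,
the coefficient of \<open>F\<^bsub>L \<union> Q\<^esub>\<close> is \<open>1 / \<beta>\<^sub>Q\<close> times the ordered product of the \<open>\<alpha>\<^sub>k - cnj a\<^sub>k = J\<^sub>k * \<beta>\<^sub>k\<close>, \<open>k \<in> Q\<close>, followed
by \<open>J\<^sub>L\<close>; that is \<open>J\<^bsub>Q \<union> L\<^esub>\<close>, and the sum is \<open>f a\<close> (lemma \<open>reconstruction\<close>).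

\<^emph>\<open>Continuous extension.\<close> The identity is needed at all points, and \<open>S\<^sub>K\<close> is defined by a continuous
extension whose existence has to be shown. Substituting \<open>\<i>\<close> for each \<open>e\<^sub>h\<close> with \<open>h \<in> M\<close> turns the real coordinates
of \<open>F\<close> into complex functions that are holomorphic in every \<open>z\<^sub>h\<close>, \<open>h \<in> M\<close> (lemma \<open>holo_in_partial_char\<close>). Up to
a constant, the components of the stem function of \<open>S\<^sub>K\<close> are obtained from such a function, multiplied by \<open>z\<^sub>K\<close>,
by taking for each \<open>h \<in> M\<close> the divided difference between \<open>z\<close> and its conjugate in the variable \<open>z\<^sub>h\<close>
(lemmas \<open>antisymmetrised_coordinate_product\<close> and \<open>iterated_divided_diff\<close>). By Cauchy's formula a divided
difference is continuous also where \<open>z\<^sub>h\<close> is real, and it stays holomorphic in the other variables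
(lemmas \<open>continuous_on_divided_diff\<close> and \<open>holo_in_divided_diff\<close>).

\<^emph>\<open>Mean value property.\<close> As a function of one variable \<open>x\<^sub>h\<close> with \<open>h \<in> M\<close>, the component \<open>S\<^sub>K\<close> depends only on
\<open>\<alpha>\<^sub>h\<close> and \<open>|\<beta>\<^sub>h|\<close>, and \<open>\<beta>\<^sub>h\<close> times each real coordinate of its stem function is the odd part of a holomorphic function. The mean of such a function over
a three-sphere is its value at the centre (lemma \<open>sphere_mean\<close>): the projection of the three-sphere to
the plane of \<open>1\<close> and \<open>J\<close> is uniformly distributed in a disc (lemma \<open>sphere_projection_uniform\<close>), and an
elementary substitution on the chords of that disc turns the mean into the mean of the holomorphic function over
a disc in the complex plane. By Fubini the integral of \<open>S\<^sub>K\<close> over the product of spheres is \<open>S\<^sub>K a\<close>, and the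
pointwise identity at \<open>a\<close> is the claim.
\<close>

section \<open>Linear isometries preserve Lebesgue measure\<close>

lemma nn_integral_lborel_translate:
  fixes f :: "'a::euclidean_space \<Rightarrow> ennreal"
  assumes [measurable]: "f \<in> borel_measurable borel"
  shows "(\<integral>\<^sup>+x. f (c + x) \<partial>lborel) = (\<integral>\<^sup>+x. f x \<partial>lborel)"
proof -
  have "(\<integral>\<^sup>+x. f x \<partial>lborel) = (\<integral>\<^sup>+x. f x \<partial>distr lborel borel ((+) c))"
    by (simp add: lborel_distr_plus)
  also have "\<dots> = (\<integral>\<^sup>+x. f (c + x) \<partial>lborel)"
    by (subst nn_integral_distr) simp_all
  finally show ?thesis by simp
qed

lemma borel_measurable_linear:
  fixes T :: "'a::euclidean_space \<Rightarrow> 'b::euclidean_space"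
  shows "linear T \<Longrightarrow> T \<in> borel_measurable borel"
  by (intro borel_measurable_continuous_onI linear_continuous_on linear_conv_bounded_linear[THEN iffD1])

text \<open>Since \<open>T\<close> is onto, the image \<open>M\<close> of Lebesgue measure is translation invariant, and two translation
invariant measures are compared by convolution with a ball: with \<open>B\<close> the unit ball,
\<open>indicator A (T x) * indicator B (y - T x)\<close> is integrated over \<open>x\<close> and \<open>y\<close> in both orders. One order
gives \<open>M A\<close> times the volume of \<open>B\<close>; the other, after moving \<open>x\<close> by a preimage of \<open>y\<close>, gives the Lebesgue
measure of \<open>A\<close> times the volume of the unit ball in the domain of \<open>T\<close>. The two balls have the same
volume because the dimensions agree.\<close>

lemma lborel_distr_isometry:
  fixes T :: "'a::euclidean_space \<Rightarrow> 'b::euclidean_space"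
  assumes lin: "linear T" and iso: "\<And>x. norm (T x) = norm x" and dim: "DIM('a) = DIM('b)"
  shows "distr lborel borel T = lborel"
proof (rule measure_eqI)
  show "sets (distr lborel borel T) = sets lborel" by simp
next
  fix A assume "A \<in> sets (distr lborel borel T)"
  then have A[measurable]: "A \<in> sets borel" by simp
  have T[measurable]: "T \<in> borel_measurable borel"
    by (rule borel_measurable_linear[OF lin])
  have inj: "inj T"
    using iso by (auto simp: linear_injective_0[OF lin] dest: arg_cong[where f=norm])
  have "dim (range T) = DIM('b)"
    using dim_image_eq[OF lin, of UNIV] inj dim by (simp add: inj_on_subset)
  then have "range T = UNIV"
    by (metis dim_eq_full span_eq_iff linear_subspace_image[OF lin subspace_UNIV])
  then obtain s where s: "\<And>y. T (s y) = y" by (metis surj_def)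
  define B where "B = cball (0::'b) 1"
  have B[measurable]: "B \<in> sets borel" by (simp add: B_def)
  have ball_eq: "emeasure lborel (cball (0::'a) 1) = emeasure lborel B"
    unfolding B_def by (simp add: emeasure_cball dim)
  have B_pos: "emeasure lborel B \<noteq> 0" "emeasure lborel B \<noteq> \<infinity>"
    using emeasure_lborel_cball_finite[of "0::'b" 1] content_cball_pos[of 1 "0::'b"]
    by (auto simp: B_def measure_def)
  have "emeasure (distr lborel borel T) A * emeasure lborel B
      = (\<integral>\<^sup>+x. indicator A (T x) * emeasure lborel B \<partial>lborel)"
  proof (subst nn_integral_multc)
    have "emeasure (distr lborel borel T) A = (\<integral>\<^sup>+y. indicator A y \<partial>distr lborel borel T)"
      by simp
    also have "\<dots> = (\<integral>\<^sup>+x. indicator A (T x) \<partial>lborel)"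
      by (rule nn_integral_distr) simp_all
    finally show "emeasure (distr lborel borel T) A * emeasure lborel B
        = (\<integral>\<^sup>+x. indicator A (T x) \<partial>lborel) * emeasure lborel B" by simp
  qed simp
  also have "\<dots> = (\<integral>\<^sup>+x. \<integral>\<^sup>+y. indicator A (T x) * indicator B (- T x + y) \<partial>lborel \<partial>lborel)"
    by (intro nn_integral_cong, subst nn_integral_cmult, simp,
        subst nn_integral_lborel_translate[where f="indicator B"]) simp_all
  also have "\<dots> = (\<integral>\<^sup>+y. \<integral>\<^sup>+x. indicator A (T x) * indicator B (- T x + y) \<partial>lborel \<partial>lborel)"
    by (rule pair_sigma_finite.Fubini'[symmetric])
       (auto intro!: pair_sigma_finite.intro sigma_finite_lborel)
  also have "\<dots> = (\<integral>\<^sup>+y. \<integral>\<^sup>+x. indicator A (T x + y) * indicator B (- T x) \<partial>lborel \<partial>lborel)"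
  proof (rule nn_integral_cong)
    fix y
    show "(\<integral>\<^sup>+x. indicator A (T x) * indicator B (- T x + y) \<partial>lborel)
        = (\<integral>\<^sup>+x. indicator A (T x + y) * indicator B (- T x) \<partial>lborel)"
      using nn_integral_lborel_translate[of "\<lambda>x. indicator A (T x) * indicator B (- T x + y)" "s y"]
      by (simp add: linear_add[OF lin] s add.commute)
  qed
  also have "\<dots> = (\<integral>\<^sup>+x. \<integral>\<^sup>+y. indicator A (T x + y) * indicator B (- T x) \<partial>lborel \<partial>lborel)"
    by (rule pair_sigma_finite.Fubini')
       (auto intro!: pair_sigma_finite.intro sigma_finite_lborel)
  also have "\<dots> = (\<integral>\<^sup>+x. emeasure lborel A * indicator (cball (0::'a) 1) x \<partial>lborel)"
    by (intro nn_integral_cong, subst nn_integral_multc, simp,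
        subst nn_integral_lborel_translate[where f="indicator A"])
       (simp_all add: B_def iso indicator_def)
  also have "\<dots> = emeasure lborel A * emeasure lborel B"
    by (subst nn_integral_cmult) (auto simp: ball_eq intro!: borel_measurable_indicator)
  finally show "emeasure (distr lborel borel T) A = emeasure lborel A"
    using B_pos by (auto simp: mult.commute[of _ "emeasure lborel B"] ennreal_mult_cancel_left)
qed

section \<open>Projecting the three-sphere to a disc\<close>

lemma emeasure_cball_R2: "r \<ge> 0 \<Longrightarrow> emeasure lborel (cball (c :: real \<times> real) r) = ennreal (pi * r\<^sup>2)"
  by (simp add: emeasure_cball unit_ball_vol_2 power2_eq_square)

text \<open>Polar coordinates in the plane with the angle forgotten: the disc of radius \<open>sqrt s\<close> has area \<open>pi * s\<close>.\<close>

lemma distr_norm_sq_R2: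
  "distr lborel borel (\<lambda>w::real \<times> real. (norm w)\<^sup>2) = density lborel (\<lambda>s. ennreal pi * indicator {0..} s)"
  (is "?M = ?N")
proof (rule measure_eqI_generator_eq[where E="range atMost" and \<Omega>=UNIV and A="\<lambda>i. {..real i}"])
  have b: "sets (borel::real measure) = sigma_sets UNIV (range atMost)"
    by (subst borel_eq_atMost) simp
  show "Int_stable (range (atMost :: real \<Rightarrow> _))"
    by (auto simp: Int_stable_def)
  show "sets (?M) = sigma_sets UNIV (range atMost)"
    "sets (?N) = sigma_sets UNIV (range atMost)"
    using b by auto
  have 1: "emeasure (?M) {..s} = ennreal (pi * max 0 s)" for s :: real
  proof (cases "s \<ge> 0")
    case True
    then have "(\<lambda>w::real \<times> real. (norm w)\<^sup>2) -` {..s} = cball 0 (sqrt s)"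
      by (auto simp: real_le_rsqrt sqrt_le_D intro: real_le_rsqrt)
         (metis norm_ge_zero real_sqrt_le_iff real_sqrt_unique sqrt_le_D)
    then show ?thesis using True by (simp add: emeasure_distr emeasure_cball_R2)
  next
    case False
    then have "(\<lambda>w::real \<times> real. (norm w)\<^sup>2) -` {..s} = {}"
      by (auto simp: not_le) (meson order.strict_trans1 not_le zero_le_power2)
    then show ?thesis using False by (simp add: emeasure_distr)
  qed
  have 2: "emeasure (?N) {..s} = ennreal (pi * max 0 s)" for s :: real
  proof -
    have "emeasure (?N) {..s}
        = (\<integral>\<^sup>+t. ennreal pi * indicator {0..s} t \<partial>lborel)"
      by (subst emeasure_density) (auto intro!: nn_integral_cong simp: indicator_def)
    also have "\<dots> = ennreal (pi * max 0 s)"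
      by (subst nn_integral_cmult_indicator) (auto simp: emeasure_lborel_Icc_eq ennreal_mult' max_def)
    finally show ?thesis .
  qed
  show "emeasure (?M) X =
        emeasure (?N) X" if "X \<in> range atMost" for X
    using that 1 2 by auto
  show "emeasure (?M) {..real i} \<noteq> \<infinity>" for i
    by (simp only: 1) simp
  show "(\<Union>i. {..real i}) = UNIV"
    by (auto simp: real_arch_simple)
qed auto

lemma nn_integral_norm_sq_R2:
  assumes [measurable]: "k \<in> borel_measurable borel"
  shows "(\<integral>\<^sup>+(w::real \<times> real). k ((norm w)\<^sup>2) \<partial>lborel) = ennreal pi * (\<integral>\<^sup>+s. indicator {0..} s * k s \<partial>lborel)"
proof -
  have "(\<integral>\<^sup>+(w::real \<times> real). k ((norm w)\<^sup>2) \<partial>lborel)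
      = (\<integral>\<^sup>+s. k s \<partial>distr lborel borel (\<lambda>w::real \<times> real. (norm w)\<^sup>2))"
    by (simp add: nn_integral_distr)
  also have "\<dots> = (\<integral>\<^sup>+s. ennreal pi * (indicator {0..} s * k s) \<partial>lborel)"
    by (simp only: distr_norm_sq_R2) (simp add: nn_integral_density mult.assoc)
  finally show ?thesis by (simp add: nn_integral_cmult)
qed

lemma nn_integral_lborel_scale:
  fixes f :: "'a::euclidean_space \<Rightarrow> ennreal"
  assumes [measurable]: "f \<in> borel_measurable borel" and c: "c > 0"
  shows "(\<integral>\<^sup>+x. f x \<partial>lborel) = ennreal (c ^ DIM('a)) * (\<integral>\<^sup>+x. f (c *\<^sub>R x) \<partial>lborel)"
  using c
  by (subst lborel_affine[of c "0::'a"])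
     (simp_all add: nn_integral_density nn_integral_distr nn_integral_cmult)

lemma DIM_quat: "DIM(quat) = 4"
  by (simp add: Basis_quat_def)

text \<open>The reflection in the hyperplane orthogonal to \<open>i - J\<close>. For an imaginary unit \<open>J\<close> it exchanges \<open>i\<close> and \<open>J\<close>
and fixes the real axis. For \<open>J = i\<close> the quotient is \<open>0 / 0 = 0\<close> and the map is the identity, as it
should be.\<close>

definition swap_reflection :: "quat \<Rightarrow> quat \<Rightarrow> quat" where
  "swap_reflection J x = (let v = Quat 0 1 0 0 - J in x - (2 * inner x v / inner v v) *\<^sub>R v)"

text \<open>For an imaginary unit \<open>J\<close>, orthonormal coordinates of the quaternions whose first coordinate plane is
spanned by \<open>1\<close> and \<open>J\<close>.\<close>

definition adapted_frame :: "quat \<Rightarrow> (real \<times> real) \<times> (real \<times> real) \<Rightarrow> quat" where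
  "adapted_frame J w = swap_reflection J (Quat (fst (fst w)) (snd (fst w)) (fst (snd w)) (snd (snd w)))"

lemma linear_adapted_frame: "linear (adapted_frame J)"
proof (rule linearI)
  show "adapted_frame J (x + y) = adapted_frame J x + adapted_frame J y" for x y
  proof -
    have "Quat (fst (fst (x+y))) (snd (fst (x+y))) (fst (snd (x+y))) (snd (snd (x+y))) =
      Quat (fst (fst x)) (snd (fst x)) (fst (snd x)) (snd (snd x)) + Quat (fst (fst y)) (snd (fst y)) (fst (snd y)) (snd (snd y))"
      by (simp add: quat_eq_iff)
    then show ?thesis
      by (simp add: adapted_frame_def swap_reflection_def Let_def inner_add_left ring_distribs add_divide_distrib scaleR_add_left)
  qed
  show "adapted_frame J (c *\<^sub>R x) = c *\<^sub>R adapted_frame J x" for c x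
  proof -
    have "Quat (fst (fst (c *\<^sub>R x))) (snd (fst (c *\<^sub>R x))) (fst (snd (c *\<^sub>R x))) (snd (snd (c *\<^sub>R x))) =
      c *\<^sub>R Quat (fst (fst x)) (snd (fst x)) (fst (snd x)) (snd (snd x))"
      by (simp add: quat_eq_iff)
    then show ?thesis
      by (simp add: adapted_frame_def swap_reflection_def Let_def scaleR_diff_right mult_ac)
  qed
qed

lemma norm_swap_reflection: "norm (swap_reflection J x) = norm x"
proof -
  define v where "v = Quat 0 1 0 0 - J"
  have "inner (swap_reflection J x) (swap_reflection J x) = inner x x"
  proof (cases "v = 0")
    case False
    then have "inner v v \<noteq> 0" by simp
    then show ?thesis
      unfolding swap_reflection_def Let_def v_def[symmetric]
      by (simp add: inner_diff_left inner_diff_right inner_commute field_simps)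
  qed (simp add: swap_reflection_def Let_def v_def[symmetric])
  then show ?thesis by (simp add: norm_eq_sqrt_inner)
qed

lemma norm_adapted_frame: "norm (adapted_frame J w) = norm w"
  unfolding adapted_frame_def norm_swap_reflection
  by (simp add: norm_quat_def norm_prod_def)

lemma adapted_frame_coords:
  assumes "J \<in> imag_units"
  shows "q_re (adapted_frame J w) = fst (fst w)" "inner J (adapted_frame J w) = snd (fst w)"
proof -
  define v where "v = Quat 0 1 0 0 - J"
  have re: "q_re v = 0" using assms by (simp add: v_def imag_units_iff)
  show "q_re (adapted_frame J w) = fst (fst w)"
    unfolding adapted_frame_def swap_reflection_def Let_def v_def[symmetric] by (simp add: re)
  have J1: "inner J J = 1" using assms by (simp add: imag_units_iff norm_eq_1[symmetric])
  have Jv: "inner J v = - (inner v v / 2)"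
  proof -
    have "inner v v = 1 + inner J J - 2 * inner J (Quat 0 1 0 0)"
      unfolding v_def by (simp add: inner_diff_left inner_diff_right inner_commute) (simp add: inner_quat_def)
    then show ?thesis unfolding v_def using J1 by (simp add: inner_diff_right field_simps)
  qed
  define y where "y = Quat (fst (fst w)) (snd (fst w)) (fst (snd w)) (snd (snd w))"
  have "inner J (y - (2 * inner y v / inner v v) *\<^sub>R v) = inner J y + inner y v"
    by (cases "v = 0") (simp_all add: inner_diff_right Jv)
  also have "\<dots> = inner y (Quat 0 1 0 0)"
    unfolding v_def by (simp add: inner_diff_right inner_commute)
  also have "\<dots> = snd (fst w)" by (simp add: inner_quat_def y_def)
  finally show "inner J (adapted_frame J w) = snd (fst w)"
    unfolding adapted_frame_def swap_reflection_def Let_def v_def[symmetric] y_def .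
qed

lemma distr_adapted_frame: "distr lborel borel (adapted_frame J) = lborel"
  by (rule lborel_distr_isometry) (simp_all add: linear_adapted_frame norm_adapted_frame DIM_quat del: DIM_prod, simp)

text \<open>Archimedes' hat-box theorem, one dimension up: a pair of orthogonal coordinates of a uniformly
distributed point of the three-sphere is uniformly distributed in the disc. In adapted coordinates
\<open>(z, w)\<close>, the cone over the preimage of \<open>A\<close> consists of the points with \<open>|z|^2 + |w|^2 \<le> 1\<close> and
\<open>z / sqrt (|z|^2 + |w|^2) \<in> A\<close>. As only \<open>|w|^2\<close> enters, the substitutions \<open>t = |z|^2 + |w|^2\<close> and
\<open>z = sqrt t * \<zeta>\<close> turn its volume into a constant times the area of \<open>A\<close> inside the disc. The constant
is then determined by the total masses.\<close>

lemma sphere_projection_uniform: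
  assumes J: "J \<in> imag_units"
  shows "distr sphere_measure borel (\<lambda>x. (q_re x, inner J x)) = uniform_measure lborel (cball (0 :: real \<times> real) 1)"
proof -
  let ?P = "\<lambda>x. (q_re x, inner J x)"
  have q_re: "q_re = (\<lambda>x. inner x 1)" by (auto simp: inner_quat_def)
  have P[measurable]: "?P \<in> borel_measurable borel"
    unfolding q_re by measurable
  have sets_sph: "sets sphere_measure = sets (restrict_space borel (sphere 0 1))"
    by (simp add: sphere_measure_def sets_restrict_space)
  have P': "?P \<in> measurable sphere_measure borel"
    by (subst measurable_cong_sets[OF sets_sph refl]) (intro measurable_restrict_space1 P)
  have space: "space sphere_measure = sphere 0 1"
    by (simp add: sphere_measure_def space_restrict_space)
  define V where "V = emeasure lborel (cball (0::quat) 1)"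
  define D where "D = cball (0 :: real \<times> real) 1"
  define C where "C = ennreal pi * (\<integral>\<^sup>+t. indicator {0<..1} t * ennreal t \<partial>lborel) / V"
  have key: "emeasure (distr sphere_measure borel ?P) A = C * emeasure lborel (D \<inter> A)"
    if A[measurable]: "A \<in> sets borel" for A
  proof -
    let ?S = "?P -` A \<inter> sphere (0::quat) 1"
    let ?E = "\<lambda>z :: real \<times> real. {s. 0 < (norm z)\<^sup>2 + s \<and> (norm z)\<^sup>2 + s \<le> 1 \<and> z /\<^sub>R sqrt ((norm z)\<^sup>2 + s) \<in> A}"
    let ?H = "\<lambda>z :: real \<times> real. {t. (norm z)\<^sup>2 \<le> t \<and> 0 < t \<and> t \<le> 1 \<and> z /\<^sub>R sqrt t \<in> A}"
    have "emeasure (distr sphere_measure borel ?P) A = emeasure sphere_measure ?S"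
      using P' A by (simp add: emeasure_distr space)
    also have "\<dots> = emeasure (distr (uniform_measure lborel (cball 0 1)) borel sgn) ?S"
      unfolding sphere_measure_def
      by (subst emeasure_restrict_space) (auto intro!: sets.Int measurable_sets_borel[OF P])
    also have "\<dots> = emeasure (uniform_measure lborel (cball 0 1)) (sgn -` ?S)"
      by (subst emeasure_distr) (auto intro!: sets.Int measurable_sets_borel[OF P])
    also have "\<dots> = emeasure lborel (cball 0 1 \<inter> sgn -` ?S) / V"
      unfolding V_def
      by (subst emeasure_uniform_measure)
         (auto intro!: measurable_sets_borel[OF sgn_measurable] sets.Int measurable_sets_borel[OF P])
    also have "emeasure lborel (cball 0 1 \<inter> sgn -` ?S)
      = emeasure (distr lborel borel (adapted_frame J)) (cball 0 1 \<inter> sgn -` ?S)"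
      by (simp add: distr_adapted_frame)
    also have "\<dots> = emeasure lborel (adapted_frame J -` (cball 0 1 \<inter> sgn -` ?S))"
      by (subst emeasure_distr)
         (auto intro!: measurable_sets_borel[OF sgn_measurable] sets.Int measurable_sets_borel[OF P]
           borel_measurable_linear linear_adapted_frame)
    also have "adapted_frame J -` (cball 0 1 \<inter> sgn -` ?S)
       = {w. 0 < (norm (fst w))\<^sup>2 + (norm (snd w))\<^sup>2 \<and> (norm (fst w))\<^sup>2 + (norm (snd w))\<^sup>2 \<le> 1 \<and>
             fst w /\<^sub>R sqrt ((norm (fst w))\<^sup>2 + (norm (snd w))\<^sup>2) \<in> A}" (is "?L = ?R")
    proof (rule set_eqI)
      fix w :: "(real \<times> real) \<times> (real \<times> real)"
      have n: "norm (adapted_frame J w) = sqrt ((norm (fst w))\<^sup>2 + (norm (snd w))\<^sup>2)"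
        by (simp add: norm_adapted_frame norm_prod_def)
      have p: "?P (sgn (adapted_frame J w)) = fst w /\<^sub>R norm (adapted_frame J w)"
        using adapted_frame_coords[OF J, of w] by (simp add: sgn_div_norm prod_eq_iff)
      have "adapted_frame J w \<noteq> 0 \<longleftrightarrow> 0 < (norm (fst w))\<^sup>2 + (norm (snd w))\<^sup>2"
        using n by (metis norm_eq_zero real_sqrt_eq_zero_cancel_iff sum_power2_gt_zero_iff sum_power2_eq_zero_iff)
      moreover have "norm (sgn (adapted_frame J w)) = 1 \<longleftrightarrow> adapted_frame J w \<noteq> 0"
        by (simp add: norm_sgn)
      moreover have "norm (adapted_frame J w) \<le> 1 \<longleftrightarrow> (norm (fst w))\<^sup>2 + (norm (snd w))\<^sup>2 \<le> 1"
        unfolding n by simp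
      ultimately show "w \<in> ?L \<longleftrightarrow> w \<in> ?R"
        using p n by auto
    qed
    finally have step1: "emeasure (distr sphere_measure borel ?P) A = emeasure lborel ?R / V" .
    have R[measurable]: "?R \<in> sets (borel \<Otimes>\<^sub>M borel)"
    proof -
      have "Measurable.pred ((borel :: (real \<times> real) measure) \<Otimes>\<^sub>M (borel :: (real \<times> real) measure))
         (\<lambda>w. 0 < (norm (fst w))\<^sup>2 + (norm (snd w))\<^sup>2 \<and> (norm (fst w))\<^sup>2 + (norm (snd w))\<^sup>2 \<le> 1 \<and>
             fst w /\<^sub>R sqrt ((norm (fst w))\<^sup>2 + (norm (snd w))\<^sup>2) \<in> A)"
        by measurable
      then show ?thesis by (simp add: pred_def space_pair_measure)
    qed
    have "emeasure lborel ?R = (\<integral>\<^sup>+w. indicator ?R w \<partial>(lborel \<Otimes>\<^sub>M lborel))"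
      unfolding lborel_prod by (rule nn_integral_indicator[symmetric]) (use R[unfolded borel_prod] in simp)
    also have "\<dots> = (\<integral>\<^sup>+z. \<integral>\<^sup>+w. indicator ?R (z, w) \<partial>lborel \<partial>lborel)"
      by (subst lborel.nn_integral_fst) simp_all
    also have "\<dots> = (\<integral>\<^sup>+z. \<integral>\<^sup>+w. indicator (?E z) ((norm (w::real\<times>real))\<^sup>2) \<partial>lborel \<partial>lborel)"
      by (simp add: indicator_def)
    also have "\<dots> = (\<integral>\<^sup>+z. ennreal pi * (\<integral>\<^sup>+s. indicator {0..} s * indicator (?E z) s \<partial>lborel) \<partial>lborel)"
      by (intro nn_integral_cong nn_integral_norm_sq_R2) measurable
    also have "\<dots> = (\<integral>\<^sup>+z. ennreal pi * (\<integral>\<^sup>+t. indicator (?H z) t \<partial>lborel) \<partial>lborel)"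
    proof (rule nn_integral_cong)
      fix z :: "real \<times> real"
      have "(\<integral>\<^sup>+s. indicator {0..} s * indicator (?E z) s \<partial>lborel)
        = (\<integral>\<^sup>+t. indicator {0..} (- (norm z)\<^sup>2 + t) * indicator (?E z) (- (norm z)\<^sup>2 + t) \<partial>lborel)"
        by (rule nn_integral_lborel_translate[symmetric]) measurable
      also have "\<dots> = (\<integral>\<^sup>+t. indicator (?H z) t \<partial>lborel)"
        by (intro nn_integral_cong) (auto simp: indicator_def)
      finally show "ennreal pi * (\<integral>\<^sup>+s. indicator {0..} s * indicator (?E z) s \<partial>lborel) = ennreal pi * (\<integral>\<^sup>+t. indicator (?H z) t \<partial>lborel)"
        by (rule arg_cong)
    qed
    also have "\<dots> = ennreal pi * (\<integral>\<^sup>+z. \<integral>\<^sup>+t. indicator (?H z) t \<partial>lborel \<partial>lborel)"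
      by (rule nn_integral_cmult) measurable
    also have "(\<integral>\<^sup>+z. \<integral>\<^sup>+t. indicator (?H z) t \<partial>lborel \<partial>lborel) = (\<integral>\<^sup>+t. \<integral>\<^sup>+z. indicator (?H z) t \<partial>lborel \<partial>lborel)"
      by (rule pair_sigma_finite.Fubini'[symmetric])
         (auto intro!: pair_sigma_finite.intro sigma_finite_lborel)
    also have "\<dots> = (\<integral>\<^sup>+t. (indicator {0<..1} t * ennreal t) * emeasure lborel (D \<inter> A) \<partial>lborel)"
    proof (rule nn_integral_cong)
      fix t :: real
      show "(\<integral>\<^sup>+z. indicator (?H z) t \<partial>lborel)
          = (indicator {0<..1} t * ennreal t) * emeasure lborel (D \<inter> A)"
      proof (cases "t \<in> {0<..1}")
        case True
        then have t: "0 < t" "t \<le> 1" "sqrt t > 0" by auto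
        have "(\<integral>\<^sup>+z. indicator (?H z) t \<partial>lborel)
           = ennreal (sqrt t ^ 2) * (\<integral>\<^sup>+z. indicator (?H (sqrt t *\<^sub>R z)) t \<partial>lborel)"
          using nn_integral_lborel_scale[where f="\<lambda>z. indicator (?H z) t" and c="sqrt t" and 'a="real \<times> real"] t
          by simp
        also have "(\<integral>\<^sup>+z. indicator (?H (sqrt t *\<^sub>R z)) t \<partial>lborel)
          = (\<integral>\<^sup>+z. indicator (D \<inter> A) z \<partial>lborel)"
        proof (rule nn_integral_cong)
          fix z :: "real \<times> real"
          have "(norm (sqrt t *\<^sub>R z))\<^sup>2 \<le> t \<longleftrightarrow> t * (norm z)\<^sup>2 \<le> t * 1"
            using t by (simp add: power_mult_distrib)
          also have "\<dots> \<longleftrightarrow> norm z \<le> 1"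
            using t by (simp add: mult_le_cancel_left_pos abs_square_le_1)
          finally show "indicator (?H (sqrt t *\<^sub>R z)) t = (indicator (D \<inter> A) z :: ennreal)"
            using t by (auto simp: indicator_def D_def)
        qed
        also have "\<dots> = emeasure lborel (D \<inter> A)" by (simp add: D_def)
        finally show ?thesis using t True by simp
      qed (auto simp: indicator_def)
    qed
    also have "\<dots> = (\<integral>\<^sup>+t. indicator {0<..1} t * ennreal t \<partial>lborel) * emeasure lborel (D \<inter> A)"
      by (rule nn_integral_multc) measurable
    finally show ?thesis unfolding C_def step1 by (simp add: ennreal_times_divide mult_ac)
  qed
  interpret S: prob_space sphere_measure by (rule prob_space_sphere_measure)
  interpret PS: prob_space "distr sphere_measure borel ?P" by (rule S.prob_space_distr[OF P'])
  have "C * ennreal pi = 1"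
    using key[of UNIV] PS.emeasure_space_1 by (simp add: D_def emeasure_cball_R2 del: emeasure_cball)
  then have C: "C * x = x / ennreal pi" for x
    by (metis (no_types, lifting) ennreal_mult_divide_eq ennreal_neq_top ennreal_eq_0_iff not_le pi_gt_zero mult.commute mult.left_commute mult_1 ennreal_times_divide)
  show ?thesis
    by (rule measure_eqI)
       (simp_all add: key C emeasure_uniform_measure D_def emeasure_cball_R2 del: emeasure_cball)
qed

section \<open>Means of holomorphic functions over discs\<close>

lemma integrable_bounded_Borel:
  fixes f :: "'a \<Rightarrow> 'b::{banach, second_countable_topology}"
  assumes "prob_space M" "f \<in> borel_measurable M" "\<And>x. norm (f x) \<le> B"
  shows "integrable M f"
proof -
  interpret prob_space M by fact
  show ?thesis by (rule integrable_const_bound[of _ B]) (use assms in auto)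
qed

lemma compact_indicator_Borel_bounded:
  fixes f :: "'a::euclidean_space \<Rightarrow> 'b::euclidean_space"
  assumes "compact K" "continuous_on K f"
  shows "(\<lambda>x. indicator K x *\<^sub>R f x) \<in> borel_measurable borel"
    and "\<exists>B. \<forall>x. norm (indicator K x *\<^sub>R f x) \<le> B"
proof -
  show "(\<lambda>x. indicator K x *\<^sub>R f x) \<in> borel_measurable borel"
    by (rule borel_measurable_continuous_on_indicator) (use assms in \<open>auto intro: borel_closed compact_imp_closed\<close>)
  have "bounded (f ` K)"
    by (rule compact_imp_bounded[OF compact_continuous_image[OF assms(2,1)]])
  then obtain B where "\<forall>x\<in>K. norm (f x) \<le> B" by (auto simp: bounded_iff)
  then have "norm (indicator K x *\<^sub>R f x) \<le> max B 0" for x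
    by (cases "x \<in> K") auto
  then show "\<exists>B. \<forall>x. norm (indicator K x *\<^sub>R f x) \<le> B" by blast
qed

definition unit_disc :: "(real \<times> real) measure" where
  "unit_disc = uniform_measure lborel (cball 0 1)"

abbreviation disc_average :: "(real \<times> real \<Rightarrow> complex) \<Rightarrow> complex" where
  "disc_average g \<equiv> (\<integral>w. indicator (cball 0 1) w *\<^sub>R g w \<partial>unit_disc)"

lemma prob_space_unit_disc: "prob_space unit_disc"
  unfolding unit_disc_def
  by (rule prob_space_uniform_measure) (simp_all add: emeasure_cball_R2 del: emeasure_cball)

lemma sets_unit_disc [measurable_cong, simp]: "sets unit_disc = sets borel"
  by (simp add: unit_disc_def)

lemma AE_unit_disc: "AE w in unit_disc. w \<in> cball 0 1"
  unfolding unit_disc_def by (rule AE_uniform_measureI) auto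

lemma distr_unit_disc_isometry:
  fixes T :: "real \<times> real \<Rightarrow> real \<times> real"
  assumes lin: "linear T" and iso: "\<And>x. norm (T x) = norm x"
  shows "distr unit_disc borel T = unit_disc"
proof (rule measure_eqI)
  fix A assume "A \<in> sets (distr unit_disc borel T)"
  then have A[measurable]: "A \<in> sets borel" by simp
  have T[measurable]: "T \<in> borel_measurable borel"
    by (rule borel_measurable_linear[OF lin])
  have L: "distr lborel borel T = lborel" by (rule lborel_distr_isometry) (use assms in auto)
  have e: "T -` (cball 0 1 \<inter> A) = cball 0 1 \<inter> T -` A" by (rule set_eqI) (simp add: iso)
  have "emeasure (distr unit_disc borel T) A = emeasure unit_disc (T -` A)"
    by (subst emeasure_distr) (auto simp: unit_disc_def)
  also have "\<dots> = emeasure lborel (cball 0 1 \<inter> T -` A) / emeasure lborel (cball (0::real \<times> real) 1)"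
    unfolding unit_disc_def
    by (rule emeasure_uniform_measure) (use measurable_sets_borel[OF T A] in auto)
  also have "emeasure lborel (cball 0 1 \<inter> T -` A) = emeasure (distr lborel borel T) (cball 0 1 \<inter> A)"
    using T by (subst emeasure_distr) (simp_all add: e del: vimage_Int)
  also have "\<dots> / emeasure lborel (cball (0::real \<times> real) 1) = emeasure unit_disc A"
    unfolding L unit_disc_def by (rule emeasure_uniform_measure[symmetric]) auto
  finally show "emeasure (distr unit_disc borel T) A = emeasure unit_disc A" .
qed simp

text \<open>The radius \<open>\<rho>\<close> is a complex number, which leaves the starting point on the circle free.\<close>

lemma circle_mean:
  assumes "open S" "\<phi> holomorphic_on S" "cball z0 r \<subseteq> S" "norm \<rho> \<le> r"
  shows "(LINT t:{0..1}|lborel. \<phi> (z0 + \<rho> * exp (2 * of_real pi * \<i> * of_real t))) = \<phi> z0"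
proof -
  define f where "f = (\<lambda>\<zeta>. \<phi> (z0 + \<rho> * \<zeta>))"
  have sub: "(\<lambda>\<zeta>. z0 + \<rho> * \<zeta>) ` cball 0 1 \<subseteq> S"
  proof -
    have "z0 + \<rho> * \<zeta> \<in> cball z0 r" if "norm \<zeta> \<le> 1" for \<zeta>
      using mult_mono[OF assms(4) that] order_trans[OF norm_ge_zero assms(4)]
      by (simp add: dist_norm norm_mult)
    then show ?thesis using assms(3) by (auto simp: dist_norm)
  qed
  have hol: "f holomorphic_on cball 0 1"
    unfolding f_def
    by (rule holomorphic_on_compose_gen[of "\<lambda>\<zeta>. z0 + \<rho> * \<zeta>" _ \<phi> S, unfolded o_def])
       (use assms sub in \<open>auto intro!: holomorphic_intros\<close>)
  have "((\<lambda>u. f u / (u - 0)) has_contour_integral (2 * of_real pi * \<i> * f 0)) (circlepath 0 1)"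
    by (rule Cauchy_integral_circlepath_simple) (use hol in auto)
  then have "((\<lambda>x. f (circlepath 0 1 x) / circlepath 0 1 x *
       vector_derivative (circlepath 0 1) (at x within {0..1})) has_integral (2 * of_real pi * \<i> * f 0)) {0..1}"
    unfolding has_contour_integral_def by (rule has_integral_eq[rotated]) simp
  then have "((\<lambda>x. (2 * of_real pi * \<i>) * f (exp (2 * of_real pi * \<i> * of_real x))) has_integral (2 * of_real pi * \<i> * f 0)) {0..1}"
    by (rule has_integral_eq[rotated])
       (simp add: vector_derivative_circlepath01, simp add: circlepath mult_ac)
  then have "((\<lambda>x. (1 / (2 * of_real pi * \<i>)) * ((2 * of_real pi * \<i>) * f (exp (2 * of_real pi * \<i> * of_real x)))) has_integral
      (1 / (2 * of_real pi * \<i>)) * (2 * of_real pi * \<i> * f 0)) {0..1}"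
    by (rule has_integral_mult_right)
  then have *: "((\<lambda>x. f (exp (2 * of_real pi * \<i> * of_real x))) has_integral f 0) {0..1}"
    by simp
  have cont: "continuous_on {0..1} (\<lambda>x. f (exp (2 * of_real pi * \<i> * of_real x)))"
    by (intro continuous_on_compose2[OF holomorphic_on_imp_continuous_on[OF hol]] continuous_intros)
       (auto simp: norm_exp_eq_Re)
  have "(LINT t:{0..1}|lborel. f (exp (2 * of_real pi * \<i> * of_real t))) = integral {0..1} (\<lambda>x. f (exp (2 * of_real pi * \<i> * of_real x)))"
    by (rule set_borel_integral_eq_integral(2)[OF borel_integrable_atLeastAtMost'[OF cont]])
  then show ?thesis using integral_unique[OF *] by (simp add: f_def)
qed

definition cpair :: "real \<times> real \<Rightarrow> complex" where "cpair w = Complex (fst w) (snd w)"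

abbreviation disc_point :: "complex \<Rightarrow> real \<Rightarrow> real \<times> real \<Rightarrow> complex" where
  "disc_point z0 r w \<equiv> z0 + of_real r * cpair w"

lemma norm_cpair [simp]: "norm (cpair w) = norm w"
  by (simp add: cpair_def cmod_def norm_prod_def)

lemma continuous_on_cpair [continuous_intros]: "continuous_on A cpair"
  unfolding cpair_def Complex_eq by (intro continuous_intros)

lemma mem_cball_scaled:
  fixes z0 :: complex
  assumes "norm \<zeta> \<le> 1" "r \<ge> 0"
  shows "z0 + of_real r * \<zeta> \<in> cball z0 r"
  using mult_left_le[OF assms] assms by (simp add: dist_norm norm_mult)

lemma continuous_on_holomorphic_disc:
  assumes hol: "\<phi> holomorphic_on S" and S: "cball z0 r \<subseteq> S" and r: "r \<ge> 0"
    and g: "continuous_on A g" "\<And>x. x \<in> A \<Longrightarrow> norm (g x) \<le> 1"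
  shows "continuous_on A (\<lambda>x. \<phi> (z0 + of_real r * g x))"
  by (rule continuous_on_compose2[OF holomorphic_on_imp_continuous_on[OF hol]])
     (use S mem_cball_scaled[OF g(2) r] in \<open>auto intro!: continuous_intros g(1) simp del: mem_cball\<close>)

text \<open>The measure on the disc is invariant under rotations, so the integral does not change when it is
averaged over all of them. After exchanging the two integrations the inner integral is a mean over a
circle, hence the value at the centre.\<close>

lemma disc_mean:
  assumes S: "open S" "\<phi> holomorphic_on S" "cball z0 r \<subseteq> S" and r: "r \<ge> 0"
  shows "disc_average (\<lambda>w. \<phi> (disc_point z0 r w)) = \<phi> z0"
proof -
  interpret U: prob_space unit_disc by (rule prob_space_unit_disc)
  define I where "I = density lborel (\<lambda>t. ennreal (indicator {0..1::real} t))"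
  interpret I: prob_space I
    unfolding I_def by (rule prob_spaceI) (simp add: emeasure_density ennreal_indicator)
  have sets_I[measurable_cong, simp]: "sets I = sets borel" by (simp add: I_def)
  interpret P: pair_sigma_finite I unit_disc ..
  define e where "e t = exp (2 * of_real pi * \<i> * of_real t)" for t :: real
  have e: "norm (e t) = 1" for t by (simp add: e_def norm_exp_eq_Re)
  define K where "K = {0..1::real} \<times> cball (0::real \<times> real) 1"
  define F where "F p = indicator K p *\<^sub>R \<phi> (z0 + of_real r * (cpair (snd p) * e (fst p)))" for p :: "real \<times> real \<times> real"
  have K: "compact K" by (simp add: K_def compact_Times)
  have contF: "continuous_on K (\<lambda>p. \<phi> (z0 + of_real r * (cpair (snd p) * e (fst p))))"
  proof (rule continuous_on_holomorphic_disc[OF S(2,3) r])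
    show "continuous_on K (\<lambda>p. cpair (snd p) * e (fst p))"
      unfolding e_def by (intro continuous_intros continuous_on_compose2[OF continuous_on_cpair[of UNIV]]) auto
  qed (use e in \<open>auto simp: K_def norm_mult\<close>)
  have F_meas: "F \<in> borel_measurable (I \<Otimes>\<^sub>M unit_disc)"
    using compact_indicator_Borel_bounded(1)[OF K contF]
    unfolding F_def by (simp add: measurable_cong_sets[OF sets_pair_measure_cong[OF sets_I sets_unit_disc] refl] borel_prod)
  obtain B where B: "\<And>p. norm (F p) \<le> B"
    using compact_indicator_Borel_bounded(2)[OF K contF] unfolding F_def by blast
  have int: "integrable (I \<Otimes>\<^sub>M unit_disc) F"
    by (rule integrable_bounded_Borel[OF _ F_meas B]) (rule prob_space_pair[OF I.prob_space_axioms U.prob_space_axioms])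
  have 1: "(\<integral>t. F (t, w) \<partial>I) = indicator (cball 0 1) w *\<^sub>R \<phi> z0" for w
  proof (cases "w \<in> cball 0 1")
    case True
    have "(\<integral>t. F (t, w) \<partial>I) = (\<integral>t. indicator {0..1} t *\<^sub>R \<phi> (z0 + (of_real r * cpair w) * e t) \<partial>I)"
      using True by (intro Bochner_Integration.integral_cong) (auto simp: F_def K_def indicator_def mult_ac)
    also have "\<dots> = (LINT t:{0..1}|lborel. indicator {0..1} t *\<^sub>R \<phi> (z0 + (of_real r * cpair w) * e t))"
      unfolding I_def set_lebesgue_integral_def
    proof (rule integral_density)
      have "continuous_on {0..1} (\<lambda>t. \<phi> (z0 + (of_real r * cpair w) * e t))"
        unfolding mult.assoc
      proof (rule continuous_on_holomorphic_disc[OF S(2,3) r])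
        show "continuous_on {0..1} (\<lambda>t. cpair w * e t)" unfolding e_def by (intro continuous_intros)
      qed (use True e in \<open>auto simp: norm_mult\<close>)
      then show "(\<lambda>t. indicator {0..1} t *\<^sub>R \<phi> (z0 + of_real r * cpair w * e t)) \<in> borel_measurable lborel"
        using compact_indicator_Borel_bounded(1)[of "{0..1}" "\<lambda>t. \<phi> (z0 + (of_real r * cpair w) * e t)"] by simp
    qed auto
    also have "\<dots> = (LINT t:{0..1}|lborel. \<phi> (z0 + (of_real r * cpair w) * e t))"
      unfolding set_lebesgue_integral_def
      by (intro Bochner_Integration.integral_cong) (auto simp: indicator_def)
    also have "\<dots> = \<phi> z0"
      unfolding e_def
      by (rule circle_mean[OF S]) (use True r in \<open>auto simp: norm_mult intro: mult_left_le\<close>)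
    finally show ?thesis using True by simp
  qed (simp add: F_def K_def indicator_def)
  have 2: "(\<integral>w. F (t, w) \<partial>unit_disc) = indicator {0..1} t *\<^sub>R disc_average (\<lambda>w. \<phi> (disc_point z0 r w))" for t
  proof (cases "t \<in> {0..1}")
    case True
    define T where "T w = (Re (e t) * fst w - Im (e t) * snd w, Re (e t) * snd w + Im (e t) * fst w)" for w :: "real \<times> real"
    have emb_T: "cpair (T w) = cpair w * e t" for w
      by (simp add: cpair_def T_def complex_eq_iff algebra_simps)
    have nT: "norm (T w) = norm w" for w
      using arg_cong[OF emb_T, of norm w] e by (simp add: norm_mult)
    have lT: "linear T" by (rule linearI) (auto simp: T_def algebra_simps)
    have T[measurable]: "T \<in> borel_measurable borel"
      by (rule borel_measurable_linear[OF lT])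
    have c: "continuous_on (cball 0 1) (\<lambda>w. \<phi> (disc_point z0 r w))"
      by (rule continuous_on_holomorphic_disc[OF S(2,3) r continuous_on_cpair]) simp
    have "disc_average (\<lambda>w. \<phi> (disc_point z0 r w))
       = (\<integral>w. indicator (cball 0 1) w *\<^sub>R \<phi> (disc_point z0 r w) \<partial>distr unit_disc borel T)"
      by (simp only: distr_unit_disc_isometry[OF lT nT])
    also have "\<dots> = (\<integral>w. indicator (cball 0 1) (T w) *\<^sub>R \<phi> (disc_point z0 r (T w)) \<partial>unit_disc)"
      by (rule integral_distr) (use compact_indicator_Borel_bounded(1)[OF _ c] in simp_all)
    also have "\<dots> = (\<integral>w. F (t, w) \<partial>unit_disc)"
      using True by (intro Bochner_Integration.integral_cong) (auto simp: F_def K_def indicator_def nT emb_T)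
    finally show ?thesis using True by simp
  next
    case False
    then have "F (t, w) = 0" for w by (auto simp: F_def K_def)
    then show ?thesis using False by simp
  qed
  have "(\<integral>t. \<integral>w. F (t, w) \<partial>unit_disc \<partial>I) = (\<integral>w. \<integral>t. F (t, w) \<partial>I \<partial>unit_disc)"
    using P.Fubini_integral[of "\<lambda>t w. F (t, w)"] int by simp
  moreover have "disc_average (\<lambda>w. \<phi> z0) = \<phi> z0"
  proof -
    have "disc_average (\<lambda>w. \<phi> z0) = (\<integral>w. \<phi> z0 \<partial>unit_disc)"
      by (rule integral_cong_AE) (use AE_unit_disc in \<open>auto elim!: eventually_mono intro!: borel_measurable_scaleR borel_measurable_indicator\<close>)
    then show ?thesis using U.prob_space by simp
  qed
  moreover have "AE t in I. t \<in> {0..1}"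
    unfolding I_def by (subst AE_density) (auto simp: indicator_def)
  then have "(\<integral>t. indicator {0..1} t *\<^sub>R disc_average (\<lambda>w. \<phi> (disc_point z0 r w)) \<partial>I)
     = (\<integral>t. disc_average (\<lambda>w. \<phi> (disc_point z0 r w)) \<partial>I)"
    by (intro integral_cong_AE borel_measurable_scaleR borel_measurable_indicator borel_measurable_const)
       (simp, erule eventually_mono, simp add: indicator_def)
  ultimately show ?thesis
    using I.prob_space by (simp add: 1 2)
qed

section \<open>Means over three-spheres\<close>

text \<open>Up to constant factors both sides are the integral of \<open>U (sqrt q)\<close> over the interval from
\<open>(b - r * c)^2\<close> to \<open>(b + r * c)^2\<close>: substitute \<open>q = b^2 + 2 * b * r * t + r^2 * c^2\<close> on the left and
\<open>q = (b + r * t)^2\<close> on the right. The second substitution is not monotone if \<open>b < r * c\<close>, but what it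
traverses twice cancels.\<close>

lemma sqrt_fibre_substitution:
  fixes U :: "real \<Rightarrow> complex"
  assumes b: "b > 0" and r: "r > 0" and c: "c \<ge> 0"
    and cont: "continuous_on {max 0 (b - r * c)..b + r * c} U"
  shows "(LINT t:{-c..c}|lborel. U (sqrt (b\<^sup>2 + 2 * b * r * t + r\<^sup>2 * c\<^sup>2)))
       = (1 / b) *\<^sub>R (LINT t:{-c..c}|lborel. (b + r * t) *\<^sub>R U \<bar>b + r * t\<bar>)"
proof -
  define lo hi where "lo = max 0 (b - r * c)" and "hi = b + r * c"
  have rc: "r * c \<ge> 0" using r c by simp
  have lohi: "0 \<le> lo" "lo \<le> hi" "0 \<le> hi" "lo \<le> \<bar>b - r * c\<bar>" using b rc by (auto simp: lo_def hi_def)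
  define f where "f q = U (sqrt q)" for q
  have contf: "continuous_on {lo\<^sup>2..hi\<^sup>2} f"
    unfolding f_def
  proof (rule continuous_on_compose2[OF cont])
    show "sqrt ` {lo\<^sup>2..hi\<^sup>2} \<subseteq> {max 0 (b - r * c)..b + r * c}"
    proof
      fix q assume "q \<in> sqrt ` {lo\<^sup>2..hi\<^sup>2}"
      then obtain x where x: "q = sqrt x" "lo\<^sup>2 \<le> x" "x \<le> hi\<^sup>2" by auto
      have "sqrt (lo\<^sup>2) \<le> q" "q \<le> sqrt (hi\<^sup>2)"
        using x by (simp_all only: real_sqrt_le_mono)
      then show "q \<in> {max 0 (b - r * c)..b + r * c}"
        using lohi unfolding lo_def[symmetric] hi_def[symmetric] by simp
    qed
  qed (intro continuous_intros)
  define X where "X = integral {(b - r * c)\<^sup>2..(b + r * c)\<^sup>2} f"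
  have lo2: "lo\<^sup>2 \<le> (b - r * c)\<^sup>2" using lohi by (metis abs_le_square_iff abs_of_nonneg)
  have le: "(b - r * c)\<^sup>2 \<le> (b + r * c)\<^sup>2" using b rc by (simp add: power2_eq_square algebra_simps)
  have img1: "(\<lambda>t. b\<^sup>2 + 2 * b * r * t + r\<^sup>2 * c\<^sup>2) ` {-c..c} \<subseteq> {lo\<^sup>2..hi\<^sup>2}"
  proof -
    have "(b - r * c)\<^sup>2 \<le> b\<^sup>2 + 2 * b * r * t + r\<^sup>2 * c\<^sup>2 \<and> b\<^sup>2 + 2 * b * r * t + r\<^sup>2 * c\<^sup>2 \<le> (b + r * c)\<^sup>2"
      if "-c \<le> t" "t \<le> c" for t
    proof -
      have "(b * r) * (- c) \<le> (b * r) * t" "(b * r) * t \<le> (b * r) * c"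
        using that b r by (intro mult_left_mono; simp)+
      then show ?thesis by (simp add: power2_eq_square algebra_simps)
    qed
    then show ?thesis using lo2 unfolding hi_def by fastforce
  qed
  have abs_bounds: "lo \<le> \<bar>b + r * t\<bar> \<and> \<bar>b + r * t\<bar> \<le> hi" if "-c \<le> t" "t \<le> c" for t
  proof -
    have "r * (- c) \<le> r * t" "r * t \<le> r * c" using that r by (intro mult_left_mono; simp)+
    then show ?thesis using b rc unfolding lo_def hi_def by linarith
  qed
  have img2: "(\<lambda>t. (b + r * t)\<^sup>2) ` {-c..c} \<subseteq> {lo\<^sup>2..hi\<^sup>2}"
  proof -
    have "lo\<^sup>2 \<le> (b + r * t)\<^sup>2 \<and> (b + r * t)\<^sup>2 \<le> hi\<^sup>2" if "-c \<le> t" "t \<le> c" for t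
      using abs_bounds[OF that] lohi by (metis abs_le_square_iff abs_of_nonneg abs_ge_zero abs_abs)
    then show ?thesis by auto
  qed
  have q1: "b\<^sup>2 + 2 * b * r * (- c) + r\<^sup>2 * c\<^sup>2 = (b - r * c)\<^sup>2" "b\<^sup>2 + 2 * b * r * c + r\<^sup>2 * c\<^sup>2 = (b + r * c)\<^sup>2"
    by (simp_all add: power2_eq_square algebra_simps)
  have "((\<lambda>t. (2 * b * r) *\<^sub>R f (b\<^sup>2 + 2 * b * r * t + r\<^sup>2 * c\<^sup>2)) has_integral
      integral {b\<^sup>2 + 2 * b * r * (- c) + r\<^sup>2 * c\<^sup>2..b\<^sup>2 + 2 * b * r * c + r\<^sup>2 * c\<^sup>2} f) {-c..c}"
    by (rule has_integral_substitution[OF _ _ img1 contf])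
       (use c le q1 in \<open>auto intro!: derivative_eq_intros\<close>)
  then have h1: "((\<lambda>t. (2 * b * r) *\<^sub>R f (b\<^sup>2 + 2 * b * r * t + r\<^sup>2 * c\<^sup>2)) has_integral X) {-c..c}"
    unfolding q1 X_def .
  have "((\<lambda>t. (2 * r * (b + r * t)) *\<^sub>R f ((b + r * t)\<^sup>2)) has_integral
      integral {(b + r * (- c))\<^sup>2..(b + r * c)\<^sup>2} f) {-c..c}"
    by (rule has_integral_substitution[OF _ _ img2 contf])
       (use c le in \<open>auto intro!: derivative_eq_intros simp: algebra_simps\<close>)
  then have h2: "((\<lambda>t. (2 * r * (b + r * t)) *\<^sub>R f ((b + r * t)\<^sup>2)) has_integral X) {-c..c}"
    unfolding X_def by simp
  have c1: "continuous_on {-c..c} (\<lambda>t. f (b\<^sup>2 + 2 * b * r * t + r\<^sup>2 * c\<^sup>2))"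
    by (rule continuous_on_compose2[OF contf _ img1]) (intro continuous_intros)
  have c2: "continuous_on {-c..c} (\<lambda>t. (b + r * t) *\<^sub>R U \<bar>b + r * t\<bar>)"
  proof (intro continuous_intros continuous_on_compose2[OF cont])
    show "(\<lambda>t. \<bar>b + r * t\<bar>) ` {-c..c} \<subseteq> {max 0 (b - r * c)..b + r * c}"
      using abs_bounds unfolding lo_def hi_def by auto
  qed
  have "((\<lambda>t. f (b\<^sup>2 + 2 * b * r * t + r\<^sup>2 * c\<^sup>2)) has_integral ((1 / (2 * b * r)) *\<^sub>R X)) {-c..c}"
    using has_integral_cmul[OF h1, of "1 / (2 * b * r)"] b r by simp
  then have i1: "(LINT t:{-c..c}|lborel. f (b\<^sup>2 + 2 * b * r * t + r\<^sup>2 * c\<^sup>2)) = (1 / (2 * b * r)) *\<^sub>R X"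
    using set_borel_integral_eq_integral(2)[OF borel_integrable_atLeastAtMost'[OF c1]] by (metis integral_unique)
  have "((\<lambda>t. (b + r * t) *\<^sub>R U \<bar>b + r * t\<bar>) has_integral ((1 / (2 * r)) *\<^sub>R X)) {-c..c}"
    using has_integral_cmul[OF h2, of "1 / (2 * r)"] r by (simp add: f_def)
  then have i2: "(LINT t:{-c..c}|lborel. (b + r * t) *\<^sub>R U \<bar>b + r * t\<bar>) = (1 / (2 * r)) *\<^sub>R X"
    using set_borel_integral_eq_integral(2)[OF borel_integrable_atLeastAtMost'[OF c2]] by (metis integral_unique)
  show ?thesis using i1 b r unfolding i2 f_def by simp
qed

lemma unit_disc_integral_eqI:
  fixes f g :: "real \<times> real \<Rightarrow> complex"
  assumes f: "continuous_on (cball 0 1) f" and g: "continuous_on (cball 0 1) g"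
    and eq: "\<And>s c. \<lbrakk>\<bar>s\<bar> \<le> 1; c = sqrt (1 - s\<^sup>2)\<rbrakk> \<Longrightarrow>
        (LINT t:{-c..c}|lborel. f (s, t)) = (LINT t:{-c..c}|lborel. g (s, t))"
  shows "disc_average (\<lambda>w. f w) = disc_average (\<lambda>w. g w)"
proof -
  have dens: "unit_disc = density lborel (\<lambda>w::real \<times> real. ennreal (indicator (cball 0 1) w / pi))"
    unfolding unit_disc_def uniform_measure_def
  proof (rule arg_cong[where f="density lborel"], rule ext)
    fix w :: "real \<times> real"
    have "emeasure lborel (cball (0 :: real \<times> real) 1) = ennreal pi"
      using emeasure_cball_R2[of 1 0] by simp
    moreover have "ennreal (1 / pi) = 1 / ennreal pi"
      by (metis divide_ennreal ennreal_1 pi_gt_zero zero_le_one)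
    ultimately show "indicator (cball 0 1) w / emeasure lborel (cball (0 :: real \<times> real) 1) = ennreal (indicator (cball 0 1) w / pi)"
      by (cases "w \<in> cball 0 1") simp_all
  qed
  have *: "disc_average (\<lambda>w. h w)
      = (1 / pi) *\<^sub>R (\<integral>s. indicator {-1..1} s *\<^sub>R (LINT t:{- sqrt (1 - s\<^sup>2)..sqrt (1 - s\<^sup>2)}|lborel. h (s, t)) \<partial>lborel)"
    if h: "continuous_on (cball 0 1) h" for h :: "real \<times> real \<Rightarrow> complex"
  proof -
    have m: "(\<lambda>w. indicator (cball 0 1) w *\<^sub>R h w) \<in> borel_measurable borel"
      by (rule compact_indicator_Borel_bounded(1)[OF _ h]) simp
    have "disc_average (\<lambda>w. h w)
        = (\<integral>w. (indicator (cball 0 1) w / pi) *\<^sub>R (indicator (cball 0 1) w *\<^sub>R h w) \<partial>lborel)"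
      unfolding dens by (rule integral_density)
         (use m in \<open>auto intro!: borel_measurable_divide borel_measurable_indicator\<close>)
    also have "\<dots> = (\<integral>w. (1 / pi) *\<^sub>R (indicator (cball 0 1) w *\<^sub>R h w) \<partial>lborel)"
      by (intro Bochner_Integration.integral_cong) (auto simp: indicator_def)
    also have "\<dots> = (1 / pi) *\<^sub>R (\<integral>w. indicator (cball 0 1) w *\<^sub>R h w \<partial>lborel)"
      by (rule integral_scaleR_right)
    also have "(\<integral>w. indicator (cball 0 1) w *\<^sub>R h w \<partial>lborel) = (\<integral>w. indicator (cball 0 1) w *\<^sub>R h w \<partial>(lborel \<Otimes>\<^sub>M lborel))"
      by (simp add: lborel_prod)
    also have "\<dots> = (\<integral>s. \<integral>t. indicator (cball 0 1) (s, t) *\<^sub>R h (s, t) \<partial>lborel \<partial>lborel)"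
    proof (rule lborel_pair.integral_fst'[symmetric])
      show "integrable (lborel \<Otimes>\<^sub>M lborel) (\<lambda>w. indicator (cball 0 1) w *\<^sub>R h w)"
        unfolding lborel_prod using borel_integrable_compact[OF _ h] by simp
    qed
    also have "\<dots> = (\<integral>s. indicator {-1..1} s *\<^sub>R (LINT t:{- sqrt (1 - s\<^sup>2)..sqrt (1 - s\<^sup>2)}|lborel. h (s, t)) \<partial>lborel)"
    proof (rule Bochner_Integration.integral_cong[OF refl])
      fix s :: real
      have mem: "(s, t) \<in> cball 0 1 \<longleftrightarrow> s\<^sup>2 + t\<^sup>2 \<le> 1" for t
        by (simp add: norm_prod_def)
      show "(\<integral>t. indicator (cball 0 1) (s, t) *\<^sub>R h (s, t) \<partial>lborel)
          = indicator {-1..1} s *\<^sub>R (LINT t:{- sqrt (1 - s\<^sup>2)..sqrt (1 - s\<^sup>2)}|lborel. h (s, t))"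
      proof (cases "s \<in> {-1..1}")
        case True
        then have s: "s\<^sup>2 \<le> 1" by (simp add: abs_square_le_1 abs_le_iff)
        have mem': "(s, t) \<in> cball 0 1 \<longleftrightarrow> t \<in> {- sqrt (1 - s\<^sup>2)..sqrt (1 - s\<^sup>2)}" for t
        proof -
          have "(s, t) \<in> cball 0 1 \<longleftrightarrow> \<bar>t\<bar> \<le> sqrt (1 - s\<^sup>2)"
          proof -
            have "\<bar>t\<bar> \<le> sqrt (1 - s\<^sup>2) \<longleftrightarrow> t\<^sup>2 \<le> 1 - s\<^sup>2"
              using real_le_rsqrt[of "\<bar>t\<bar>" "1 - s\<^sup>2"] sqrt_ge_absD[of t "1 - s\<^sup>2"]
              unfolding power2_abs by blast
            then show ?thesis unfolding mem by linarith
          qed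
          then show ?thesis by (simp add: abs_le_iff) linarith
        qed
        have "indicator (cball 0 1) (s, t) = (indicator {- sqrt (1 - s\<^sup>2)..sqrt (1 - s\<^sup>2)} t :: real)" for t
          using mem'[of t] by (simp only: indicator_def)
        moreover have "indicator {-1..1} s = (1::real)" using True by (rule indicator_simps(1))
        ultimately show ?thesis by (simp only: set_lebesgue_integral_def scaleR_one)
      next
        case False
        then have "\<not> \<bar>s\<bar> \<le> 1" by (simp add: abs_le_iff) linarith
        then have "\<not> s\<^sup>2 \<le> 1" using abs_square_le_1[of s] by blast
        then have "\<not> s\<^sup>2 + t\<^sup>2 \<le> 1" for t :: real using zero_le_power2[of t] by linarith
        then have "(s, t) \<notin> cball 0 1" for t :: real unfolding mem .
        then have "indicator (cball 0 1) (s, t) = (0::real)" for t :: real by (rule indicator_simps(2))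
        moreover have "indicator {-1..1} s = (0::real)" using False by (rule indicator_simps(2))
        ultimately show ?thesis
          by (simp only: scaleR_zero_left Bochner_Integration.integral_zero)
      qed
    qed
    finally show ?thesis .
  qed
  show ?thesis
    unfolding *[OF f] *[OF g]
  proof (intro arg_cong[where f="\<lambda>x. (1 / pi) *\<^sub>R x"] Bochner_Integration.integral_cong refl)
    fix s :: real
    show "indicator {-1..1} s *\<^sub>R (LINT t:{- sqrt (1 - s\<^sup>2)..sqrt (1 - s\<^sup>2)}|lborel. f (s, t))
        = indicator {-1..1} s *\<^sub>R (LINT t:{- sqrt (1 - s\<^sup>2)..sqrt (1 - s\<^sup>2)}|lborel. g (s, t))"
    proof (cases "s \<in> {-1..1}")
      case True
      then have "\<bar>s\<bar> \<le> 1" by (simp add: abs_le_iff)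
      from eq[OF this refl] show ?thesis by (rule arg_cong)
    next
      case False
      then have "indicator {-1..1} s = (0::real)" by (rule indicator_simps(2))
      then show ?thesis by (simp only: scaleR_zero_left)
    qed
  qed
qed

definition im_part :: "quat \<Rightarrow> quat" where "im_part x = x - of_real (q_re x)"

text \<open>The set of all \<open>\<alpha> + J * \<beta>\<close> with \<open>J\<close> an imaginary unit is a two-sphere; it is represented by its point in
the closed upper half plane.\<close>

definition upper :: "quat \<Rightarrow> complex" where "upper x = Complex (q_re x) (norm (im_part x))"

lemma q_re_inner: "q_re x = inner x 1"
  by (simp add: inner_quat_def)

lemma continuous_on_q_re [continuous_intros]: "continuous_on A f \<Longrightarrow> continuous_on A (\<lambda>x. q_re (f x))"
  unfolding q_re_inner by (intro continuous_intros)

lemma continuous_on_upper: "continuous_on A upper"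
  unfolding upper_def im_part_def Complex_eq by (intro continuous_intros)

lemma im_part_simps [simp]: "q_re (im_part x) = 0" "im_part (x + y) = im_part x + im_part y"
   "im_part (c *\<^sub>R x) = c *\<^sub>R im_part x"
  by (simp_all add: im_part_def quat_eq_iff)

lemma norm_sq_split: "(norm x)\<^sup>2 = (q_re x)\<^sup>2 + (norm (im_part x))\<^sup>2"
  by (simp add: norm_quat_def im_part_def)

lemma norm_sq_add: "(norm (x + y))\<^sup>2 = (norm x)\<^sup>2 + 2 * inner x y + (norm y)\<^sup>2" for x y :: "'a::real_inner"
  by (simp add: power2_norm_eq_inner inner_add_left inner_add_right inner_commute)

lemma inner_im_part: "q_re J = 0 \<Longrightarrow> inner J (im_part y) = inner J y"
  by (simp add: inner_quat_def im_part_def)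

lemma sets_sphere_measure: "sets sphere_measure = sets (restrict_space borel (sphere 0 1))"
  by (simp add: sphere_measure_def sets_restrict_space)

lemma space_sphere_measure: "space sphere_measure = sphere 0 1"
  by (simp add: sphere_measure_def space_restrict_space)

lemma measurable_sphere_continuous:
  fixes f :: "quat \<Rightarrow> 'b::euclidean_space"
  assumes "continuous_on (sphere 0 1) f"
  shows "f \<in> borel_measurable sphere_measure"
  by (subst measurable_cong_sets[OF sets_sphere_measure refl])
     (rule borel_measurable_continuous_on_restrict[OF assms])

text \<open>The disc is the section of the ball by the plane through the real axis and the centre.\<close>

lemma disc_subset_if_ball_subset:
  assumes cnj: "\<And>z. z \<in> S \<Longrightarrow> cnj z \<in> S" and incl: "\<And>x. x \<in> cball a r \<Longrightarrow> upper x \<in> S"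
    and a: "im_part a \<noteq> 0"
  shows "cball (upper a) r \<subseteq> S"
proof
  fix w assume w: "w \<in> cball (upper a) r"
  define b where "b = norm (im_part a)"
  define J where "J = im_part a /\<^sub>R b"
  have J: "q_re J = 0" "norm J = 1" and bJ: "im_part a = b *\<^sub>R J" using a by (simp_all add: J_def b_def)
  define x where "x = of_real (Re w) + Im w *\<^sub>R J"
  have imx: "im_part x = Im w *\<^sub>R J" and rex: "q_re x = Re w" using J by (simp_all add: x_def im_part_def)
  have "(norm (x - a))\<^sup>2 = (Re w - q_re a)\<^sup>2 + (norm (im_part (x - a)))\<^sup>2"
    unfolding norm_sq_split[of "x - a"] by (simp add: rex)
  also have "im_part (x - a) = (Im w - b) *\<^sub>R J"
    using imx bJ by (simp add: im_part_def algebra_simps)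
  also have "(Re w - q_re a)\<^sup>2 + (norm ((Im w - b) *\<^sub>R J))\<^sup>2 = (norm (w - upper a))\<^sup>2"
    using J by (simp add: cmod_power2 upper_def b_def)
  finally have "norm (x - a) = norm (w - upper a)" by simp
  then have "x \<in> cball a r" using w by (simp add: dist_norm norm_minus_commute)
  from incl[OF this] have up: "Complex (Re w) \<bar>Im w\<bar> \<in> S" using J by (simp add: upper_def rex imx)
  show "w \<in> S"
  proof (cases "Im w \<ge> 0")
    case False
    then have "cnj (Complex (Re w) \<bar>Im w\<bar>) = w" by (simp add: complex_eq_iff)
    then show ?thesis using cnj[OF up] by simp
  qed (use up in simp)
qed

lemma upper_on_sphere:
  assumes a: "im_part a = b *\<^sub>R J" and J: "J \<in> imag_units" and y: "norm y = 1"
  shows "upper (a + r *\<^sub>R y) = Complex (q_re a + r * q_re y)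
      (sqrt (b\<^sup>2 + 2 * b * r * inner J y + r\<^sup>2 * (1 - (q_re y)\<^sup>2)))"
    and "(q_re y, inner J y) \<in> cball 0 1"
proof -
  have J: "q_re J = 0" "norm J = 1" using J by (simp_all add: imag_units_iff)
  have iy: "(norm (im_part y))\<^sup>2 = 1 - (q_re y)\<^sup>2" using norm_sq_split[of y] y by simp
  have "(norm (im_part (a + r *\<^sub>R y)))\<^sup>2 = (norm (b *\<^sub>R J + r *\<^sub>R im_part y))\<^sup>2" by (simp add: a)
  also have "\<dots> = b\<^sup>2 + 2 * b * r * inner J y + r\<^sup>2 * (1 - (q_re y)\<^sup>2)"
    unfolding norm_sq_add using J iy inner_im_part[of J y] by (simp add: power_mult_distrib)
  finally have "norm (im_part (a + r *\<^sub>R y)) = sqrt (b\<^sup>2 + 2 * b * r * inner J y + r\<^sup>2 * (1 - (q_re y)\<^sup>2))"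
    by (metis norm_ge_zero real_sqrt_unique)
  then show "upper (a + r *\<^sub>R y) = Complex (q_re a + r * q_re y)
      (sqrt (b\<^sup>2 + 2 * b * r * inner J y + r\<^sup>2 * (1 - (q_re y)\<^sup>2)))"
    by (simp add: upper_def)
  have "\<bar>inner J y\<bar> \<le> norm (im_part y)"
    using Cauchy_Schwarz_ineq2[of J "im_part y"] J inner_im_part[of J y] by simp
  then have "(inner J y)\<^sup>2 \<le> (norm (im_part y))\<^sup>2" by (metis abs_ge_zero power2_abs power_mono)
  then show "(q_re y, inner J y) \<in> cball 0 1" using iy by (simp add: norm_prod_def)
qed

lemma chord_subset_disc:
  assumes c: "c\<^sup>2 = 1 - s\<^sup>2" and r: "r > 0" and q: "\<bar>q - b\<bar> \<le> r * c"
  shows "Complex (\<alpha> + r * s) q \<in> cball (Complex \<alpha> b) r"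
proof -
  have "(q - b)\<^sup>2 \<le> (r * c)\<^sup>2" using q by (metis abs_ge_zero power2_abs power_mono)
  then have "(r * s)\<^sup>2 + (q - b)\<^sup>2 \<le> r\<^sup>2" using c by (simp add: power_mult_distrib algebra_simps)
  then have "(norm (Complex (\<alpha> + r * s) q - Complex \<alpha> b))\<^sup>2 \<le> r\<^sup>2" by (simp add: cmod_power2)
  then show ?thesis using r by (simp add: power2_le_iff_abs_le dist_norm norm_minus_commute)
qed

text \<open>By \<open>sphere_projection_uniform\<close> the mean over the three-sphere is the mean over the unit disc of
\<open>u (\<alpha> + r * s + i * sqrt (b^2 + 2 * b * r * t + r^2 * (1 - s^2)))\<close>. On every chord \<open>s = const\<close>,
\<open>sqrt_fibre_substitution\<close> exchanges this integrand, without changing the integral, for \<open>1 / b\<close> times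
\<open>\<beta> * u = (\<phi> - \<phi> \<circ> cnj) / (2 * i)\<close> at the point \<open>\<alpha> + r * s + i * (b + r * t)\<close>. What remains is the mean of
a holomorphic and of an antiholomorphic function over a disc in the complex plane.\<close>

lemma sphere_mean_nonreal_centre:
  assumes S: "open S" and cnj: "\<And>z. z \<in> S \<Longrightarrow> cnj z \<in> S"
    and hol: "\<phi> holomorphic_on S" and u: "continuous_on S u"
    and eq: "\<And>z. z \<in> S \<Longrightarrow> 2 * \<i> * of_real (Im z) * u z = \<phi> z - \<phi> (cnj z)"
    and incl: "\<And>x. x \<in> cball a r \<Longrightarrow> upper x \<in> S"
    and r: "r > 0" and a: "im_part a \<noteq> 0"
  shows "(\<integral>y. u (upper (a + r *\<^sub>R y)) \<partial>sphere_measure) = u (upper a)"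
proof -
  interpret \<sigma>: prob_space sphere_measure by (rule prob_space_sphere_measure)
  define b where "b = norm (im_part a)"
  define J where "J = im_part a /\<^sub>R b"
  define \<alpha> where "\<alpha> = q_re a"
  define z0 where "z0 = Complex \<alpha> b"
  have b: "b > 0" using a by (simp add: b_def)
  have J: "J \<in> imag_units" using a by (simp add: imag_units_iff J_def b_def)
  have bJ: "im_part a = b *\<^sub>R J" using b by (simp add: J_def)
  have J': "q_re J = 0" "norm J = 1" using J by (simp_all add: imag_units_iff)
  have upper_a: "upper a = z0" by (simp add: upper_def z0_def b_def \<alpha>_def)
  have disc: "cball z0 r \<subseteq> S"
    unfolding upper_a[symmetric] by (rule disc_subset_if_ball_subset[OF cnj incl a])
  have cdisc: "cball (cnj z0) r \<subseteq> S"
  proof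
    fix w assume "w \<in> cball (cnj z0) r"
    then have "cnj w \<in> cball z0 r"
      by (metis complex_cnj_cnj complex_cnj_diff complex_mod_cnj dist_norm mem_cball)
    then show "w \<in> S" using disc cnj by (metis complex_cnj_cnj subsetD)
  qed
  have even: "u (Complex x \<bar>y\<bar>) * of_real y = (\<phi> (Complex x y) - \<phi> (cnj (Complex x y))) / (2 * \<i>)"
    if "Complex x y \<in> S" for x y
  proof (cases "y \<ge> 0")
    case True
    then show ?thesis using eq[OF that] by (simp add: field_simps)
  next
    case False
    then have c: "cnj (Complex x y) = Complex x \<bar>y\<bar>" "cnj (Complex x \<bar>y\<bar>) = Complex x y"
      by (simp_all add: complex_eq_iff)
    show ?thesis using eq[OF cnj[OF that]] False unfolding c by (simp add: field_simps)
  qed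
  define W where "W w = Complex (\<alpha> + r * fst w) (sqrt (b\<^sup>2 + 2 * b * r * snd w + r\<^sup>2 * (1 - (fst w)\<^sup>2)))" for w :: "real \<times> real"
  have W_upper: "upper (a + r *\<^sub>R y) = W (q_re y, inner J y)" and y_disc: "(q_re y, inner J y) \<in> cball 0 1"
    if "norm y = 1" for y
    using upper_on_sphere(1)[OF bJ J that, of r] upper_on_sphere(2)[OF bJ J that]
    by (simp_all add: W_def \<alpha>_def)
  have W_disc: "W (s, t) \<in> cball z0 r" if st: "(s, t) \<in> cball 0 1" for s t
  proof -
    have st': "s\<^sup>2 + t\<^sup>2 \<le> 1" using st by (simp add: norm_prod_def)
    define c where "c = sqrt (1 - s\<^sup>2)"
    have s1: "s\<^sup>2 \<le> 1" using st' zero_le_power2[of t] by linarith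
    then have c2: "c\<^sup>2 = 1 - s\<^sup>2" and c0: "c \<ge> 0" by (simp_all add: c_def)
    have tc: "\<bar>t\<bar> \<le> c" unfolding c_def using st' by (intro real_le_rsqrt) simp
    have br: "b * r > 0" using b r by simp
    have "(b * r) * (- c) \<le> (b * r) * t" "(b * r) * t \<le> (b * r) * c"
      using tc br by (intro mult_left_mono; simp add: abs_le_iff)+
    then have lo: "(b - r * c)\<^sup>2 \<le> b\<^sup>2 + 2 * b * r * t + r\<^sup>2 * c\<^sup>2" and hi: "b\<^sup>2 + 2 * b * r * t + r\<^sup>2 * c\<^sup>2 \<le> (b + r * c)\<^sup>2"
      by (simp_all add: power2_eq_square algebra_simps)
    define q where "q = sqrt (b\<^sup>2 + 2 * b * r * t + r\<^sup>2 * c\<^sup>2)"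
    \<comment> \<open>the values of the square root on a chord stay within the corresponding chord of the disc\<close>
    have "\<bar>b - r * c\<bar> \<le> q" unfolding q_def using lo by (intro real_le_rsqrt) simp
    moreover have "q \<le> b + r * c" unfolding q_def using hi b r c0 by (intro real_le_lsqrt) auto
    ultimately have "\<bar>q - b\<bar> \<le> r * c" by linarith
    then show ?thesis
      using chord_subset_disc[OF c2 r, of q b \<alpha>] unfolding W_def z0_def q_def c2 by simp
  qed
  have contW: "continuous_on (cball 0 1) (\<lambda>w. u (W w))"
  proof (rule continuous_on_compose2[OF u])
    show "continuous_on (cball 0 1) W"
      unfolding W_def Complex_eq by (intro continuous_intros)
    show "W ` cball 0 1 \<subseteq> S" using W_disc disc by (metis (no_types, lifting) image_subsetI subsetD surj_pair)
  qed
  define h where "h w = (\<phi> w - \<phi> (cnj w)) / (2 * \<i>)" for w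
  have emb_disc: "disc_point z0 r w \<in> S" if "w \<in> cball 0 1" for w
    using mem_cball_scaled[of "cpair w" r z0] that r disc by auto
  have cemb: "continuous_on (cball 0 1) (\<lambda>w. \<phi> (disc_point z0 r w))"
    by (rule continuous_on_holomorphic_disc[OF hol disc _ continuous_on_cpair]) (use r in auto)
  have cemb': "continuous_on (cball 0 1) (\<lambda>w. \<phi> (cnj (disc_point z0 r w)))"
  proof -
    have "continuous_on (cball 0 1) (\<lambda>w. \<phi> (cnj z0 + of_real r * cnj (cpair w)))"
      by (rule continuous_on_holomorphic_disc[OF hol cdisc]) (use r in \<open>auto intro!: continuous_intros\<close>)
    then show ?thesis by simp
  qed
  have conth: "continuous_on (cball 0 1) (\<lambda>w. h (disc_point z0 r w))"
    unfolding h_def by (intro continuous_intros cemb cemb') simp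
  have "(\<integral>y. u (upper (a + r *\<^sub>R y)) \<partial>sphere_measure)
      = (\<integral>y. indicator (cball 0 1) (q_re y, inner J y) *\<^sub>R u (W (q_re y, inner J y)) \<partial>sphere_measure)"
    by (intro Bochner_Integration.integral_cong refl)
       (use W_upper y_disc in \<open>auto simp: space_sphere_measure\<close>)
  also have "\<dots> = (\<integral>w. indicator (cball 0 1) w *\<^sub>R u (W w) \<partial>distr sphere_measure borel (\<lambda>y. (q_re y, inner J y)))"
  proof (rule integral_distr[symmetric])
    show "(\<lambda>y. (q_re y, inner J y)) \<in> measurable sphere_measure borel"
      by (rule measurable_sphere_continuous) (intro continuous_intros)
    show "(\<lambda>w. indicator (cball 0 1) w *\<^sub>R u (W w)) \<in> borel_measurable borel"
      by (rule compact_indicator_Borel_bounded(1)[OF _ contW]) simp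
  qed
  also have "\<dots> = disc_average (\<lambda>w. u (W w))"
    by (simp add: sphere_projection_uniform[OF J] unit_disc_def)
  also have "\<dots> = disc_average (\<lambda>w. ((1 / b) *\<^sub>R h (disc_point z0 r w)))"
  proof (rule unit_disc_integral_eqI[OF contW])
    show "continuous_on (cball 0 1) (\<lambda>w. (1 / b) *\<^sub>R h (disc_point z0 r w))"
      by (intro continuous_intros conth)
    fix s c :: real assume s: "\<bar>s\<bar> \<le> 1" and c: "c = sqrt (1 - s\<^sup>2)"
    have s2: "s\<^sup>2 \<le> 1" using s by (simp add: abs_square_le_1)
    then have c2: "c\<^sup>2 = 1 - s\<^sup>2" and c0: "c \<ge> 0" by (simp_all add: c)
    define U where "U q = u (Complex (\<alpha> + r * s) q)" for q
    have U: "continuous_on {max 0 (b - r * c)..b + r * c} U"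
      unfolding U_def
    proof (rule continuous_on_compose2[OF u])
      show "continuous_on {max 0 (b - r * c)..b + r * c} (Complex (\<alpha> + r * s))"
        unfolding Complex_eq by (intro continuous_intros)
      have "Complex (\<alpha> + r * s) q \<in> cball z0 r" if "b - r * c \<le> q" "q \<le> b + r * c" for q
        unfolding z0_def by (rule chord_subset_disc[OF c2 r]) (use that in linarith)
      then show "Complex (\<alpha> + r * s) ` {max 0 (b - r * c)..b + r * c} \<subseteq> S" using disc by auto
    qed
    have "(LINT t:{-c..c}|lborel. u (W (s, t))) = (LINT t:{-c..c}|lborel. U (sqrt (b\<^sup>2 + 2 * b * r * t + r\<^sup>2 * c\<^sup>2)))"
      by (simp add: W_def U_def c2)
    also have "\<dots> = (1 / b) *\<^sub>R (LINT t:{-c..c}|lborel. (b + r * t) *\<^sub>R U \<bar>b + r * t\<bar>)"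
      by (rule sqrt_fibre_substitution[OF b r c0 U])
    also have "(LINT t:{-c..c}|lborel. (b + r * t) *\<^sub>R U \<bar>b + r * t\<bar>) = (LINT t:{-c..c}|lborel. h (disc_point z0 r (s, t)))"
    proof (rule set_lebesgue_integral_cong)
      show "\<forall>t. t \<in> {-c..c} \<longrightarrow> (b + r * t) *\<^sub>R U \<bar>b + r * t\<bar> = h (disc_point z0 r (s, t))"
      proof (intro allI impI)
        fix t assume "t \<in> {-c..c}"
        then have "\<bar>t\<bar> \<le> c" by auto
        then have "t\<^sup>2 \<le> c\<^sup>2" by (metis abs_ge_zero power2_abs power_mono)
        then have "(s, t) \<in> cball 0 1" using c2 by (simp add: norm_prod_def)
        moreover have "disc_point z0 r (s, t) = Complex (\<alpha> + r * s) (b + r * t)"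
          by (simp add: z0_def cpair_def complex_eq_iff)
        ultimately show "(b + r * t) *\<^sub>R U \<bar>b + r * t\<bar> = h (disc_point z0 r (s, t))"
          using even[of "\<alpha> + r * s" "b + r * t"] emb_disc[of "(s, t)"]
          by (simp add: h_def U_def scaleR_conv_of_real mult.commute)
      qed
    qed simp
    finally show "(LINT t:{-c..c}|lborel. u (W (s, t))) = (LINT t:{-c..c}|lborel. (1 / b) *\<^sub>R h (disc_point z0 r (s, t)))"
      by simp
  qed
  also have "\<dots> = (\<integral>w. (1 / (2 * \<i> * of_real b)) * (indicator (cball 0 1) w *\<^sub>R \<phi> (disc_point z0 r w)
          - indicator (cball 0 1) w *\<^sub>R \<phi> (cnj (disc_point z0 r w))) \<partial>unit_disc)"
    using b by (intro Bochner_Integration.integral_cong refl) (auto simp: h_def indicator_def scaleR_conv_of_real field_simps)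
  also have "\<dots> = (1 / (2 * \<i> * of_real b)) * (disc_average (\<lambda>w. \<phi> (disc_point z0 r w))
          - disc_average (\<lambda>w. \<phi> (cnj (disc_point z0 r w))))"
  proof -
    have int: "integrable unit_disc (\<lambda>w. indicator (cball 0 1) w *\<^sub>R k w)" if kc: "continuous_on (cball 0 1) k" for k :: "real \<times> real \<Rightarrow> complex"
    proof -
      obtain B where B: "\<And>w. norm (indicator (cball 0 1) w *\<^sub>R k w) \<le> B"
        using compact_indicator_Borel_bounded(2)[OF compact_cball kc] by blast
      have "(\<lambda>w. indicator (cball 0 1) w *\<^sub>R k w) \<in> borel_measurable unit_disc"
        using compact_indicator_Borel_bounded(1)[OF compact_cball kc]
        by (simp add: measurable_cong_sets[OF sets_unit_disc refl])
      then show ?thesis by (rule integrable_bounded_Borel[OF prob_space_unit_disc _ B])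
    qed
    show ?thesis
      by (subst integral_mult_right_zero, subst Bochner_Integration.integral_diff[OF int[OF cemb] int[OF cemb']]) (rule refl)
  qed
  also have "disc_average (\<lambda>w. \<phi> (disc_point z0 r w)) = \<phi> z0"
    by (rule disc_mean[OF S hol disc]) (use r in simp)
  also have "disc_average (\<lambda>w. \<phi> (cnj (disc_point z0 r w))) = \<phi> (cnj z0)"
  proof -
    define T where "T w = (fst w, - snd w)" for w :: "real \<times> real"
    have T: "linear T" "\<And>w. norm (T w) = norm w"
      by (auto intro!: linearI simp: T_def norm_prod_def)
    have "disc_average (\<lambda>w. \<phi> (cnj (disc_point z0 r w)))
        = (\<integral>w. indicator (cball 0 1) w *\<^sub>R \<phi> (cnj (disc_point z0 r w)) \<partial>distr unit_disc borel T)"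
      by (simp only: distr_unit_disc_isometry[OF T])
    also have "\<dots> = (\<integral>w. indicator (cball 0 1) (T w) *\<^sub>R \<phi> (cnj (disc_point z0 r (T w))) \<partial>unit_disc)"
    proof (rule integral_distr)
      show "T \<in> measurable unit_disc borel"
        unfolding measurable_cong_sets[OF sets_unit_disc refl]
        by (rule borel_measurable_linear[OF T(1)])
      show "(\<lambda>w. indicator (cball 0 1) w *\<^sub>R \<phi> (cnj (disc_point z0 r w))) \<in> borel_measurable borel"
        by (rule compact_indicator_Borel_bounded(1)[OF _ cemb']) simp
    qed
    also have "\<dots> = disc_average (\<lambda>w. \<phi> (disc_point (cnj z0) r w))"
    proof (intro Bochner_Integration.integral_cong refl)
      fix w
      have "cnj (disc_point z0 r (T w)) = disc_point (cnj z0) r w"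
        by (simp add: complex_eq_iff cpair_def T_def)
      then show "indicator (cball 0 1) (T w) *\<^sub>R \<phi> (cnj (disc_point z0 r (T w)))
          = indicator (cball 0 1) w *\<^sub>R \<phi> (disc_point (cnj z0) r w)"
        using T(2)[of w] by (auto simp: indicator_def)
    qed
    also have "\<dots> = \<phi> (cnj z0)"
      by (rule disc_mean[OF S hol cdisc]) (use r in simp)
    finally show ?thesis .
  qed
  also have "(1 / (2 * \<i> * of_real b)) * (\<phi> z0 - \<phi> (cnj z0)) = u z0"
    using eq[of z0] disc r b by (auto simp: z0_def field_simps subset_iff)
  finally show ?thesis unfolding upper_a .
qed

text \<open>The mean value property of the function \<open>u \<circ> upper\<close> on the quaternions, where \<open>\<beta> * u\<close> is the odd part of
a holomorphic function. A real centre \<open>a\<close> is the limit of the centres \<open>a + \<epsilon> * i\<close>; with the radius reduced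
by \<open>\<epsilon>\<close> the balls around them stay inside the given one.\<close>

lemma sphere_mean:
  assumes S: "open S" and cnj: "\<And>z. z \<in> S \<Longrightarrow> cnj z \<in> S"
    and hol: "\<phi> holomorphic_on S" and u: "continuous_on S u"
    and eq: "\<And>z. z \<in> S \<Longrightarrow> 2 * \<i> * of_real (Im z) * u z = \<phi> z - \<phi> (cnj z)"
    and incl: "\<And>x. x \<in> cball a r \<Longrightarrow> upper x \<in> S" and r: "r \<ge> 0"
  shows "(\<integral>y. u (upper (a + r *\<^sub>R y)) \<partial>sphere_measure) = u (upper a)"
proof -
  interpret \<sigma>: prob_space sphere_measure by (rule prob_space_sphere_measure)
  consider "r = 0" | "r > 0" "im_part a \<noteq> 0" | "r > 0" "im_part a = 0" using r by linarith
  then show ?thesis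
  proof cases
    case 1
    then show ?thesis using \<sigma>.prob_space by simp
  next
    case 2
    then show ?thesis using sphere_mean_nonreal_centre[OF S cnj hol u eq incl] by blast
  next
    case 3
    \<comment> \<open>the denominator \<open>j + 2\<close> keeps the reduced radius positive\<close>
    define \<epsilon> where "\<epsilon> j = r / (real j + 2)" for j :: nat
    define A where "A j = a + \<epsilon> j *\<^sub>R Quat 0 1 0 0" for j
    define R where "R j = r - \<epsilon> j" for j
    have \<epsilon>: "0 < \<epsilon> j" "\<epsilon> j < r" for j using 3 by (simp_all add: \<epsilon>_def field_simps add_pos_nonneg)
    have \<epsilon>0: "\<epsilon> \<longlonglongrightarrow> 0" unfolding \<epsilon>_def by real_asymp
    have A0: "A \<longlonglongrightarrow> a" unfolding A_def using tendsto_add[OF tendsto_const tendsto_scaleR[OF \<epsilon>0 tendsto_const]] by force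
    have R0: "R \<longlonglongrightarrow> r" unfolding R_def using tendsto_diff[OF tendsto_const \<epsilon>0] by force
    have nq: "norm (Quat 0 1 0 0) = 1" by (simp add: norm_quat_def)
    have dA: "dist a (A j) = \<epsilon> j" for j using \<epsilon>[of j] by (simp add: A_def dist_norm nq)
    have sub: "cball (A j) (R j) \<subseteq> cball a r" for j
    proof
      fix x assume "x \<in> cball (A j) (R j)"
      then show "x \<in> cball a r" using dist_triangle[of a x "A j"] dA[of j] by (simp add: R_def)
    qed
    have c: "continuous_on (cball a r) (\<lambda>x. u (upper x))"
      by (rule continuous_on_compose2[OF u continuous_on_upper]) (use incl in auto)
    have "im_part (A j) \<noteq> 0" for j
      using 3 \<epsilon>[of j] by (simp add: A_def) (simp add: im_part_def quat_eq_iff)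
    then have mean: "(\<integral>y. u (upper (A j + R j *\<^sub>R y)) \<partial>sphere_measure) = u (upper (A j))" for j
      using \<epsilon>[of j] sub[of j] incl by (intro sphere_mean_nonreal_centre[OF S cnj hol u eq]) (auto simp: R_def)
    have inA: "A j + R j *\<^sub>R y \<in> cball a r" if "norm y = 1" for j y
      using \<epsilon>[of j] that by (intro subsetD[OF sub[of j]]) (simp add: dist_norm R_def)
    have ina: "a + r *\<^sub>R y \<in> cball a r" if "norm y = 1" for y
      using 3 that by (simp add: dist_norm)
    have "bounded ((\<lambda>x. u (upper x)) ` cball a r)"
      by (rule compact_imp_bounded[OF compact_continuous_image[OF c compact_cball]])
    then obtain B where B: "\<And>x. x \<in> cball a r \<Longrightarrow> norm (u (upper x)) \<le> B"
      by (auto simp: bounded_iff simp del: mem_cball)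
    have "(\<lambda>j. \<integral>y. u (upper (A j + R j *\<^sub>R y)) \<partial>sphere_measure) \<longlonglongrightarrow> (\<integral>y. u (upper (a + r *\<^sub>R y)) \<partial>sphere_measure)"
    proof (rule integral_dominated_convergence[where w="\<lambda>_. B"])
      show "(\<lambda>y. u (upper (a + r *\<^sub>R y))) \<in> borel_measurable sphere_measure"
        by (intro measurable_sphere_continuous continuous_on_compose2[OF c] continuous_intros) (use ina in auto)
      show "(\<lambda>y. u (upper (A j + R j *\<^sub>R y))) \<in> borel_measurable sphere_measure" for j
        by (intro measurable_sphere_continuous continuous_on_compose2[OF c] continuous_intros) (use inA in auto)
      show "AE y in sphere_measure. norm (u (upper (A j + R j *\<^sub>R y))) \<le> B" for j
        by (rule AE_I2) (use inA B in \<open>auto simp: space_sphere_measure\<close>)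
      show "AE y in sphere_measure. (\<lambda>j. u (upper (A j + R j *\<^sub>R y))) \<longlonglongrightarrow> u (upper (a + r *\<^sub>R y))"
      proof (rule AE_I2)
        fix y assume "y \<in> space sphere_measure"
        then have y: "norm y = 1" by (simp add: space_sphere_measure)
        have "(\<lambda>j. A j + R j *\<^sub>R y) \<longlonglongrightarrow> a + r *\<^sub>R y"
          by (intro tendsto_intros A0 R0)
        then show "(\<lambda>j. u (upper (A j + R j *\<^sub>R y))) \<longlonglongrightarrow> u (upper (a + r *\<^sub>R y))"
          by (rule continuous_on_tendsto_compose[OF c]) (use inA ina y in auto)
      qed
    qed simp
    moreover have "(\<lambda>j. \<integral>y. u (upper (A j + R j *\<^sub>R y)) \<partial>sphere_measure) \<longlonglongrightarrow> u (upper a)"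
      unfolding mean
    proof (rule continuous_on_tendsto_compose[OF c A0])
      have inA_centre: "A j \<in> cball a r" for j using dA[of j] \<epsilon>(2)[of j] by simp
      show "a \<in> cball a r" using 3 by simp
      show "\<forall>\<^sub>F j in sequentially. A j \<in> cball a r"
        using inA_centre by simp
    qed
    ultimately show ?thesis by (rule LIMSEQ_unique)
  qed
qed

section \<open>Divided differences in one of several complex variables\<close>

definition upd :: "'a ^ 'n \<Rightarrow> 'n \<Rightarrow> 'a \<Rightarrow> 'a ^ 'n::finite" where
  "upd z h \<zeta> = (\<chi> i. if i = h then \<zeta> else z $ i)"

definition conj_set :: "'n set \<Rightarrow> 'n::finite cvec \<Rightarrow> 'n cvec" where
  "conj_set N z = (\<chi> i. if i \<in> N then cnj (z $ i) else z $ i)"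

lemma upd_nth: "upd z h \<zeta> $ i = (if i = h then \<zeta> else z $ i)"
  by (simp add: upd_def)

lemma upd_same [simp]: "upd z h (z $ h) = z"
  by (simp add: vec_eq_iff upd_def)

lemma upd_cnj: "upd z h (cnj (z $ h)) = conj_at h z"
  by (simp add: vec_eq_iff upd_def conj_at_def)

lemma conj_at_upd: "conj_at h (upd z h \<zeta>) = upd z h (cnj \<zeta>)"
  by (simp add: vec_eq_iff upd_def conj_at_def)

lemma conj_at_upd_other: "k \<noteq> h \<Longrightarrow> conj_at h (upd z k \<zeta>) = upd (conj_at h z) k \<zeta>"
  by (simp add: vec_eq_iff upd_def conj_at_def)

lemma upd_eq_axis: "upd (z :: 'n::finite cvec) h \<zeta> = upd z h 0 + axis h \<zeta>"
  by (simp add: vec_eq_iff upd_def axis_def)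

lemma upd_diff_axis: "upd (z :: 'n::finite cvec) h \<zeta> - z = axis h (\<zeta> - z $ h)"
  by (simp add: vec_eq_iff upd_def axis_def)

lemma continuous_on_upd [continuous_intros]:
  fixes f :: "'a::topological_space \<Rightarrow> 'b::real_normed_vector ^ 'n::finite"
  assumes "continuous_on A f" "continuous_on A g"
  shows "continuous_on A (\<lambda>x. upd (f x) h (g x))"
  unfolding upd_def
proof (rule continuous_on_vec_lambda)
  fix i
  show "continuous_on A (\<lambda>x. if i = h then g x else f x $ i)"
    using assms by (cases "i = h") (auto intro!: continuous_intros)
qed

lemma continuous_on_conj_at [continuous_intros]:
  "continuous_on A f \<Longrightarrow> continuous_on A (\<lambda>x. conj_at h (f x))"
  unfolding upd_cnj[symmetric] by (intro continuous_intros)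

lemma norm_upd_diff_le: "norm (upd (z :: 'n::finite cvec) h \<zeta> - upd w h \<zeta>) \<le> norm (z - w)"
  by (rule norm_le_componentwise_cart) (simp add: upd_def)

lemma norm_axis: "norm (axis h c) = norm (c :: 'a::real_normed_vector)"
proof -
  have "(\<Sum>i\<in>UNIV. (norm (axis h c $ i))\<^sup>2) = (\<Sum>i\<in>UNIV. if i = h then (norm c)\<^sup>2 else 0)"
    by (rule sum.cong) (auto simp: axis_def)
  then show ?thesis by (simp add: norm_vec_def L2_set_def)
qed

lemma dist_upd_le: "dist (upd (z :: 'n::finite cvec) h \<zeta>) w \<le> dist z w + norm (\<zeta> - w $ h)"
proof -
  have "dist (upd z h \<zeta>) w \<le> dist (upd z h \<zeta>) (upd w h \<zeta>) + dist (upd w h \<zeta>) w"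
    by (rule dist_triangle)
  also have "\<dots> \<le> dist z w + norm (\<zeta> - w $ h)"
    using norm_upd_diff_le[of z h \<zeta> w] by (simp add: dist_norm upd_diff_axis norm_axis)
  finally show ?thesis .
qed

lemma open_slice: "open D \<Longrightarrow> open {\<zeta>. upd (z :: 'n::finite cvec) h \<zeta> \<in> D}"
  using open_vimage[of D "upd z h"] by (simp add: vimage_def continuous_on_upd)

definition holo_in :: "'n::finite cvec set \<Rightarrow> 'n \<Rightarrow> ('n cvec \<Rightarrow> complex) \<Rightarrow> bool" where
  "holo_in D h U \<longleftrightarrow> (\<forall>z\<in>D. (\<lambda>\<zeta>. U (upd z h \<zeta>)) holomorphic_on {\<zeta>. upd z h \<zeta> \<in> D})"

text \<open>At real \<open>z $ h\<close> the derivative is the limit of the quotient.\<close>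

definition divided_diff :: "'n::finite \<Rightarrow> ('n cvec \<Rightarrow> complex) \<Rightarrow> 'n cvec \<Rightarrow> complex" where
  "divided_diff h \<Phi> z = (if Im (z $ h) = 0 then deriv (\<lambda>\<zeta>. \<Phi> (upd z h \<zeta>)) (z $ h)
     else (\<Phi> z - \<Phi> (conj_at h z)) / (2 * \<i> * of_real (Im (z $ h))))"

text \<open>The function \<open>U\<close> shows that \<open>i * \<beta>\<^sub>h * v\<close> is the odd part in \<open>z\<^sub>h\<close> of a function holomorphic in \<open>z\<^sub>h\<close>, which
is the hypothesis of \<open>sphere_mean\<close> in that variable.\<close>

definition is_divided_diff :: "'n::finite cvec set \<Rightarrow> 'n \<Rightarrow> ('n cvec \<Rightarrow> complex) \<Rightarrow> bool" where
  "is_divided_diff D h v \<longleftrightarrow> (\<exists>U. holo_in D h U \<and>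
     (\<forall>z\<in>D. 2 * \<i> * of_real (Im (z $ h)) * v z = U z - U (conj_at h z)))"

lemma conj_at_real: "Im (z $ h) = 0 \<Longrightarrow> conj_at h z = z"
  by (auto simp: vec_eq_iff conj_at_def complex_eq_iff)

lemma divided_diff_eq: "2 * \<i> * of_real (Im (z $ h)) * divided_diff h \<Phi> z = \<Phi> z - \<Phi> (conj_at h z)"
  by (simp add: divided_diff_def conj_at_real)

text \<open>Cauchy's formula at \<open>z\<^sub>h\<close> and at its conjugate, or Cauchy's formula for the derivative where the two points
coincide. Both cases are given by one expression, which is visibly continuous in \<open>z\<close>.\<close>

lemma divided_diff_Cauchy:
  assumes hol: "(\<lambda>\<zeta>. \<Phi> (upd z h \<zeta>)) holomorphic_on S" and S: "cball w0 \<rho> \<subseteq> S"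
    and w: "z $ h \<in> ball w0 \<rho>" "cnj (z $ h) \<in> ball w0 \<rho>"
  shows "divided_diff h \<Phi> z = 1 / (2 * of_real pi * \<i>) *
     contour_integral (circlepath w0 \<rho>) (\<lambda>\<zeta>. \<Phi> (upd z h \<zeta>) / ((\<zeta> - z $ h) * (\<zeta> - cnj (z $ h))))"
proof -
  define \<phi> where "\<phi> \<zeta> = \<Phi> (upd z h \<zeta>)" for \<zeta>
  have hol: "\<phi> holomorphic_on cball w0 \<rho>" unfolding \<phi>_def by (rule holomorphic_on_subset[OF hol S])
  have \<rho>: "\<rho> > 0" using w(1) by (metis ball_eq_empty empty_iff not_le)
  define w where "w = z $ h"
  show ?thesis
  proof (cases "Im w = 0")
    case True
    then have cw: "cnj w = w" by (simp add: complex_eq_iff)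
    have "(\<phi> has_field_derivative (1 / (2 * of_real pi * \<i>) * contour_integral (circlepath w0 \<rho>) (\<lambda>u. \<phi> u / (u - w)\<^sup>2))) (at w)"
      by (rule Cauchy_derivative_integral_circlepath(2))
         (use hol assms(3) in \<open>auto simp: w_def intro: holomorphic_on_imp_continuous_on holomorphic_on_subset\<close>)
    then have "deriv \<phi> w = 1 / (2 * of_real pi * \<i>) * contour_integral (circlepath w0 \<rho>) (\<lambda>u. \<phi> u / ((u - w) * (u - cnj w)))"
      unfolding cw power2_eq_square[symmetric] by (rule DERIV_imp_deriv)
    then show ?thesis using True by (simp add: divided_diff_def \<phi>_def[abs_def] w_def)
  next
    case False
    define C where "C = circlepath w0 \<rho>"
    have nz: "w - cnj w = 2 * \<i> * of_real (Im w)" by (simp add: complex_eq_iff)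
    have nz': "w - cnj w \<noteq> 0" using False by (simp add: nz)
    have 1: "((\<lambda>u. \<phi> u / (u - w)) has_contour_integral (2 * of_real pi * \<i> * \<phi> w)) C"
      unfolding C_def by (rule Cauchy_integral_circlepath_simple) (use hol assms(3) in \<open>auto simp: w_def dist_norm norm_minus_commute\<close>)
    have 2: "((\<lambda>u. \<phi> u / (u - cnj w)) has_contour_integral (2 * of_real pi * \<i> * \<phi> (cnj w))) C"
      unfolding C_def by (rule Cauchy_integral_circlepath_simple) (use hol assms(4) in \<open>auto simp: w_def dist_norm norm_minus_commute\<close>)
    have "((\<lambda>u. 1 / (w - cnj w) * (\<phi> u / (u - w) - \<phi> u / (u - cnj w))) has_contour_integral
        (1 / (w - cnj w) * (2 * of_real pi * \<i> * \<phi> w - 2 * of_real pi * \<i> * \<phi> (cnj w)))) C"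
      by (intro has_contour_integral_lmul has_contour_integral_diff 1 2)
    then have "((\<lambda>u. \<phi> u / ((u - w) * (u - cnj w))) has_contour_integral
        (1 / (w - cnj w) * (2 * of_real pi * \<i> * \<phi> w - 2 * of_real pi * \<i> * \<phi> (cnj w)))) C"
    proof (rule has_contour_integral_eq)
      fix u assume "u \<in> path_image C"
      then have "u \<noteq> w" "u \<noteq> cnj w"
        using assms(3,4) \<rho> by (auto simp: C_def w_def)
      then show "1 / (w - cnj w) * (\<phi> u / (u - w) - \<phi> u / (u - cnj w)) = \<phi> u / ((u - w) * (u - cnj w))"
        using nz' by (simp add: divide_simps) (simp add: algebra_simps)
    qed
    then have "contour_integral C (\<lambda>u. \<phi> u / ((u - w) * (u - cnj w)))
        = 1 / (w - cnj w) * (2 * of_real pi * \<i> * \<phi> w - 2 * of_real pi * \<i> * \<phi> (cnj w))"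
      by (rule contour_integral_unique)
    then have "1 / (2 * of_real pi * \<i>) * contour_integral C (\<lambda>u. \<phi> u / ((u - w) * (u - cnj w))) = (\<phi> w - \<phi> (cnj w)) / (w - cnj w)"
      using nz' by (simp add: field_simps)
    then show ?thesis
      using False unfolding nz by (simp add: divided_diff_def \<phi>_def[abs_def] w_def C_def upd_cnj)
  qed
qed

lemma continuous_on_divided_diff:
  fixes D :: "'n::finite cvec set"
  assumes D: "open D" "invariant_set D" and \<Phi>: "continuous_on D \<Phi>" and hol: "holo_in D h \<Phi>"
  shows "continuous_on D (divided_diff h \<Phi>)"
proof (intro continuous_at_imp_continuous_on ballI)
  fix z0 assume z0: "z0 \<in> D"
  show "isCont (divided_diff h \<Phi>) z0"
  proof (cases "Im (z0 $ h) = 0")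
    case False
    define N where "N = D \<inter> {z. Im (z $ h) \<noteq> 0}"
    have N: "open N" unfolding N_def
      by (intro open_Int D open_Collect_neq continuous_intros)
    have "continuous_on N (\<lambda>z. (\<Phi> z - \<Phi> (conj_at h z)) / (2 * \<i> * of_real (Im (z $ h))))"
      by (intro continuous_intros continuous_on_compose2[OF \<Phi>])
         (use D(2) in \<open>auto simp: N_def invariant_set_def\<close>)
    then have "continuous_on N (divided_diff h \<Phi>)"
      by (rule continuous_on_eq) (simp add: divided_diff_def N_def)
    then show ?thesis using N z0 False by (auto simp: continuous_on_eq_continuous_at N_def)
  next
    case True
    define w0 where "w0 = z0 $ h"
    have cw0: "cnj w0 = w0" using True by (simp add: w0_def complex_eq_iff)
    obtain e where e: "e > 0" "ball z0 e \<subseteq> D" using D(1) z0 by (auto simp: open_contains_ball)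
    define \<rho> where "\<rho> = e / 2"
    define N where "N = ball z0 (\<rho> / 2)"
    have \<rho>: "\<rho> > 0" using e by (simp add: \<rho>_def)
    have inD: "upd z h \<zeta> \<in> D" if "z \<in> N" "\<zeta> \<in> cball w0 \<rho>" for z \<zeta>
    proof -
      have "dist (upd z h \<zeta>) z0 \<le> dist z z0 + norm (\<zeta> - w0)"
        using dist_upd_le[of z h \<zeta> z0] by (simp add: w0_def)
      also have "\<dots> < e" using that \<rho> by (simp add: N_def \<rho>_def dist_commute dist_norm norm_minus_commute)
      finally show ?thesis using e by (auto simp: dist_commute)
    qed
    have zh: "z $ h \<in> ball w0 (\<rho> / 2)" "cnj (z $ h) \<in> ball w0 (\<rho> / 2)" if "z \<in> N" for z
    proof -
      have "norm (z $ h - w0) \<le> norm (z - z0)"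
        using Finite_Cartesian_Product.norm_nth_le[of "z - z0" h] by (simp add: w0_def)
      then show 1: "z $ h \<in> ball w0 (\<rho> / 2)" using that by (simp add: N_def dist_norm norm_minus_commute)
      have "norm (cnj (z $ h) - w0) = norm (z $ h - w0)"
        by (metis complex_cnj_diff complex_mod_cnj cw0)
      then show "cnj (z $ h) \<in> ball w0 (\<rho> / 2)" using 1 by (simp add: dist_norm norm_minus_commute)
    qed
    let ?c = "\<lambda>t::real. w0 + of_real \<rho> * exp (2 * of_real pi * \<i> * of_real t)"
    let ?k = "\<lambda>z t. \<Phi> (upd z h (?c t)) / ((?c t - z $ h) * (?c t - cnj (z $ h)))
        * (2 * of_real pi * \<i> * of_real \<rho> * exp (2 * of_real pi * \<i> * of_real t))"
    have formula: "divided_diff h \<Phi> z = 1 / (2 * of_real pi * \<i>) *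
        integral (cbox 0 1) (?k z)" if z: "z \<in> N" for z
    proof -
      have zD: "z \<in> D" using inD[OF z, of "z $ h"] zh[OF z] \<rho> by simp
      have "divided_diff h \<Phi> z = 1 / (2 * of_real pi * \<i>) *
       contour_integral (circlepath w0 \<rho>) (\<lambda>\<zeta>. \<Phi> (upd z h \<zeta>) / ((\<zeta> - z $ h) * (\<zeta> - cnj (z $ h))))"
      proof (rule divided_diff_Cauchy)
        show "(\<lambda>\<zeta>. \<Phi> (upd z h \<zeta>)) holomorphic_on {\<zeta>. upd z h \<zeta> \<in> D}"
          using hol zD by (simp add: holo_in_def)
        show "cball w0 \<rho> \<subseteq> {\<zeta>. upd z h \<zeta> \<in> D}" using inD[OF z] by blast
      qed (use zh[OF z] \<rho> in auto)
      also have "contour_integral (circlepath w0 \<rho>) (\<lambda>\<zeta>. \<Phi> (upd z h \<zeta>) / ((\<zeta> - z $ h) * (\<zeta> - cnj (z $ h))))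
        = integral (cbox 0 1) (?k z)"
        unfolding contour_integral_integral box_real
        by (rule integral_cong) (simp only: vector_derivative_circlepath, simp add: circlepath)
      finally show ?thesis .
    qed
    have "continuous_on N (\<lambda>z. 1 / (2 * of_real pi * \<i>) *
        integral (cbox 0 1) (?k z))"
    proof (intro continuous_intros integral_continuous_on_param)
      define c where "c t = w0 + of_real \<rho> * exp (2 * of_real pi * \<i> * of_real t)" for t :: real
      have c: "norm (c t - w0) = \<rho>" for t using \<rho> by (simp add: c_def norm_mult norm_exp_eq_Re)
      have ne: "c t - v \<noteq> 0" if "v \<in> ball w0 (\<rho> / 2)" for t v
        using c[of t] that \<rho> by (auto simp: dist_norm norm_minus_commute)
      have cc: "continuous_on A (\<lambda>p. c (snd p))" for A :: "('n cvec \<times> real) set"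
        unfolding c_def by (intro continuous_intros)
      have cP: "continuous_on (N \<times> cbox 0 1) (\<lambda>p. \<Phi> (upd (fst p) h (c (snd p))))"
        by (intro continuous_on_compose2[OF \<Phi>] continuous_intros cc)
           (use c in \<open>auto intro!: inD simp: dist_norm norm_minus_commute\<close>)
      have "continuous_on (N \<times> cbox 0 1) (\<lambda>p. \<Phi> (upd (fst p) h (c (snd p))) / ((c (snd p) - fst p $ h) * (c (snd p) - cnj (fst p $ h)))
            * (2 * of_real pi * \<i> * of_real \<rho> * exp (2 * of_real pi * \<i> * of_real (snd p))))"
        by (intro continuous_intros cP cc) (use ne zh in auto)
      then show "continuous_on (N \<times> cbox 0 1) (\<lambda>(z, t). ?k z t)"
        by (simp add: c_def case_prod_beta)
    qed
    then have "continuous_on N (divided_diff h \<Phi>)"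
      by (rule continuous_on_eq) (rule formula[symmetric])
    then show ?thesis using \<rho> by (auto simp: continuous_on_eq_continuous_at N_def)
  qed
qed

text \<open>For non-real \<open>z\<^sub>h\<close> this can be read off from the quotient. For real \<open>z\<^sub>h\<close> the divided difference is, as a
function of \<open>z\<^sub>k\<close>, the locally uniform limit of the divided differences at \<open>z\<^sub>h + i * \<epsilon>\<close>, because it is
uniformly continuous on compact sets.\<close>

lemma holo_in_divided_diff:
  fixes D :: "'n::finite cvec set"
  assumes D: "open D" "invariant_set D" and \<Phi>: "continuous_on D \<Phi>" and hol: "holo_in D h \<Phi>"
    and k: "k \<noteq> h" and holk: "holo_in D k \<Phi>"
  shows "holo_in D k (divided_diff h \<Phi>)"
  unfolding holo_in_def
proof
  have cont: "continuous_on D (divided_diff h \<Phi>)" by (rule continuous_on_divided_diff[OF D \<Phi> hol])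
  have off: "(\<lambda>\<zeta>. divided_diff h \<Phi> (upd z k \<zeta>)) holomorphic_on {\<zeta>. upd z k \<zeta> \<in> D}"
    if z: "z \<in> D" and im: "Im (z $ h) \<noteq> 0" for z
  proof -
    have c: "conj_at h z \<in> D" using z D(2) by (auto simp: invariant_set_def)
    have set: "{\<zeta>. upd (conj_at h z) k \<zeta> \<in> D} = {\<zeta>. upd z k \<zeta> \<in> D}"
      using D(2) k by (simp add: conj_at_upd_other[symmetric] invariant_set_def)
    have "(\<lambda>\<zeta>. (\<Phi> (upd z k \<zeta>) - \<Phi> (upd (conj_at h z) k \<zeta>)) / (2 * \<i> * of_real (Im (z $ h)))) holomorphic_on {\<zeta>. upd z k \<zeta> \<in> D}"
      using holk z c im set unfolding holo_in_def by (intro holomorphic_intros) force+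
    then show ?thesis
      using im k by (simp add: divided_diff_def upd_nth conj_at_upd_other)
  qed
  fix z assume z: "z \<in> D"
  define T where "T = {\<zeta>. upd z k \<zeta> \<in> D}"
  have T: "open T" unfolding T_def by (rule open_slice[OF D(1)])
  show "(\<lambda>\<zeta>. divided_diff h \<Phi> (upd z k \<zeta>)) holomorphic_on {\<zeta>. upd z k \<zeta> \<in> D}"
  proof (cases "Im (z $ h) = 0")
    case False
    then show ?thesis using off z by blast
  next
    case True
    have "(\<lambda>\<zeta>. divided_diff h \<Phi> (upd z k \<zeta>)) field_differentiable (at \<zeta>0)" if \<zeta>0: "\<zeta>0 \<in> T" for \<zeta>0
    proof -
      define p0 where "p0 = upd z k \<zeta>0"
      have p0: "p0 \<in> D" "p0 $ h = z $ h" using \<zeta>0 k by (auto simp: p0_def T_def upd_nth)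
      obtain e where e: "e > 0" "ball p0 e \<subseteq> D" using D(1) p0 by (auto simp: open_contains_ball)
      define \<delta> where "\<delta> = e / 3"
      have \<delta>: "\<delta> > 0" using e by (simp add: \<delta>_def)
      define P where "P \<epsilon> \<zeta> = upd (upd p0 h (z $ h + \<i> * of_real \<epsilon>)) k \<zeta>" for \<epsilon> :: real and \<zeta>
      have PD: "P \<epsilon> \<zeta> \<in> D" if "\<bar>\<epsilon>\<bar> \<le> \<delta>" "norm (\<zeta> - \<zeta>0) \<le> \<delta>" for \<epsilon> \<zeta>
      proof -
        have "dist (P \<epsilon> \<zeta>) p0 \<le> dist (upd p0 h (z $ h + \<i> * of_real \<epsilon>)) p0 + norm (\<zeta> - p0 $ k)"
          unfolding P_def by (rule dist_upd_le)
        also have "\<dots> \<le> norm (z $ h + \<i> * of_real \<epsilon> - p0 $ h) + norm (\<zeta> - p0 $ k)"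
          using dist_upd_le[of p0 h "z $ h + \<i> * of_real \<epsilon>" p0] by simp
        also have "\<dots> < e" using that \<delta> p0 by (simp add: p0_def upd_nth norm_mult \<delta>_def)
        finally show ?thesis using e by (auto simp: dist_commute)
      qed
      define K where "K = cball (0::real) \<delta> \<times> cball \<zeta>0 \<delta>"
      define G where "G p = divided_diff h \<Phi> (P (fst p) (snd p))" for p
      have "continuous_on K G"
        unfolding G_def
      proof (rule continuous_on_compose2[OF cont])
        show "continuous_on K (\<lambda>p. P (fst p) (snd p))"
          unfolding P_def by (intro continuous_intros)
        show "(\<lambda>p. P (fst p) (snd p)) ` K \<subseteq> D"
          by (auto simp: K_def dist_norm norm_minus_commute intro!: PD)
      qed
      moreover have "compact K" by (simp add: K_def compact_Times)
      ultimately have uc: "uniformly_continuous_on K G" by (rule compact_uniformly_continuous)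
      define s where "s j = \<delta> / (real j + 1)" for j :: nat
      have s: "0 < s j" "s j \<le> \<delta>" for j using \<delta> by (simp_all add: s_def field_simps)
      have s0: "s \<longlonglongrightarrow> 0" unfolding s_def by real_asymp
      have UL: "uniform_limit (cball \<zeta>0 \<delta>) (\<lambda>j \<zeta>. G (s j, \<zeta>)) (\<lambda>\<zeta>. G (0, \<zeta>)) sequentially"
        unfolding uniform_limit_iff
      proof (intro allI impI)
        fix \<epsilon> :: real assume "\<epsilon> > 0"
        then obtain d where d: "d > 0" "\<And>x x'. x \<in> K \<Longrightarrow> x' \<in> K \<Longrightarrow> dist x' x < d \<Longrightarrow> dist (G x') (G x) < \<epsilon>"
          using uc unfolding uniformly_continuous_on_def by metis
        have "\<forall>\<^sub>F j in sequentially. s j < d" using s0 d(1) by (rule order_tendstoD)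
        then show "\<forall>\<^sub>F j in sequentially. \<forall>\<zeta>\<in>cball \<zeta>0 \<delta>. dist (G (s j, \<zeta>)) (G (0, \<zeta>)) < \<epsilon>"
        proof (rule eventually_mono, intro ballI)
          fix j \<zeta> assume j: "s j < d" and \<zeta>: "\<zeta> \<in> cball \<zeta>0 \<delta>"
          have "(s j, \<zeta>) \<in> K" "(0, \<zeta>) \<in> K" using s[of j] \<zeta> \<delta> by (auto simp: K_def)
          moreover have "dist (s j, \<zeta>) (0, \<zeta>) < d" using j s[of j] by (simp add: dist_Pair_Pair)
          ultimately show "dist (G (s j, \<zeta>)) (G (0, \<zeta>)) < \<epsilon>" using d(2) by blast
        qed
      qed
      have EV: "\<forall>\<^sub>F j in sequentially. continuous_on (cball \<zeta>0 \<delta>) (\<lambda>\<zeta>. G (s j, \<zeta>)) \<and> (\<lambda>\<zeta>. G (s j, \<zeta>)) holomorphic_on ball \<zeta>0 \<delta>"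
      proof (rule always_eventually, rule allI)
        fix j
        define z' where "z' = upd p0 h (z $ h + \<i> * of_real (s j))"
        have "z' $ k = \<zeta>0" using k by (simp add: z'_def p0_def upd_nth)
        then have "P (s j) \<zeta>0 = z'" unfolding P_def z'_def[symmetric] using upd_same[of z' k] by simp
        then have z': "z' \<in> D" using PD[of "s j" \<zeta>0] s[of j] \<delta> by simp
        have im: "Im (z' $ h) \<noteq> 0" using True s[of j] by (simp add: z'_def upd_nth)
        have "(\<lambda>\<zeta>. G (s j, \<zeta>)) holomorphic_on {\<zeta>. upd z' k \<zeta> \<in> D}"
          using off[OF z' im] by (simp add: G_def P_def z'_def)
        moreover have "cball \<zeta>0 \<delta> \<subseteq> {\<zeta>. upd z' k \<zeta> \<in> D}"
          using PD s[of j] by (auto simp: P_def z'_def dist_norm norm_minus_commute)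
        ultimately have "(\<lambda>\<zeta>. G (s j, \<zeta>)) holomorphic_on cball \<zeta>0 \<delta>" by (rule holomorphic_on_subset)
        then show "continuous_on (cball \<zeta>0 \<delta>) (\<lambda>\<zeta>. G (s j, \<zeta>)) \<and> (\<lambda>\<zeta>. G (s j, \<zeta>)) holomorphic_on ball \<zeta>0 \<delta>"
          by (auto intro: holomorphic_on_imp_continuous_on holomorphic_on_subset)
      qed
      have "(\<lambda>\<zeta>. G (0, \<zeta>)) holomorphic_on ball \<zeta>0 \<delta>"
        by (rule holomorphic_uniform_limit[OF EV UL]) simp_all
      moreover have "(\<lambda>\<zeta>. G (0, \<zeta>)) = (\<lambda>\<zeta>. divided_diff h \<Phi> (upd z k \<zeta>))"
      proof
        fix \<zeta>
        have "P 0 \<zeta> = upd z k \<zeta>" using k by (simp add: P_def p0_def vec_eq_iff upd_def)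
        then show "G (0, \<zeta>) = divided_diff h \<Phi> (upd z k \<zeta>)" by (simp add: G_def)
      qed
      ultimately show ?thesis using \<delta> by (auto intro: holomorphic_on_imp_differentiable_at)
    qed
    then show ?thesis
      unfolding T_def[symmetric] holomorphic_on_def by (auto intro: field_differentiable_at_within)
  qed
qed

section \<open>Iterated divided differences\<close>

lemma conj_set_insert: "h \<notin> N \<Longrightarrow> conj_set N (conj_at h z) = conj_set (insert h N) z"
  by (auto simp: vec_eq_iff conj_set_def conj_at_def)

lemma sum_Pow_insert:
  assumes "finite M" "h \<notin> M"
  shows "(\<Sum>N\<in>Pow (insert h M). g N) = (\<Sum>N\<in>Pow M. g N) + (\<Sum>N\<in>Pow M. g (insert h N))"
proof -
  have "inj_on (insert h) (Pow M)" using assms(2) by (auto simp: inj_on_def)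
  then show ?thesis
    unfolding Pow_insert
    using assms by (subst sum.union_disjoint) (auto simp: sum.reindex)
qed

abbreviation im_prod :: "'n set \<Rightarrow> 'n::finite cvec \<Rightarrow> real" where
  "im_prod M z \<equiv> (\<Prod>h\<in>M. Im (z $ h))"

abbreviation antisym :: "'n set \<Rightarrow> ('n cvec \<Rightarrow> complex) \<Rightarrow> 'n::finite cvec \<Rightarrow> complex" where
  "antisym M \<Phi> z \<equiv> (\<Sum>N\<in>Pow M. (-1) ^ card N * \<Phi> (conj_set N z))"

text \<open>Each further divided difference doubles the number of terms of the alternating sum: conjugating \<open>z\<^sub>h\<close>
as well replaces \<open>N\<close> by \<open>insert h N\<close>. Holomorphy in the remaining variables keeps the iteration going.\<close>

lemma iterated_divided_diff:
  fixes D :: "'n::finite cvec set"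
  assumes D: "open D" "invariant_set D" and \<Phi>: "continuous_on D \<Phi>"
    and hol: "\<And>h. h \<in> S \<Longrightarrow> holo_in D h \<Phi>" and M: "M \<subseteq> S"
  shows "\<exists>V. continuous_on D V \<and> (\<forall>k\<in>S - M. holo_in D k V) \<and>
    (\<forall>z\<in>D. (2 * \<i>) ^ card M * of_real (im_prod M z) * V z
       = antisym M \<Phi> z)"
  using finite[of M] M
proof (induction M rule: finite_induct)
  case empty
  have "conj_set {} z = z" for z :: "'n cvec" by (simp add: conj_set_def vec_eq_iff)
  then show ?case using \<Phi> hol by (intro exI[of _ \<Phi>]) simp
next
  case (insert h M)
  then obtain V where V: "continuous_on D V" "\<And>k. k \<in> S - M \<Longrightarrow> holo_in D k V"
    "\<And>z. z \<in> D \<Longrightarrow> (2 * \<i>) ^ card M * of_real (im_prod M z) * V z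
       = antisym M \<Phi> z" by auto
  have hV: "holo_in D h V" using V(2) insert by auto
  have "(2 * \<i>) ^ card (insert h M) * of_real (im_prod (insert h M) z) * divided_diff h V z
       = antisym (insert h M) \<Phi> z" if z: "z \<in> D" for z
  proof -
    have cz: "conj_at h z \<in> D" using z D(2) by (auto simp: invariant_set_def)
    have "im_prod M (conj_at h z) = im_prod M z"
      using insert by (intro prod.cong) (auto simp: conj_at_def)
    then have c: "(2 * \<i>) ^ card M * of_real (im_prod M z) * V (conj_at h z)
       = (\<Sum>N\<in>Pow M. (-1) ^ card N * \<Phi> (conj_set N (conj_at h z)))"
      using V(3)[OF cz] by simp
    have "(2 * \<i>) ^ card (insert h M) * of_real (im_prod (insert h M) z) * divided_diff h V z
       = (2 * \<i>) ^ card M * of_real (im_prod M z) * (2 * \<i> * of_real (Im (z $ h)) * divided_diff h V z)"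
      using insert by (simp add: mult_ac)
    also have "\<dots> = antisym M \<Phi> z - (\<Sum>N\<in>Pow M. (-1) ^ card N * \<Phi> (conj_set N (conj_at h z)))"
      unfolding divided_diff_eq by (simp only: right_diff_distrib V(3)[OF z] c)
    also have "(\<Sum>N\<in>Pow M. (-1) ^ card N * \<Phi> (conj_set N (conj_at h z))) = - (\<Sum>N\<in>Pow M. (-1) ^ card (insert h N) * \<Phi> (conj_set (insert h N) z))"
    proof (subst sum_negf[symmetric], rule sum.cong[OF refl])
      fix N assume "N \<in> Pow M"
      then have "h \<notin> N" using insert by auto
      then show "(-1) ^ card N * \<Phi> (conj_set N (conj_at h z)) = - ((-1) ^ card (insert h N) * \<Phi> (conj_set (insert h N) z))"
        by (simp add: conj_set_insert)
    qed
    finally show ?thesis using insert by (simp add: sum_Pow_insert)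
  qed
  moreover have "continuous_on D (divided_diff h V)" by (rule continuous_on_divided_diff[OF D V(1) hV])
  moreover have "holo_in D k (divided_diff h V)" if "k \<in> S - insert h M" for k
    by (rule holo_in_divided_diff[OF D V(1) hV]) (use that V(2) in auto)
  ultimately show ?case by (intro exI[of _ "divided_diff h V"]) blast
qed

lemma nonreal_part_dense:
  fixes D :: "'n::finite cvec set"
  assumes "open D" "z \<in> D"
  obtains w where "\<And>j::nat. w j \<in> nonreal_part M D" "w \<longlonglongrightarrow> z"
proof -
  define v where "v j = (\<chi> i. if i \<in> M \<and> Im (z $ i) = 0 then z $ i + \<i> * of_real (1 / (real j + 1)) else z $ i)" for j :: nat
  have "(\<lambda>j. 1 / (real j + 1)) \<longlonglongrightarrow> 0" by real_asymp
  then have l: "(\<lambda>j. z $ i + \<i> * of_real (1 / (real j + 1))) \<longlonglongrightarrow> z $ i + \<i> * of_real 0" for i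
    by (intro tendsto_intros)
  have v: "v \<longlonglongrightarrow> z"
  proof (rule vec_tendstoI)
    fix i
    show "(\<lambda>j. v j $ i) \<longlonglongrightarrow> z $ i"
    proof (cases "i \<in> M \<and> Im (z $ i) = 0")
      case True
      then show ?thesis using l[of i] by (simp add: v_def)
    next
      case False
      then have "(\<lambda>j. v j $ i) = (\<lambda>_. z $ i)" by (simp only: v_def vec_lambda_beta if_False)
      then show ?thesis by simp
    qed
  qed
  then have "\<forall>\<^sub>F j in sequentially. v j \<in> D" using assms by (simp add: topological_tendstoD)
  then obtain J where J: "\<And>j. j \<ge> J \<Longrightarrow> v j \<in> D" by (auto simp: eventually_sequentially)
  have "v (j + J) \<in> nonreal_part M D" for j
    using J[of "j + J"] by (auto simp: nonreal_part_def v_def)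
  moreover have "(\<lambda>j. v (j + J)) \<longlonglongrightarrow> z" using v by (rule LIMSEQ_ignore_initial_segment)
  ultimately show ?thesis by (rule that)
qed

lemma nonreal_part_subset: "nonreal_part M D \<subseteq> D"
  by (auto simp: nonreal_part_def)

lemma continuous_eq_from_nonreal:
  fixes D :: "'n::finite cvec set" and f g :: "'n cvec \<Rightarrow> 'b::t2_space"
  assumes "open D" "continuous_on D f" "continuous_on D g"
    and "\<And>z. z \<in> nonreal_part M D \<Longrightarrow> f z = g z" and "z \<in> D"
  shows "f z = g z"
proof -
  obtain w where w: "\<And>j::nat. w j \<in> nonreal_part M D" "w \<longlonglongrightarrow> z"
    using nonreal_part_dense[OF assms(1,5)] by blast
  have wD: "w j \<in> D" for j using w(1) nonreal_part_subset by blast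
  have "(\<lambda>j. f (w j)) \<longlonglongrightarrow> f z" "(\<lambda>j. g (w j)) \<longlonglongrightarrow> g z"
    by (auto intro!: continuous_on_tendsto_compose[OF assms(2) w(2)] continuous_on_tendsto_compose[OF assms(3) w(2)] simp: assms(5) wD)
  moreover have "(\<lambda>j. f (w j)) = (\<lambda>j. g (w j))" using assms(4) w(1) by auto
  ultimately show ?thesis using LIMSEQ_unique by metis
qed

text \<open>Iterated divided differences do not depend on the order of the variables: away from real coordinates
they are all given by the same quotient, and they are continuous. So any variable may be taken last.\<close>

lemma iterated_divided_diff_last:
  fixes D :: "'n::finite cvec set"
  assumes D: "open D" "invariant_set D" and \<Phi>: "continuous_on D \<Phi>"
    and hol: "\<And>h. h \<in> M \<Longrightarrow> holo_in D h \<Phi>"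
    and V: "continuous_on D V"
      "\<And>z. z \<in> D \<Longrightarrow> (2 * \<i>) ^ card M * of_real (im_prod M z) * V z
       = antisym M \<Phi> z"
    and h: "h \<in> M"
  shows "is_divided_diff D h V"
proof -
  define M' where "M' = M - {h}"
  have M: "M = insert h M'" "h \<notin> M'" using h by (auto simp: M'_def)
  have "M' \<subseteq> M" by (auto simp: M'_def)
  from iterated_divided_diff[OF D \<Phi> hol this] obtain U where
    "continuous_on D U \<and> (\<forall>k\<in>M - M'. holo_in D k U) \<and> (\<forall>z\<in>D. (2 * \<i>) ^ card M' * of_real (im_prod M' z) * U z
       = antisym M' \<Phi> z)" by (rule exE)
  then have U: "continuous_on D U" "\<forall>k\<in>M - M'. holo_in D k U"
    "\<And>z. z \<in> D \<Longrightarrow> (2 * \<i>) ^ card M' * of_real (im_prod M' z) * U z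
       = antisym M' \<Phi> z" by simp_all
  have hU: "holo_in D h U" using U(2) h by (auto simp: M'_def)
  have "2 * \<i> * of_real (Im (z $ h)) * V z = U z - U (conj_at h z)" if z: "z \<in> D" for z
  proof (rule continuous_eq_from_nonreal[OF D(1) _ _ _ z, where M=M])
    show "continuous_on D (\<lambda>z. 2 * \<i> * of_real (Im (z $ h)) * V z)"
      by (intro continuous_intros V(1))
    show "continuous_on D (\<lambda>z. U z - U (conj_at h z))"
      by (intro continuous_intros U(1) continuous_on_compose2[OF U(1)])
         (use D(2) in \<open>auto simp: invariant_set_def\<close>)
    fix z assume zn: "z \<in> nonreal_part M D"
    then have z: "z \<in> D" and cz: "conj_at h z \<in> D" using D(2) by (auto simp: nonreal_part_def invariant_set_def)
    define c where "c = (2 * \<i>) ^ card M' * of_real (im_prod M' z)"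
    have c0: "c \<noteq> 0" using zn by (simp add: c_def nonreal_part_def M'_def prod_zero_iff)
    have cc: "im_prod M' (conj_at h z) = im_prod M' z"
      using M(2) by (intro prod.cong) (auto simp: conj_at_def)
    have "c * (2 * \<i> * of_real (Im (z $ h)) * V z) = (2 * \<i>) ^ card M * of_real (im_prod M z) * V z"
      using M by (simp add: c_def mult_ac)
    also have "\<dots> = antisym M' \<Phi> z + (\<Sum>N\<in>Pow M'. (-1) ^ card (insert h N) * \<Phi> (conj_set (insert h N) z))"
      unfolding V(2)[OF z] unfolding M(1) by (rule sum_Pow_insert) (use M in auto)
    also have "(\<Sum>N\<in>Pow M'. (-1) ^ card (insert h N) * \<Phi> (conj_set (insert h N) z)) = - (\<Sum>N\<in>Pow M'. (-1) ^ card N * \<Phi> (conj_set N (conj_at h z)))"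
    proof (subst sum_negf[symmetric], rule sum.cong[OF refl])
      fix N assume "N \<in> Pow M'"
      then have "h \<notin> N" using M by auto
      then show "(-1) ^ card (insert h N) * \<Phi> (conj_set (insert h N) z) = - ((-1) ^ card N * \<Phi> (conj_set N (conj_at h z)))"
        by (simp add: conj_set_insert)
    qed
    also have "antisym M' \<Phi> z + - (\<Sum>N\<in>Pow M'. (-1) ^ card N * \<Phi> (conj_set N (conj_at h z))) = c * (U z - U (conj_at h z))"
      using U(3)[OF z] U(3)[OF cz] unfolding cc by (simp add: c_def right_diff_distrib)
    finally show "2 * \<i> * of_real (Im (z $ h)) * V z = U z - U (conj_at h z)"
      using c0 by simp
  qed
  then show ?thesis using hU unfolding is_divided_diff_def by blast
qed

section \<open>Characters of the group of conjugations\<close>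

lemma minus_one_power_prod:
  assumes "finite N"
  shows "(-1) ^ card (N \<inter> A) = (\<Prod>k\<in>N. if k \<in> A then -1 else (1::'a::comm_ring_1))"
  using assms by (simp add: prod.If_cases)

text \<open>The sum over all subsets is a product over \<open>k \<in> M\<close> of factors \<open>1 + 1\<close> or \<open>1 - 1\<close>.\<close>

lemma character_orthogonality:
  assumes M: "finite M"
  shows "(\<Sum>N\<in>Pow M. (-1) ^ card (N \<inter> A) * (-1) ^ card (N \<inter> B))
       = (if A \<inter> M = B \<inter> M then 2 ^ card M else (0::'a::comm_ring_1))"
proof -
  define g where "g k = (if k \<in> A then -1 else 1) * (if k \<in> B then -1 else (1::'a))" for k
  have "(\<Sum>N\<in>Pow M. (-1) ^ card (N \<inter> A) * (-1) ^ card (N \<inter> B)) = (\<Sum>N\<in>Pow M. (\<Prod>k\<in>N. g k) * (\<Prod>k\<in>M - N. 1))"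
  proof (rule sum.cong[OF refl])
    fix N assume "N \<in> Pow M"
    then have "finite N" using M by (auto intro: finite_subset)
    then show "(-1) ^ card (N \<inter> A) * (-1) ^ card (N \<inter> B) = (\<Prod>k\<in>N. g k) * (\<Prod>k\<in>M - N. 1)"
      by (simp only: minus_one_power_prod g_def prod.distrib prod.neutral_const mult_1_right)
  qed
  also have "\<dots> = (\<Prod>k\<in>M. g k + 1)" by (rule prod_add[OF M, symmetric])
  also have "\<dots> = (if A \<inter> M = B \<inter> M then 2 ^ card M else 0)"
  proof (cases "A \<inter> M = B \<inter> M")
    case True
    then have "(\<Prod>k\<in>M. g k + 1) = (\<Prod>k\<in>M. 2)" by (intro prod.cong) (auto simp: g_def)
    then show ?thesis using True by simp
  next
    case False
    then obtain k where "k \<in> M" "(k \<in> A) \<noteq> (k \<in> B)" by auto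
    then have "g k + 1 = 0" by (auto simp: g_def)
    then show ?thesis using False M \<open>k \<in> M\<close> by (auto intro!: prod_zero)
  qed
  finally show ?thesis .
qed

lemma stem_conj_set':
  assumes "stem_function D F" "invariant_set D" "z \<in> D"
  shows "conj_set N z \<in> D" "F (conj_set N z) $ K = (-1) ^ card (K \<inter> N) * F z $ K"
  using stem_conj_set[OF assms, of N K] by (simp_all add: conj_set_def)

section \<open>From stem functions to holomorphic functions\<close>

text \<open>For fixed \<open>L\<close> and \<open>b\<close>, the components \<open>L \<union> Q\<close> with \<open>Q \<subseteq> M\<close> are combined into one complex number by
substituting \<open>\<i>\<close> for every \<open>e\<^sub>h\<close> with \<open>h \<in> M\<close>. This makes all the complex structures \<open>\<J>\<^sub>h\<close>, \<open>h \<in> M\<close>, equal to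
multiplication by \<open>\<i>\<close>, while the parity of the components still allows each of them to be recovered.\<close>

definition partial_char :: "'n::finite set \<Rightarrow> 'n set \<Rightarrow> quat \<Rightarrow> 'n tensor \<Rightarrow> complex" where
  "partial_char M L b v = (\<Sum>Q\<in>Pow M. \<i> ^ card Q * of_real (inner (v $ (L \<union> Q)) b))"

lemma bounded_linear_partial_char: "bounded_linear (partial_char M L b)"
proof -
  have scale: "c * of_real (r * x) = r *\<^sub>R (c * complex_of_real x)" for c r x
    by (simp add: scaleR_conv_of_real)
  show ?thesis
    unfolding linear_conv_bounded_linear[symmetric]
    by (rule linearI)
       (simp_all add: partial_char_def inner_add_left distrib_left sum.distrib scale scaleR_sum_right del: of_real_mult)
qed

lemma sum_axis_nth:
  fixes f :: "'i::finite \<Rightarrow> 'a::comm_monoid_add"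
  shows "(\<Sum>i\<in>UNIV. axis (\<sigma> i) (f i)) $ j = (\<Sum>i\<in>{i. \<sigma> i = j}. f i)"
proof -
  have "(\<Sum>i\<in>UNIV. axis (\<sigma> i) (f i)) $ j = (\<Sum>i\<in>UNIV. if \<sigma> i = j then f i else 0)"
    by (simp add: sum_component axis_def eq_commute)
  then show ?thesis by (simp add: sum.If_cases)
qed

lemma tensor_J_nth:
  "tensor_J h v $ T = (if h \<in> T then v $ (T - {h}) else - v $ (insert h T))"
proof -
  have "{K. sym_diff K {h} = T} = {sym_diff T {h}}" by auto
  then have "tensor_J h v $ T = (-1) ^ card (sym_diff T {h} \<inter> {h}) * v $ (sym_diff T {h})"
    unfolding tensor_J_def sum_axis_nth by simp
  moreover have "sym_diff T {h} = (if h \<in> T then T - {h} else insert h T)" by auto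
  moreover have "sym_diff T {h} \<inter> {h} = (if h \<in> T then {} else {h})" by auto
  ultimately show ?thesis by simp
qed

lemma partial_char_tensor_J:
  assumes h: "h \<in> M" "L \<inter> M = {}"
  shows "partial_char M L b (tensor_J h v) = \<i> * partial_char M L b v"
proof -
  have "partial_char M L b (tensor_J h v) =
     (\<Sum>Q\<in>Pow M. \<i> ^ card Q * of_real (inner (if h \<in> Q then v $ (L \<union> (Q - {h})) else - v $ (L \<union> insert h Q)) b))"
    unfolding partial_char_def
  proof (rule sum.cong[OF refl])
    fix Q assume "Q \<in> Pow M"
    have "h \<notin> L" using h by auto
    then have "tensor_J h v $ (L \<union> Q) = (if h \<in> Q then v $ (L \<union> (Q - {h})) else - v $ (L \<union> insert h Q))"
      unfolding tensor_J_nth by (auto intro!: arg_cong[where f="vec_nth v"])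
    then show "\<i> ^ card Q * of_real (inner (tensor_J h v $ (L \<union> Q)) b) =
       \<i> ^ card Q * of_real (inner (if h \<in> Q then v $ (L \<union> (Q - {h})) else - v $ (L \<union> insert h Q)) b)" by simp
  qed
  also have "\<dots> = (\<Sum>Q\<in>Pow M. \<i> * (\<i> ^ card Q * of_real (inner (v $ (L \<union> Q)) b)))"
  proof (rule sum.reindex_bij_witness[where i="\<lambda>Q. sym_diff Q {h}" and j="\<lambda>Q. sym_diff Q {h}"])
    fix Q assume Q: "Q \<in> Pow M"
    show "sym_diff (sym_diff Q {h}) {h} = Q" by auto
    show "sym_diff Q {h} \<in> Pow M" using Q h by auto
    have fin: "finite Q" by simp
    show "\<i> * (\<i> ^ card (sym_diff Q {h}) * of_real (inner (v $ (L \<union> sym_diff Q {h})) b)) =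
       \<i> ^ card Q * of_real (inner (if h \<in> Q then v $ (L \<union> (Q - {h})) else - v $ (L \<union> insert h Q)) b)"
    proof (cases "h \<in> Q")
      case True
      then have "sym_diff Q {h} = Q - {h}" "card Q = Suc (card (Q - {h}))"
        using card_Suc_Diff1[OF fin True] by auto
      then show ?thesis using True by (simp only: power_Suc if_True mult.assoc)
    next
      case False
      then have "sym_diff Q {h} = insert h Q" "card (insert h Q) = Suc (card Q)" by auto
      then show ?thesis using False by (simp add: mult.assoc[symmetric])
    qed
  next
    fix Q assume Q: "Q \<in> Pow M"
    show "sym_diff (sym_diff Q {h}) {h} = Q" by auto
    show "sym_diff Q {h} \<in> Pow M" using Q h by auto
  qed
  also have "\<dots> = \<i> * partial_char M L b v"
    by (simp add: partial_char_def sum_distrib_left)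
  finally show ?thesis .
qed

lemma axis_complex_split: "axis h \<zeta> = Re \<zeta> *\<^sub>R axis h 1 + Im \<zeta> *\<^sub>R (axis h \<i> :: 'n::finite cvec)"
  by (auto simp: vec_eq_iff axis_def complex_eq_iff)

text \<open>The equation \<open>dbar h F = 0\<close> turns into the ordinary Cauchy-Riemann equation in \<open>z\<^sub>h\<close>.\<close>

lemma holo_in_partial_char:
  fixes D :: "'n::finite cvec set"
  assumes D: "open D" and F: "stem_holomorphic D F" and h: "h \<in> M" "L \<inter> M = {}"
  shows "holo_in D h (\<lambda>z. partial_char M L b (F z))"
  unfolding holo_in_def
proof
  fix z assume z: "z \<in> D"
  let ?A = "partial_char M L b"
  interpret A: bounded_linear ?A by (rule bounded_linear_partial_char)
  have "((\<lambda>\<zeta>. ?A (F (upd z h \<zeta>))) has_field_derivative ?A (frechet_derivative F (at (upd z h \<zeta>)) (axis h 1))) (at \<zeta>)"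
    if \<zeta>: "upd z h \<zeta> \<in> D" for \<zeta>
  proof -
    define F' where "F' = frechet_derivative F (at (upd z h \<zeta>))"
    have "F differentiable (at (upd z h \<zeta>))" using F \<zeta> by (simp add: stem_holomorphic_def C1_on_def)
    then have F': "(F has_derivative F') (at (upd z h \<zeta>))"
      unfolding F'_def by (rule frechet_derivative_works[THEN iffD1])
    interpret F': bounded_linear F' by (rule has_derivative_bounded_linear[OF F'])
    have "dbar h F (upd z h \<zeta>) = 0" using F \<zeta> by (simp add: stem_holomorphic_def)
    then have "F' (axis h 1) + tensor_J h (F' (axis h \<i>)) = 0" by (simp add: dbar_def F'_def)
    then have "?A (F' (axis h 1)) + \<i> * ?A (F' (axis h \<i>)) = 0"
      by (metis A.add A.zero partial_char_tensor_J[OF h])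
    then have "\<i> * (?A (F' (axis h 1)) + \<i> * ?A (F' (axis h \<i>))) = 0" by simp
    then have CR: "?A (F' (axis h \<i>)) = \<i> * ?A (F' (axis h 1))"
      by (simp add: algebra_simps)
    have lin: "bounded_linear (axis h :: complex \<Rightarrow> 'n cvec)"
      unfolding linear_conv_bounded_linear[symmetric]
      by (rule linearI) (auto simp: vec_eq_iff axis_def)
    have U: "((\<lambda>\<zeta>. upd z h \<zeta>) has_derivative axis h) (at \<zeta>)"
    proof -
      have split: "(\<lambda>\<zeta>. upd z h \<zeta>) = (\<lambda>\<zeta>. upd z h 0 + axis h \<zeta>)" by (rule ext) (rule upd_eq_axis)
      have "((\<lambda>\<zeta>. upd z h 0 + axis h \<zeta>) has_derivative (\<lambda>d. 0 + axis h d)) (at \<zeta>)"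
        by (rule has_derivative_add[OF has_derivative_const bounded_linear_imp_has_derivative[OF lin]])
      then show ?thesis by (subst split) simp
    qed
    have der: "((\<lambda>\<zeta>. ?A (F (upd z h \<zeta>))) has_derivative (\<lambda>d. ?A (F' (axis h d)))) (at \<zeta>)"
      using A.has_derivative[OF has_derivative_compose[OF U F']] .
    have "?A (F' (axis h d)) = ?A (F' (axis h 1)) * d" for d
    proof -
      have "?A (F' (axis h d)) = Re d *\<^sub>R ?A (F' (axis h 1)) + Im d *\<^sub>R ?A (F' (axis h \<i>))"
        by (subst axis_complex_split) (simp only: F'.add F'.scale A.add A.scale)
      also have "\<dots> = ?A (F' (axis h 1)) * (of_real (Re d) + \<i> * of_real (Im d))"
        unfolding CR by (simp add: scaleR_conv_of_real algebra_simps)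
      also have "of_real (Re d) + \<i> * of_real (Im d) = d" by (simp add: complex_eq_iff)
      finally show ?thesis .
    qed
    then have "(\<lambda>d. ?A (F' (axis h d))) = (*) (?A (F' (axis h 1)))" by (rule ext)
    with der show ?thesis unfolding has_field_derivative_def F'_def[symmetric] by (rule back_subst)
  qed
  then show "(\<lambda>\<zeta>. ?A (F (upd z h \<zeta>))) holomorphic_on {\<zeta>. upd z h \<zeta> \<in> D}"
    using open_slice[OF D, of z h] by (auto simp: holomorphic_on_open)
qed

section \<open>Antisymmetrisation of the coordinate product\<close>

abbreviation coord_coeff :: "'n::finite cvec \<Rightarrow> 'n set \<Rightarrow> 'n set \<Rightarrow> real" where
  "coord_coeff z K P \<equiv> (\<Prod>k\<in>K - P. Re (z $ k)) * (\<Prod>k\<in>P. Im (z $ k))"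

lemma prod_conj_set:
  fixes z :: "'n::finite cvec"
  shows "(\<Prod>k\<in>K. conj_set N z $ k)
    = (\<Sum>P\<in>Pow K. \<i> ^ card P * (-1) ^ card (N \<inter> P) * of_real (coord_coeff z K P))"
proof -
  have "(\<Prod>k\<in>K. conj_set N z $ k) = (\<Prod>k\<in>K. (\<i> * (if k \<in> N then -1 else 1) * of_real (Im (z $ k))) + of_real (Re (z $ k)))"
    by (rule prod.cong) (auto simp: conj_set_def complex_eq_iff)
  also have "\<dots> = (\<Sum>P\<in>Pow K. (\<Prod>k\<in>P. \<i> * (if k \<in> N then -1 else 1) * of_real (Im (z $ k))) * (\<Prod>k\<in>K - P. of_real (Re (z $ k))))"
    by (rule prod_add) simp
  also have "\<dots> = (\<Sum>P\<in>Pow K. \<i> ^ card P * (-1) ^ card (N \<inter> P) * of_real (coord_coeff z K P))"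
    by (rule sum.cong[OF refl])
       (simp add: prod.distrib minus_one_power_prod Int_commute[of N] mult_ac)
  finally show ?thesis .
qed

lemma partial_char_conj_set:
  assumes "stem_function D F" "invariant_set D" "z \<in> D" "N \<subseteq> M" "L \<inter> M = {}"
  shows "partial_char M L b (F (conj_set N z))
     = (\<Sum>Q\<in>Pow M. \<i> ^ card Q * (-1) ^ card (N \<inter> Q) * of_real (inner (F z $ (L \<union> Q)) b))"
  unfolding partial_char_def
proof (rule sum.cong[OF refl])
  fix Q assume "Q \<in> Pow M"
  have "(L \<union> Q) \<inter> N = N \<inter> Q" using assms(4,5) by auto
  then have "F (conj_set N z) $ (L \<union> Q) = (-1) ^ card (N \<inter> Q) * F z $ (L \<union> Q)"
    using stem_conj_set'(2)[OF assms(1-3), of N "L \<union> Q"] by simp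
  then show "\<i> ^ card Q * of_real (inner (F (conj_set N z) $ (L \<union> Q)) b)
      = \<i> ^ card Q * (-1) ^ card (N \<inter> Q) * of_real (inner (F z $ (L \<union> Q)) b)"
    by (cases "even (card (N \<inter> Q))") simp_all
qed

text \<open>Conjugation of the variables in \<open>N\<close> multiplies the term with index \<open>P\<close> of \<open>z\<^sub>K\<close> and the component \<open>L \<union> Q\<close> of
\<open>F\<close> by signs. By orthogonality of characters the alternating sum keeps exactly the products that are
odd in every variable of \<open>M\<close>, that is \<open>Q = M - P\<close>. By \<open>tensor_mult_coord_stem\<close> below, the sum that remains
is the component \<open>L \<union> M\<close> of the stem function of \<open>x\<^sub>K \<odot> f\<close>.\<close>

lemma antisymmetrised_coordinate_product:
  fixes D :: "'n::finite cvec set"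
  assumes F: "stem_function D F" "invariant_set D" "z \<in> D" and KM: "K \<subseteq> M" and L: "L \<inter> M = {}"
  shows "(\<Sum>N\<in>Pow M. (-1) ^ card N * ((\<Prod>k\<in>K. conj_set N z $ k) * partial_char M L b (F (conj_set N z))))
     = (2 * \<i>) ^ card M * of_real (\<Sum>P\<in>Pow K. coord_coeff z K P
          * inner (F z $ (L \<union> (M - P))) b)"
proof -
  define a where "a P = coord_coeff z K P" for P
  define x where "x Q = inner (F z $ (L \<union> Q)) b" for Q
  have "(\<Sum>N\<in>Pow M. (-1) ^ card N * ((\<Prod>k\<in>K. conj_set N z $ k) * partial_char M L b (F (conj_set N z))))
     = (\<Sum>N\<in>Pow M. \<Sum>P\<in>Pow K. \<Sum>Q\<in>Pow M. (\<i> ^ card P * \<i> ^ card Q * of_real (a P * x Q)) *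
          ((-1) ^ card (N \<inter> (M - P)) * (-1) ^ card (N \<inter> Q)))"
  proof (rule sum.cong[OF refl])
    fix N assume N: "N \<in> Pow M"
    have e: "(-1) ^ card N * (-1) ^ card (N \<inter> P) = ((-1) ^ card (N \<inter> (M - P)) :: complex)" for P
    proof -
      have "card N = card (N \<inter> P) + card (N \<inter> (M - P))"
        using N by (subst card_Un_disjoint[symmetric]) (auto intro!: arg_cong[where f=card])
      then show ?thesis by (simp add: power_add mult_ac flip: power_mult_distrib)
    qed
    have "(-1) ^ card N * ((\<Prod>k\<in>K. conj_set N z $ k) * partial_char M L b (F (conj_set N z)))
      = (-1) ^ card N * ((\<Sum>P\<in>Pow K. \<i> ^ card P * (-1) ^ card (N \<inter> P) * of_real (a P)) *
         (\<Sum>Q\<in>Pow M. \<i> ^ card Q * (-1) ^ card (N \<inter> Q) * of_real (x Q)))"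
      using N unfolding a_def x_def by (subst prod_conj_set, subst partial_char_conj_set[OF F _ L]) auto
    also have "\<dots> = (\<Sum>P\<in>Pow K. \<Sum>Q\<in>Pow M. (-1) ^ card N * ((\<i> ^ card P * (-1) ^ card (N \<inter> P) * of_real (a P)) *
          (\<i> ^ card Q * (-1) ^ card (N \<inter> Q) * of_real (x Q))))"
      by (subst sum_product) (simp only: sum_distrib_left)
    also have "\<dots> = (\<Sum>P\<in>Pow K. \<Sum>Q\<in>Pow M. (\<i> ^ card P * \<i> ^ card Q * of_real (a P * x Q)) *
          ((-1) ^ card (N \<inter> (M - P)) * (-1) ^ card (N \<inter> Q)))"
      unfolding e[symmetric] by (intro sum.cong refl) (simp add: mult_ac)
    finally show "(-1) ^ card N * ((\<Prod>k\<in>K. conj_set N z $ k) * partial_char M L b (F (conj_set N z)))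
      = (\<Sum>P\<in>Pow K. \<Sum>Q\<in>Pow M. (\<i> ^ card P * \<i> ^ card Q * of_real (a P * x Q)) *
          ((-1) ^ card (N \<inter> (M - P)) * (-1) ^ card (N \<inter> Q)))" .
  qed
  also have "\<dots> = (\<Sum>P\<in>Pow K. \<Sum>Q\<in>Pow M. \<Sum>N\<in>Pow M. (\<i> ^ card P * \<i> ^ card Q * of_real (a P * x Q)) *
          ((-1) ^ card (N \<inter> (M - P)) * (-1) ^ card (N \<inter> Q)))"
    by (subst sum.swap) (intro sum.cong refl sum.swap)
  also have "\<dots> = (\<Sum>P\<in>Pow K. \<Sum>Q\<in>Pow M. if Q = M - P then (2 * \<i>) ^ card M * of_real (a P * x (M - P)) else 0)"
  proof (intro sum.cong refl)
    fix P Q assume P: "P \<in> Pow K" and Q: "Q \<in> Pow M"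
    have "(M - P) \<inter> M = Q \<inter> M \<longleftrightarrow> Q = M - P" using Q by auto
    moreover have "card P + card (M - P) = card M"
      using P KM by (subst card_Un_disjoint[symmetric]) (auto intro!: arg_cong[where f=card])
    then have "\<i> ^ card P * \<i> ^ card (M - P) = \<i> ^ card M" by (metis power_add)
    ultimately show "(\<Sum>N\<in>Pow M. (\<i> ^ card P * \<i> ^ card Q * of_real (a P * x Q)) *
          ((-1) ^ card (N \<inter> (M - P)) * (-1) ^ card (N \<inter> Q)))
       = (if Q = M - P then (2 * \<i>) ^ card M * of_real (a P * x (M - P)) else 0)"
      unfolding sum_distrib_left[symmetric] character_orthogonality[OF finite]
      by (simp add: power_mult_distrib mult_ac)
  qed
  also have "\<dots> = (\<Sum>P\<in>Pow K. (2 * \<i>) ^ card M * of_real (a P * x (M - P)))"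
    by (intro sum.cong refl) (simp add: sum.delta)
  also have "\<dots> = (2 * \<i>) ^ card M * of_real (\<Sum>P\<in>Pow K. a P * x (M - P))"
    by (simp add: sum_distrib_left)
  finally show ?thesis unfolding a_def x_def .
qed

text \<open>Dividing the antisymmetrised function by all \<open>\<beta>\<^sub>h\<close> is an iterated divided difference, so the quotient extends
continuously over the points with real coordinates.\<close>

lemma component_extension:
  fixes D :: "'n::finite cvec set" and F :: "'n cvec \<Rightarrow> 'n tensor"
  assumes D: "open D" "invariant_set D" and F: "stem_function D F" "stem_holomorphic D F"
    and KM: "K \<subseteq> M" and L: "L \<inter> M = {}"
  shows "\<exists>V :: 'n cvec \<Rightarrow> quat. continuous_on D V \<and>
    (\<forall>z\<in>D. im_prod M z *\<^sub>R V z
        = (\<Sum>P\<in>Pow K. coord_coeff z K P *\<^sub>R F z $ (L \<union> (M - P)))) \<and>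
    (\<forall>h\<in>M. \<forall>b\<in>Basis. is_divided_diff D h (\<lambda>z. of_real (inner (V z) b)))"
proof -
  define \<Psi> where "\<Psi> b z = (\<Prod>k\<in>K. z $ k) * partial_char M L b (F z)" for b z
  define R where "R z = (\<Sum>P\<in>Pow K. coord_coeff z K P *\<^sub>R F z $ (L \<union> (M - P)))" for z
  have contF: "continuous_on D F" using F by (simp add: stem_function_def)
  have cont\<Psi>: "continuous_on D (\<Psi> b)" for b
    unfolding \<Psi>_def[abs_def]
    by (intro continuous_intros bounded_linear.continuous_on[OF bounded_linear_partial_char contF])
  have hol\<Psi>: "holo_in D h (\<Psi> b)" if "h \<in> M" for h b
    unfolding holo_in_def \<Psi>_def
  proof
    fix z assume z: "z \<in> D"
    have "(\<lambda>\<zeta>. upd z h \<zeta> $ k) holomorphic_on S" for k S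
      unfolding upd_nth by (cases "k = h") (auto intro: holomorphic_intros)
    then show "(\<lambda>\<zeta>. (\<Prod>k\<in>K. upd z h \<zeta> $ k) * partial_char M L b (F (upd z h \<zeta>))) holomorphic_on {\<zeta>. upd z h \<zeta> \<in> D}"
      using holo_in_partial_char[OF D(1) F(2) that L, of b] z
      by (intro holomorphic_intros) (auto simp: holo_in_def)
  qed
  have sum: "antisym M (\<Psi> b) z = (2 * \<i>) ^ card M * of_real (inner (R z) b)" if "z \<in> D" for b z
    unfolding \<Psi>_def antisymmetrised_coordinate_product[OF F(1) D(2) that KM L] R_def
    by (simp add: inner_sum_left)
  have "\<exists>W. continuous_on D W \<and> (\<forall>z\<in>D. of_real (im_prod M z) * W z = of_real (inner (R z) b))
      \<and> (\<forall>h\<in>M. is_divided_diff D h (\<lambda>z. W z))" for b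
  proof -
    from iterated_divided_diff[OF D cont\<Psi>[of b] hol\<Psi> order_refl] obtain W where
      "continuous_on D W \<and> (\<forall>k\<in>M - M. holo_in D k W) \<and> (\<forall>z\<in>D. (2 * \<i>) ^ card M * of_real (im_prod M z) * W z
       = antisym M (\<Psi> b) z)" by (rule exE)
    then have W: "continuous_on D W" "\<And>z. z \<in> D \<Longrightarrow> (2 * \<i>) ^ card M * of_real (im_prod M z) * W z
       = antisym M (\<Psi> b) z" by blast+
    have "of_real (im_prod M z) * W z = of_real (inner (R z) b)" if z: "z \<in> D" for z
    proof -
      have "(2 * \<i>) ^ card M * (of_real (im_prod M z) * W z) = (2 * \<i>) ^ card M * of_real (inner (R z) b)"
        using W(2)[OF z] sum[OF z, of b] by (simp only: mult.assoc)
      then show ?thesis by simp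
    qed
    moreover have "is_divided_diff D h (\<lambda>z. W z)" if "h \<in> M" for h
      by (rule iterated_divided_diff_last[OF D cont\<Psi> hol\<Psi> W that])
    ultimately show ?thesis using W(1) by blast
  qed
  then obtain W where W: "\<And>b. continuous_on D (W b)"
    "\<And>b z. z \<in> D \<Longrightarrow> of_real (im_prod M z) * W b z = of_real (inner (R z) b)"
    "\<And>b h. h \<in> M \<Longrightarrow> is_divided_diff D h (W b)"
    by metis
  \<comment> \<open>a priori \<open>W b\<close> is complex; it is real where it is a quotient of reals, hence everywhere\<close>
  have Wreal: "of_real (Re (W b z)) = W b z" if z: "z \<in> D" for b z
  proof (rule continuous_eq_from_nonreal[OF D(1) _ W(1) _ z, where M=M])
    show "continuous_on D (\<lambda>z. complex_of_real (Re (W b z)))" by (intro continuous_intros W(1))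
    fix z assume zn: "z \<in> nonreal_part M D"
    then have z: "z \<in> D" by (simp add: nonreal_part_def)
    have "im_prod M z \<noteq> 0" using zn by (simp add: nonreal_part_def)
    then have "W b z = of_real (inner (R z) b / im_prod M z)"
      using W(2)[OF z, of b] by (simp add: field_simps del: of_real_prod)
    then show "of_real (Re (W b z)) = W b z" by simp
  qed
  define V where "V z = (\<Sum>b\<in>Basis. Re (W b z) *\<^sub>R b)" for z
  have Vb: "inner (V z) b = Re (W b z)" if "b \<in> Basis" for b z
    using that by (simp add: V_def inner_sum_left inner_Basis if_distrib cong: if_cong)
  show ?thesis
  proof (intro exI[of _ V] conjI ballI)
    show "continuous_on D V" unfolding V_def by (intro continuous_intros W(1))
  next
    fix z assume z: "z \<in> D"
    have "im_prod M z *\<^sub>R V z = R z"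
    proof (rule euclidean_eqI)
      fix b :: quat assume b: "b \<in> Basis"
      have "Re (of_real (im_prod M z) * W b z) = inner (R z) b"
        unfolding W(2)[OF z] by simp
      then show "inner (im_prod M z *\<^sub>R V z) b = inner (R z) b"
        using Vb[OF b, of z] by (simp del: of_real_prod)
    qed
    then show "im_prod M z *\<^sub>R V z
        = (\<Sum>P\<in>Pow K. coord_coeff z K P *\<^sub>R F z $ (L \<union> (M - P)))"
      unfolding R_def .
  next
    fix h b assume h: "h \<in> M" and b: "b \<in> (Basis :: quat set)"
    show "is_divided_diff D h (\<lambda>z. of_real (inner (V z) b))"
      using W(3)[OF h, of b] Wreal[of _ b] unfolding Vb[OF b] is_divided_diff_def by simp
  qed
qed

section \<open>Stem functions and slice products\<close>

definition has_stem :: "'n::{finite,linorder} cvec set \<Rightarrow> ('n qvec \<Rightarrow> quat) \<Rightarrow> ('n cvec \<Rightarrow> 'n tensor) \<Rightarrow> bool" where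
  "has_stem D f F \<longleftrightarrow> stem_function D F \<and> (\<forall>x\<in>circularization D. f x = induced D F x)"

lemma mem_circularizationE:
  assumes "x \<in> circularization D"
  obtains z J where "x = slice_point z J" "z \<in> D" "\<And>h. J h \<in> imag_units"
  using assms unfolding circularization_def by blast

lemma has_stem_eval:
  assumes "has_stem D f F" "invariant_set D" "z \<in> D" "\<And>h. J h \<in> imag_units"
  shows "f (slice_point z J) = (\<Sum>K\<in>UNIV. ordered_prod J K * F z $ K)"
proof -
  have "slice_point z J \<in> circularization D" using assms(3,4) by (auto simp: circularization_def)
  then show ?thesis
    using assms(1) induced_slice_point[OF _ assms(2-4)] by (auto simp: has_stem_def)
qed

lemma has_stem_induced: "stem_function D F \<Longrightarrow> has_stem D (induced D F) F"
  by (simp add: has_stem_def)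

lemma has_stem_cong:
  assumes "has_stem D f F" "\<And>z. z \<in> D \<Longrightarrow> F z = G z" "invariant_set D"
  shows "has_stem D f G"
proof -
  have G: "stem_function D G"
    using assms unfolding has_stem_def stem_function_def invariant_set_def
    by (auto cong: continuous_on_cong_simp)
  moreover have "f x = induced D G x" if xD: "x \<in> circularization D" for x
  proof -
    obtain z J where x: "x = slice_point z J" "z \<in> D" "\<And>h. J h \<in> imag_units"
      using xD by (rule mem_circularizationE) blast
    show ?thesis
      using has_stem_eval[OF assms(1,3) x(2,3)] induced_slice_point[OF G assms(3) x(2,3)] assms(2)[OF x(2)]
      by (simp add: x(1))
  qed
  ultimately show ?thesis by (simp add: has_stem_def)
qed

lemma ordered_prod_nonzero:
  assumes "\<And>h. J h \<in> imag_units" shows "ordered_prod J K \<noteq> 0"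
proof -
  have "J h \<noteq> 0" for h using assms[of h] by (auto simp: imag_units_iff)
  then have "prod_list (map J xs) \<noteq> 0" for xs by (induction xs) auto
  then show ?thesis by (simp add: ordered_prod_def)
qed

lemma norm_ordered_prod:
  assumes "\<And>h. J h \<in> imag_units" shows "norm (ordered_prod J K) = 1"
proof -
  have "norm (J h) = 1" for h using assms[of h] by (auto simp: imag_units_iff)
  then have "norm (prod_list (map J xs)) = 1" for xs by (induction xs) (auto simp: norm_mult)
  then show ?thesis by (simp add: ordered_prod_def)
qed

lemma minus_one_power_scaleR: "(-1) ^ k * (x::quat) = ((-1) ^ k :: real) *\<^sub>R x"
  by (cases "even k") auto

text \<open>Changing the sign of \<open>J\<^sub>k\<close> for \<open>k \<in> N\<close> multiplies \<open>J\<^sub>K\<close> by \<open>(-1)^|N \<inter> K|\<close>. Evaluating the slice function for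
all \<open>N\<close> and inverting by orthogonality of characters isolates every \<open>J\<^sub>K * F\<^sub>K\<close>, and \<open>J\<^sub>K\<close> is invertible.\<close>

lemma has_stem_unique:
  fixes D :: "'n::{finite,linorder} cvec set"
  assumes F: "has_stem D f F" and G: "has_stem D f G" and D: "invariant_set D" and z: "z \<in> D"
  shows "F z = G z"
proof (subst vec_eq_iff, intro allI)
  fix T
  define J where "J = (\<lambda>_::'n. Quat 0 1 0 0)"
  have J: "J h \<in> imag_units" for h by (simp add: J_def imag_units_iff norm_quat_def)
  define c where "c K = ordered_prod J K * (F z $ K - G z $ K)" for K
  \<comment> \<open>the two slice functions agree at the point with the units in \<open>N\<close> reversed\<close>
  have zero: "(\<Sum>K\<in>UNIV. ((-1) ^ card (N \<inter> K) :: real) *\<^sub>R c K) = 0" for N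
  proof -
    define I where "I k = (if k \<in> N then - J k else J k)" for k
    have I: "I h \<in> imag_units" for h using J[of h] by (auto simp: I_def imag_units_iff)
    have "ordered_prod I K = (-1) ^ card (N \<inter> K) * ordered_prod J K" for K
      using ordered_prod_flip[of K I N J] by (simp add: I_def Int_commute)
    then have "(\<Sum>K\<in>UNIV. ((-1) ^ card (N \<inter> K) :: real) *\<^sub>R c K) = (\<Sum>K\<in>UNIV. ordered_prod I K * (F z $ K - G z $ K))"
      by (simp add: c_def mult.assoc minus_one_power_scaleR)
    also have "\<dots> = (\<Sum>K\<in>UNIV. ordered_prod I K * F z $ K) - (\<Sum>K\<in>UNIV. ordered_prod I K * G z $ K)"
      by (simp add: right_diff_distrib sum_subtractf)
    also have "\<dots> = 0"
      using has_stem_eval[OF F D z I] has_stem_eval[OF G D z I] by simp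
    finally show ?thesis .
  qed
  have "0 = (\<Sum>N\<in>Pow UNIV. ((-1) ^ card (N \<inter> T) :: real) *\<^sub>R (\<Sum>K\<in>UNIV. ((-1) ^ card (N \<inter> K) :: real) *\<^sub>R c K))"
    by (simp add: zero)
  also have "\<dots> = (\<Sum>K\<in>UNIV. (\<Sum>N\<in>Pow UNIV. (-1) ^ card (N \<inter> T) * (-1) ^ card (N \<inter> K)) *\<^sub>R c K)"
    by (simp add: scaleR_sum_right scaleR_sum_left) (rule sum.swap)
  also have "\<dots> = (\<Sum>K\<in>UNIV. if K = T then (2::real) ^ CARD('n) *\<^sub>R c T else 0)"
    by (rule sum.cong[OF refl], subst character_orthogonality) auto
  also have "\<dots> = (2::real) ^ CARD('n) *\<^sub>R c T" by simp
  finally have "c T = 0" by simp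
  then show "F z $ T = G z $ T"
    using ordered_prod_nonzero[of J T] J by (simp add: c_def)
qed

lemma stem_of_eq:
  assumes "has_stem D f F" "invariant_set D"
  shows "has_stem D f (stem_of D f)" "\<And>z. z \<in> D \<Longrightarrow> stem_of D f z = F z"
proof -
  show 1: "has_stem D f (stem_of D f)"
    unfolding stem_of_def has_stem_def by (rule someI[of _ F]) (use assms in \<open>simp add: has_stem_def\<close>)
  show "stem_of D f z = F z" if "z \<in> D" for z
    by (rule has_stem_unique[OF 1 assms that])
qed

lemma tensor_mult_nth:
  "tensor_mult v w $ T = (\<Sum>K\<in>UNIV. (-1) ^ card (sym_diff K T \<inter> K) * v $ K * w $ (sym_diff K T))"
proof -
  have "tensor_mult v w = (\<Sum>K\<in>UNIV. \<Sum>H\<in>UNIV. axis (sym_diff K H) ((-1) ^ card (H \<inter> K) * v $ K * w $ H))"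
    unfolding tensor_mult_def by (rule sum.swap)
  then have "tensor_mult v w $ T = (\<Sum>K\<in>UNIV. (\<Sum>H\<in>UNIV. axis (sym_diff K H) ((-1) ^ card (H \<inter> K) * v $ K * w $ H)) $ T)"
    by (simp only: sum_component)
  then have "tensor_mult v w $ T = (\<Sum>K\<in>UNIV. \<Sum>H\<in>{H. sym_diff K H = T}. (-1) ^ card (H \<inter> K) * v $ K * w $ H)"
    by (simp only: sum_axis_nth)
  moreover have "{H. sym_diff K H = T} = {sym_diff K T}" for K by auto
  ultimately show ?thesis by simp
qed

lemma stem_function_tensor_mult:
  assumes F: "stem_function D F" and G: "stem_function D G"
  shows "stem_function D (\<lambda>z. tensor_mult (F z) (G z))"
  unfolding stem_function_def
proof (intro conjI ballI allI)
  have cF: "continuous_on D (\<lambda>z. F z $ K)" and cG: "continuous_on D (\<lambda>z. G z $ K)" for K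
    using F G by (auto simp: stem_function_def intro!: continuous_intros)
  have "continuous_on D (\<lambda>z. \<chi> T. tensor_mult (F z) (G z) $ T)"
    unfolding tensor_mult_nth by (rule continuous_on_vec_lambda) (intro continuous_intros cF cG)
  then show "continuous_on D (\<lambda>z. tensor_mult (F z) (G z))" by simp
next
  fix z T h assume z: "z \<in> D"
  have s: "F (conj_at h z) $ K * G (conj_at h z) $ sym_diff K T = (-1) ^ card (T \<inter> {h}) * (F z $ K * G z $ sym_diff K T)" for K
  proof -
    have "F (conj_at h z) $ K = (-1) ^ card (K \<inter> {h}) * F z $ K"
      "G (conj_at h z) $ sym_diff K T = (-1) ^ card (sym_diff K T \<inter> {h}) * G z $ sym_diff K T"
      using F G z by (auto simp: stem_function_def)
    moreover have "K \<inter> {h} = (if h \<in> K then {h} else {})" "T \<inter> {h} = (if h \<in> T then {h} else {})"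
      "sym_diff K T \<inter> {h} = (if (h \<in> K) \<noteq> (h \<in> T) then {h} else {})" by auto
    ultimately show ?thesis by (cases "h \<in> K"; cases "h \<in> T") simp_all
  qed
  show "tensor_mult (F (conj_at h z)) (G (conj_at h z)) $ T = (-1) ^ card (T \<inter> {h}) * tensor_mult (F z) (G z) $ T"
    unfolding tensor_mult_nth sum_distrib_left
  proof (rule sum.cong[OF refl])
    fix K
    show "(-1) ^ card (sym_diff K T \<inter> K) * F (conj_at h z) $ K * G (conj_at h z) $ sym_diff K T
      = (-1) ^ card (T \<inter> {h}) * ((-1) ^ card (sym_diff K T \<inter> K) * F z $ K * G z $ sym_diff K T)"
      using s[of K] by (simp add: mult.assoc minus_one_power_scaleR)
  qed
qed

lemma has_stem_slice_mult:
  assumes D: "invariant_set D" and F: "has_stem D f F" and G: "has_stem D g G"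
  shows "has_stem D (slice_mult D f g) (\<lambda>z. tensor_mult (F z) (G z))"
proof -
  have "has_stem D (slice_mult D f g) (\<lambda>z. tensor_mult (stem_of D f z) (stem_of D g z))"
    unfolding slice_mult_def
    by (intro has_stem_induced stem_function_tensor_mult)
       (use stem_of_eq(1)[OF F D] stem_of_eq(1)[OF G D] in \<open>auto simp: has_stem_def\<close>)
  then show ?thesis
    by (rule has_stem_cong) (use stem_of_eq(2)[OF F D] stem_of_eq(2)[OF G D] D in auto)
qed

section \<open>The stem function of a product of coordinates\<close>

text \<open>The coefficient of \<open>e\<^sub>P\<close> in the product of the factors \<open>\<alpha>\<^sub>k + e\<^sub>k * \<beta>\<^sub>k\<close>, \<open>k \<in> K\<close>.\<close>

definition coord_stem :: "'n::finite set \<Rightarrow> 'n cvec \<Rightarrow> 'n tensor" where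
  "coord_stem K z = (\<chi> P. if P \<subseteq> K then of_real (coord_coeff z K P) else 0)"

lemma stem_function_coord_stem: "stem_function D (coord_stem K)"
  unfolding stem_function_def
proof (intro conjI ballI allI)
  have "continuous_on D (\<lambda>z. if P \<subseteq> K then of_real (coord_coeff z K P) else 0 :: quat)" for P
    by (cases "P \<subseteq> K") (auto intro!: continuous_intros)
  then show "continuous_on D (coord_stem K)"
    unfolding coord_stem_def[abs_def] by (rule continuous_on_vec_lambda)
next
  fix z :: "'a cvec" and P h
  have "(\<Prod>k\<in>K - P. Re (conj_at h z $ k)) = (\<Prod>k\<in>K - P. Re (z $ k))"
    by (rule prod.cong) (auto simp: conj_at_def)
  moreover have "(\<Prod>k\<in>P. Im (conj_at h z $ k)) = (-1) ^ card (P \<inter> {h}) * (\<Prod>k\<in>P. Im (z $ k))"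
  proof -
    have "(\<Prod>k\<in>P. Im (conj_at h z $ k)) = (\<Prod>k\<in>P. (if k \<in> {h} then -1 else 1) * Im (z $ k))"
      by (rule prod.cong) (auto simp: conj_at_def)
    then show ?thesis by (simp only: prod.distrib minus_one_power_prod[OF finite])
  qed
  ultimately show "coord_stem K (conj_at h z) $ P = (-1) ^ card (P \<inter> {h}) * coord_stem K z $ P"
    by (cases "even (card (P \<inter> {h}))") (simp_all add: coord_stem_def mult_ac)
qed

lemma tensor_mult_axis:
  fixes w :: "'n::finite tensor"
  shows "tensor_mult (axis {} p + axis {k} q) w $ T
     = p * w $ T + (if k \<in> T then q * w $ (T - {k}) else - (q * w $ (insert k T)))"
proof -
  have "tensor_mult (axis {} p + axis {k} q) w $ T =
     (\<Sum>K\<in>{{}, {k}}. (-1) ^ card (sym_diff K T \<inter> K) * (axis {} p + axis {k} q) $ K * w $ (sym_diff K T))"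
    unfolding tensor_mult_nth
    by (rule sum.mono_neutral_right) (auto simp: axis_def)
  also have "\<dots> = p * w $ T + (-1) ^ card (sym_diff {k} T \<inter> {k}) * q * w $ (sym_diff {k} T)"
    by (simp add: axis_def)
  also have "(-1) ^ card (sym_diff {k} T \<inter> {k}) * q * w $ (sym_diff {k} T) =
     (if k \<in> T then q * w $ (T - {k}) else - (q * w $ (insert k T)))"
  proof (cases "k \<in> T")
    case True
    then have "sym_diff {k} T = T - {k}" "sym_diff {k} T \<inter> {k} = {}" by auto
    then show ?thesis using True by simp
  next
    case False
    then have "sym_diff {k} T = insert k T" "sym_diff {k} T \<inter> {k} = {k}" by auto
    then show ?thesis using False by simp
  qed
  finally show ?thesis .
qed

lemma coord_stem_singleton:
  "coord_stem {k} z = axis {} (of_real (Re (z $ k))) + axis {k} (of_real (Im (z $ k)))"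
  by (auto simp: vec_eq_iff coord_stem_def axis_def subset_singleton_iff)

lemma coord_stem_insert:
  assumes "k \<notin> K"
  shows "tensor_mult (coord_stem {k} z) (coord_stem K z) = coord_stem (insert k K) z"
proof (subst vec_eq_iff, intro allI)
  fix T
  show "tensor_mult (coord_stem {k} z) (coord_stem K z) $ T = coord_stem (insert k K) z $ T"
  proof (cases "k \<in> T")
    case True
    have "T \<subseteq> insert k K \<longleftrightarrow> T - {k} \<subseteq> K" and "\<not> T \<subseteq> K" using True assms by auto
    moreover have "insert k K - T = K - (T - {k})" using True assms by auto
    moreover have "(\<Prod>i\<in>T. Im (z $ i)) = Im (z $ k) * (\<Prod>i\<in>T - {k}. Im (z $ i))"
      using True by (simp add: prod.remove)
    ultimately show ?thesis
      unfolding coord_stem_singleton tensor_mult_axis using True by (simp add: coord_stem_def mult_ac)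
  next
    case False
    have "T \<subseteq> insert k K \<longleftrightarrow> T \<subseteq> K" and "\<not> insert k T \<subseteq> K" using False assms by auto
    moreover have "insert k K - T = insert k (K - T)" "k \<notin> K - T" using False assms by auto
    ultimately show ?thesis
      unfolding coord_stem_singleton tensor_mult_axis using False by (simp add: coord_stem_def mult_ac)
  qed
qed

lemma has_stem_coord_prod:
  fixes D :: "'n::{finite,linorder} cvec set"
  assumes D: "invariant_set D"
  shows "has_stem D (coord_prod D K) (coord_stem K)"
proof -
  have "has_stem D (foldr (\<lambda>k. slice_mult D (coord_fun D k)) xs (\<lambda>_. 1)) (coord_stem (set xs))"
    if "distinct xs" for xs
    using that
  proof (induction xs)
    case Nil
    have "induced D (coord_stem {}) x = 1" if xD: "x \<in> circularization D" for x
    proof -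
      obtain z J where x: "x = slice_point z J" "z \<in> D" "\<And>h. J h \<in> imag_units"
        using xD by (rule mem_circularizationE) blast
      have "induced D (coord_stem {}) x = (\<Sum>K\<in>UNIV. ordered_prod J K * coord_stem {} z $ K)"
        unfolding x(1) by (rule induced_slice_point[OF stem_function_coord_stem D x(2,3)])
      also have "\<dots> = (\<Sum>K\<in>UNIV. if (K :: 'n set) = {} then ordered_prod J {} else 0)"
        by (rule sum.cong) (auto simp: coord_stem_def)
      also have "\<dots> = ordered_prod J {}" by simp
      also have "\<dots> = 1" by (simp add: ordered_prod_def)
      finally show ?thesis .
    qed
    then show ?case by (simp add: has_stem_def stem_function_coord_stem)
  next
    case (Cons k xs)
    have "has_stem D (coord_fun D k) (coord_stem {k})"
      unfolding coord_fun_def coord_stem_singleton[symmetric]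
      by (rule has_stem_induced[OF stem_function_coord_stem])
    moreover have "has_stem D (foldr (\<lambda>k. slice_mult D (coord_fun D k)) xs (\<lambda>_. 1)) (coord_stem (set xs))"
      using Cons by simp
    ultimately have "has_stem D (slice_mult D (coord_fun D k) (foldr (\<lambda>k. slice_mult D (coord_fun D k)) xs (\<lambda>_. 1)))
        (\<lambda>z. tensor_mult (coord_stem {k} z) (coord_stem (set xs) z))"
      by (rule has_stem_slice_mult[OF D])
    moreover have "(\<lambda>z. tensor_mult (coord_stem {k} z) (coord_stem (set xs) z)) = coord_stem (set (k # xs))"
      using Cons.prems by (simp add: coord_stem_insert)
    ultimately show ?case by simp
  qed
  from this[of "sorted_list_of_set K"] show ?thesis by (simp add: coord_prod_def)
qed

text \<open>For \<open>K \<subseteq> T\<close> there are no signs: \<open>e\<^sub>P\<close> contributes to the coefficient of \<open>e\<^sub>T\<close> only together with \<open>e\<^bsub>T - P\<^esub>\<close>,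
and \<open>P\<close> and \<open>T - P\<close> are disjoint.\<close>

lemma tensor_mult_coord_stem:
  assumes "K \<subseteq> T"
  shows "tensor_mult (coord_stem K z) w $ T
    = (\<Sum>P\<in>Pow K. coord_coeff z K P *\<^sub>R w $ (T - P))"
proof -
  have "tensor_mult (coord_stem K z) w $ T =
     (\<Sum>P\<in>Pow K. (-1) ^ card (sym_diff P T \<inter> P) * coord_stem K z $ P * w $ (sym_diff P T))"
    unfolding tensor_mult_nth
    by (rule sum.mono_neutral_right) (auto simp: coord_stem_def)
  also have "\<dots> = (\<Sum>P\<in>Pow K. coord_coeff z K P *\<^sub>R w $ (T - P))"
  proof (rule sum.cong[OF refl])
    fix P assume P: "P \<in> Pow K"
    then have "sym_diff P T = T - P" "sym_diff P T \<inter> P = {}" using assms by auto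
    then show "(-1) ^ card (sym_diff P T \<inter> P) * coord_stem K z $ P * w $ (sym_diff P T)
       = coord_coeff z K P *\<^sub>R w $ (T - P)"
      using P by (simp add: coord_stem_def scaleR_conv_of_real del: of_real_prod)
  qed
  finally show ?thesis .
qed

section \<open>Canonical representation of points\<close>

definition stem_point :: "'n::finite qvec \<Rightarrow> 'n cvec" where
  "stem_point x = (\<chi> h. upper (x $ h))"

text \<open>The value at real quaternions is an arbitrary imaginary unit.\<close>

definition unit_of :: "quat \<Rightarrow> quat" where
  "unit_of q = (if im_part q = 0 then Quat 0 1 0 0 else im_part q /\<^sub>R norm (im_part q))"

lemma unit_of_imag_unit: "unit_of q \<in> imag_units"
  by (simp add: unit_of_def imag_units_iff) (simp add: norm_quat_def)

lemma slice_point_stem_point: "slice_point (stem_point x) (\<lambda>h. unit_of (x $ h)) = x"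
proof (subst vec_eq_iff, intro allI)
  fix h
  have "im_part q + of_real (q_re q) = q" for q by (simp add: im_part_def)
  moreover have "unit_of q * of_real (norm (im_part q)) = im_part q" for q
  proof (cases "im_part q = 0")
    case False
    then show ?thesis unfolding unit_of_def by (simp add: of_real_def)
  qed simp
  ultimately show "slice_point (stem_point x) (\<lambda>h. unit_of (x $ h)) $ h = x $ h"
    by (simp add: slice_point_def stem_point_def upper_def add.commute)
qed

lemma invariant_conj_set: "invariant_set D \<Longrightarrow> z \<in> D \<Longrightarrow> conj_set N z \<in> D"
  using stem_conj_set'(1)[OF stem_function_coord_stem] .

lemma stem_point_mem:
  assumes D: "invariant_set D"
  shows "stem_point x \<in> D \<longleftrightarrow> x \<in> circularization D"
proof
  assume "stem_point x \<in> D"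
  then have "slice_point (stem_point x) (\<lambda>h. unit_of (x $ h)) \<in> circularization D"
    unfolding circularization_def using unit_of_imag_unit by blast
  then show "x \<in> circularization D" by (simp add: slice_point_stem_point)
next
  assume "x \<in> circularization D"
  then obtain z J where x: "x = slice_point z J" "z \<in> D" "\<And>h. J h \<in> imag_units"
    by (rule mem_circularizationE) blast
  define N where "N = {h. Im (z $ h) < 0}"
  have "stem_point x = conj_set N z"
  proof (subst vec_eq_iff, intro allI)
    fix h
    have J: "q_re (J h) = 0" "norm (J h) = 1" using x(3)[of h] by (simp_all add: imag_units_iff)
    have "q_re (x $ h) = Re (z $ h)" using J by (simp add: x(1) slice_point_def)
    moreover have "im_part (x $ h) = J h * of_real (Im (z $ h))"
      unfolding im_part_def using J by (simp add: x(1) slice_point_def)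
    ultimately show "stem_point x $ h = conj_set N z $ h"
      using J by (auto simp: stem_point_def upper_def conj_set_def N_def norm_mult complex_eq_iff)
  qed
  then show "stem_point x \<in> D" using invariant_conj_set[OF D x(2)] by simp
qed

lemma induced_stem_point:
  assumes "stem_function D F" "invariant_set D" "x \<in> circularization D"
  shows "induced D F x = (\<Sum>K\<in>UNIV. ordered_prod (\<lambda>h. unit_of (x $ h)) K * F (stem_point x) $ K)"
  using induced_slice_point[OF assms(1,2), of "stem_point x" "\<lambda>h. unit_of (x $ h)"]
    stem_point_mem[OF assms(2)] assms(3) unit_of_imag_unit
  by (simp add: slice_point_stem_point)

lemma continuous_on_stem_point: "continuous_on A stem_point"
  unfolding stem_point_def[abs_def]
  by (intro continuous_on_vec_lambda continuous_on_compose2[OF continuous_on_upper[of UNIV]] continuous_intros) auto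

lemma tendsto_prod_list:
  fixes f :: "'k \<Rightarrow> 'a \<Rightarrow> 'b::real_normed_algebra_1"
  assumes "\<And>k. k \<in> set xs \<Longrightarrow> (f k \<longlongrightarrow> l k) F"
  shows "((\<lambda>x. prod_list (map (\<lambda>k. f k x) xs)) \<longlongrightarrow> prod_list (map l xs)) F"
  using assms by (induction xs) (auto intro!: tendsto_intros)

text \<open>The imaginary units jump at real coordinates. A term \<open>J\<^sub>K * F\<^sub>K\<close> is continuous there all the same: \<open>J\<^sub>K\<close> has
norm \<open>1\<close>, and \<open>F\<^sub>K\<close> tends to \<open>0\<close> when some \<open>z\<^sub>k\<close> with \<open>k \<in> K\<close> becomes real.\<close>

lemma continuous_on_induced:
  fixes D :: "'n::{finite,linorder} cvec set"
  assumes F: "stem_function D F" and D: "invariant_set D"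
  shows "continuous_on (circularization D) (induced D F)"
proof -
  define \<Omega> where "\<Omega> = circularization D"
  define J where "J x h = unit_of (x $ h)" for x :: "'n qvec" and h
  have "continuous_on \<Omega> (\<lambda>x. ordered_prod (J x) K * F (stem_point x) $ K)" for K
    unfolding continuous_on_def
  proof
    fix x assume x: "x \<in> \<Omega>"
    have Fc: "continuous_on \<Omega> (\<lambda>x. F (stem_point x) $ K)"
      using F D by (intro continuous_intros continuous_on_compose2[OF _ continuous_on_stem_point])
        (auto simp: stem_function_def \<Omega>_def stem_point_mem)
    then have Ft: "((\<lambda>x. F (stem_point x) $ K) \<longlongrightarrow> F (stem_point x) $ K) (at x within \<Omega>)"
      using x by (simp add: continuous_on_def)
    show "((\<lambda>x. ordered_prod (J x) K * F (stem_point x) $ K) \<longlongrightarrow> ordered_prod (J x) K * F (stem_point x) $ K) (at x within \<Omega>)"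
    proof (cases "\<exists>k\<in>K. im_part (x $ k) = 0")
      case True
      then obtain k where k: "k \<in> K" "Im (stem_point x $ k) = 0" by (auto simp: stem_point_def upper_def)
      have "stem_point x \<in> D" using x D by (simp add: \<Omega>_def stem_point_mem)
      then have z: "F (stem_point x) $ K = 0" by (rule stem_real_zero[OF F _ k])
      have "norm (ordered_prod (J y) K * F (stem_point y) $ K) = norm (F (stem_point y) $ K)" for y
        using norm_ordered_prod[of "J y" K] unit_of_imag_unit by (simp add: norm_mult J_def)
      then have "((\<lambda>y. norm (ordered_prod (J y) K * F (stem_point y) $ K)) \<longlongrightarrow> 0) (at x within \<Omega>)"
        using tendsto_norm[OF Ft] by (simp add: z)
      then show ?thesis by (simp add: z tendsto_norm_zero_iff)
    next
      case False
      have "((\<lambda>y. J y k) \<longlongrightarrow> J x k) (at x within \<Omega>)" if "k \<in> K" for k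
      proof -
        have nz: "im_part (x $ k) \<noteq> 0" using False that by blast
        have im: "((\<lambda>y. im_part (y $ k)) \<longlongrightarrow> im_part (x $ k)) (at x within \<Omega>)"
        proof -
          have "continuous_on UNIV (\<lambda>y::'n qvec. im_part (y $ k))"
            unfolding im_part_def by (intro continuous_intros)
          then show ?thesis unfolding continuous_on_def by (auto intro: tendsto_within_subset)
        qed
        have "\<forall>\<^sub>F y in at x within \<Omega>. im_part (y $ k) \<noteq> 0"
          using im nz by (rule tendsto_imp_eventually_ne)
        then have "\<forall>\<^sub>F y in at x within \<Omega>. im_part (y $ k) /\<^sub>R norm (im_part (y $ k)) = J y k"
          by eventually_elim (simp add: J_def unit_of_def)
        moreover have "((\<lambda>y. im_part (y $ k) /\<^sub>R norm (im_part (y $ k))) \<longlongrightarrow> im_part (x $ k) /\<^sub>R norm (im_part (x $ k))) (at x within \<Omega>)"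
          by (intro tendsto_intros im) (use nz in simp)
        ultimately show ?thesis
          using nz by (simp add: J_def unit_of_def Lim_transform_eventually)
      qed
      then have "((\<lambda>y. ordered_prod (J y) K) \<longlongrightarrow> ordered_prod (J x) K) (at x within \<Omega>)"
        unfolding ordered_prod_def by (intro tendsto_prod_list) simp
      then show ?thesis by (intro tendsto_mult Ft)
    qed
  qed
  then have "continuous_on \<Omega> (\<lambda>x. \<Sum>K\<in>UNIV. ordered_prod (J x) K * F (stem_point x) $ K)"
    by (rule continuous_on_sum)
  then show ?thesis
    unfolding \<Omega>_def J_def by (rule continuous_on_eq) (rule induced_stem_point[OF F D, symmetric])
qed

section \<open>Ordered products\<close>

lemma first_idx_less:
  assumes "k \<in> first_idx m" "l \<notin> first_idx m"
  shows "k < l"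
proof -
  define xs where "xs = sorted_list_of_set (UNIV :: 'a set)"
  have xs: "sorted xs" "distinct xs" "set xs = UNIV" by (simp_all add: xs_def)
  have k: "k \<in> set (take m xs)" using assms(1) by (simp add: first_idx_def xs_def)
  have "l \<in> set (take m xs) \<union> set (drop m xs)"
    unfolding set_append[symmetric] append_take_drop_id xs(3) by simp
  then have l: "l \<in> set (drop m xs)" using assms(2) by (auto simp: first_idx_def xs_def)
  have "sorted (take m xs @ drop m xs)" using xs(1) by simp
  then have "k \<le> l" using k l unfolding sorted_append by blast
  moreover have "k \<noteq> l" using assms by auto
  ultimately show ?thesis by simp
qed

lemma ordered_prod_Un:
  assumes "\<And>k l. k \<in> Q \<Longrightarrow> l \<in> L \<Longrightarrow> k < l"
  shows "ordered_prod J (Q \<union> L) = ordered_prod J Q * ordered_prod J L"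
proof -
  have "sorted_list_of_set (Q \<union> L) = sorted_list_of_set Q @ sorted_list_of_set L"
  proof (rule sorted_distinct_set_unique)
    show "sorted (sorted_list_of_set Q @ sorted_list_of_set L)"
      using assms by (auto simp: sorted_append less_imp_le)
    show "distinct (sorted_list_of_set Q @ sorted_list_of_set L)"
      using assms by (auto dest: less_irrefl[THEN notE, rotated])
  qed auto
  then show ?thesis by (simp add: ordered_prod_def)
qed

lemma ordered_prod_cong: "(\<And>k. k \<in> K \<Longrightarrow> I k = J k) \<Longrightarrow> ordered_prod I K = ordered_prod J K"
  unfolding ordered_prod_def by (intro arg_cong[where f=prod_list] map_cong) auto

lemma ordered_prod_scaled: "ordered_prod (\<lambda>k. J k * of_real (b k)) Q = (\<Prod>k\<in>Q. b k) *\<^sub>R ordered_prod J Q"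
proof -
  have "prod_list (map (\<lambda>k. J k * of_real (b k)) xs) = (\<Prod>k\<in>set xs. b k) *\<^sub>R prod_list (map J xs)" if "distinct xs" for xs
    using that by (induction xs) (simp_all add: of_real_def mult.commute)
  from this[of "sorted_list_of_set Q"] show ?thesis by (simp add: ordered_prod_def)
qed

text \<open>The real numbers \<open>a k\<close> are central, so multiplying out keeps the remaining factors in increasing order.\<close>

lemma ordered_prod_diff_expand:
  "ordered_prod (\<lambda>k. of_real (a k) - q k) Q
    = (\<Sum>T\<in>Pow Q. ((-1) ^ card T * (\<Prod>k\<in>Q - T. a k)) *\<^sub>R ordered_prod q T)"
proof -
  define op where "op T xs = prod_list (map q (filter (\<lambda>k. k \<in> T) xs))" for T xs
  have "prod_list (map (\<lambda>k. of_real (a k) - q k) xs) = (\<Sum>T\<in>Pow (set xs). ((-1) ^ card T * (\<Prod>k\<in>set xs - T. a k)) *\<^sub>R op T xs)"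
    if "distinct xs" for xs
    using that
  proof (induction xs)
    case (Cons x xs)
    then have x: "x \<notin> set xs" by simp
    let ?X = "set xs"
    let ?e = "\<lambda>T. ((-1) ^ card T * (\<Prod>k\<in>?X - T. a k)) *\<^sub>R op T xs"
    have "(\<Sum>T\<in>Pow (set (x # xs)). ((-1) ^ card T * (\<Prod>k\<in>set (x # xs) - T. a k)) *\<^sub>R op T (x # xs))
       = (\<Sum>T\<in>Pow ?X. ((-1) ^ card T * (\<Prod>k\<in>insert x ?X - T. a k)) *\<^sub>R op T (x # xs))
       + (\<Sum>T\<in>Pow ?X. ((-1) ^ card (insert x T) * (\<Prod>k\<in>insert x ?X - insert x T. a k)) *\<^sub>R op (insert x T) (x # xs))"
      unfolding list.simps(15) by (rule sum_Pow_insert) (use x in auto)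
    also have "(\<Sum>T\<in>Pow ?X. ((-1) ^ card T * (\<Prod>k\<in>insert x ?X - T. a k)) *\<^sub>R op T (x # xs))
       = of_real (a x) * (\<Sum>T\<in>Pow ?X. ?e T)"
      unfolding sum_distrib_left
    proof (rule sum.cong[OF refl])
      fix T assume T: "T \<in> Pow ?X"
      then have "x \<notin> T" using x by auto
      then have "insert x ?X - T = insert x (?X - T)" "x \<notin> ?X - T" "op T (x # xs) = op T xs"
        using x by (auto simp: op_def)
      then show "((-1) ^ card T * (\<Prod>k\<in>insert x ?X - T. a k)) *\<^sub>R op T (x # xs)
        = of_real (a x) * ?e T"
        by (simp add: of_real_def mult_ac)
    qed
    also have "(\<Sum>T\<in>Pow ?X. ((-1) ^ card (insert x T) * (\<Prod>k\<in>insert x ?X - insert x T. a k)) *\<^sub>R op (insert x T) (x # xs))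
       = - (q x * (\<Sum>T\<in>Pow ?X. ?e T))"
      unfolding sum_distrib_left sum_negf[symmetric]
    proof (rule sum.cong[OF refl])
      fix T assume T: "T \<in> Pow ?X"
      then have xT: "x \<notin> T" and fT: "finite T" using x finite_subset by auto
      have "filter (\<lambda>k. k \<in> insert x T) xs = filter (\<lambda>k. k \<in> T) xs"
        by (rule filter_cong) (use x in auto)
      then have "op (insert x T) (x # xs) = q x * op T xs" by (simp add: op_def)
      moreover have "insert x ?X - insert x T = ?X - T" using x by auto
      moreover have "card (insert x T) = Suc (card T)" using xT fT by simp
      ultimately show "((-1) ^ card (insert x T) * (\<Prod>k\<in>insert x ?X - insert x T. a k)) *\<^sub>R op (insert x T) (x # xs)
        = - (q x * ?e T)" by simp
    qed
    finally show ?case using Cons by (simp add: left_diff_distrib)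
  qed (simp add: op_def)
  from this[of "sorted_list_of_set Q"]
  have "ordered_prod (\<lambda>k. of_real (a k) - q k) Q
     = (\<Sum>T\<in>Pow Q. ((-1) ^ card T * (\<Prod>k\<in>Q - T. a k)) *\<^sub>R op T (sorted_list_of_set Q))"
    by (simp add: ordered_prod_def)
  also have "\<dots> = (\<Sum>T\<in>Pow Q. ((-1) ^ card T * (\<Prod>k\<in>Q - T. a k)) *\<^sub>R ordered_prod q T)"
  proof (rule sum.cong[OF refl])
    fix T assume T: "T \<in> Pow Q"
    have "filter (\<lambda>k. k \<in> T) (sorted_list_of_set Q) = sorted_list_of_set T"
      by (rule sorted_distinct_set_unique) (use T in \<open>auto intro: sorted_wrt_filter\<close>)
    then show "((-1) ^ card T * (\<Prod>k\<in>Q - T. a k)) *\<^sub>R op T (sorted_list_of_set Q) = ((-1) ^ card T * (\<Prod>k\<in>Q - T. a k)) *\<^sub>R ordered_prod q T"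
      by (simp add: op_def ordered_prod_def)
  qed
  finally show ?thesis .
qed

section \<open>Stem functions of spherical components\<close>

lemma Int_singleton_card: "card (A \<inter> {h}) = (if h \<in> A then 1 else 0)"
proof -
  have "A \<inter> {h} = (if h \<in> A then {h} else {})" by auto
  then show ?thesis by simp
qed

lemma invariant_nonreal_part: "invariant_set D \<Longrightarrow> invariant_set (nonreal_part M D)"
  by (auto simp: nonreal_part_def invariant_set_def conj_at_def)

lemma stem_function_subset: "stem_function D F \<Longrightarrow> D' \<subseteq> D \<Longrightarrow> stem_function D' F"
  unfolding stem_function_def by (meson continuous_on_subset subsetD)

lemma prod_Im_conj_at:
  fixes M :: "'n::finite set"
  shows "im_prod M (conj_at h z) = (-1) ^ card (M \<inter> {h}) * im_prod M z"
proof -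
  have "im_prod M (conj_at h z) = (\<Prod>k\<in>M. (if k \<in> {h} then -1 else 1) * Im (z $ k))"
    by (rule prod.cong) (auto simp: conj_at_def)
  then show ?thesis by (simp only: prod.distrib minus_one_power_prod[OF finite])
qed

text \<open>For \<open>W\<close> the stem function of \<open>x\<^sub>K \<odot> f\<close>, such a \<open>V\<close> is the stem function of the \<open>K\<close>-th spherical component: the
quotient of \<open>W\<^bsub>L \<union> M\<^esub>\<close> by \<open>\<beta>\<^sub>M\<close> for \<open>L\<close> disjoint from \<open>M\<close>, continued to points with real coordinates. The last
clause is what the mean value property is derived from.\<close>

definition is_component_stem ::
  "'n::{finite,linorder} cvec set \<Rightarrow> 'n set \<Rightarrow> ('n cvec \<Rightarrow> 'n tensor) \<Rightarrow> ('n cvec \<Rightarrow> 'n tensor) \<Rightarrow> bool" where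
  "is_component_stem D M W V \<longleftrightarrow> stem_function D V \<and>
    (\<forall>z. \<forall>L. L \<inter> M \<noteq> {} \<longrightarrow> V z $ L = 0) \<and>
    (\<forall>z\<in>D. \<forall>L. L \<inter> M = {} \<longrightarrow> im_prod M z *\<^sub>R V z $ L = W z $ (L \<union> M)) \<and>
    (\<forall>h\<in>M. \<forall>L. \<forall>b\<in>Basis. is_divided_diff D h (\<lambda>z. of_real (inner (V z $ L) b)))"

lemma is_component_stemD:
  assumes "is_component_stem D M W V"
  shows "stem_function D V" "\<And>z L. L \<inter> M \<noteq> {} \<Longrightarrow> V z $ L = 0"
    "\<And>z L. z \<in> D \<Longrightarrow> L \<inter> M = {} \<Longrightarrow> im_prod M z *\<^sub>R V z $ L = W z $ (L \<union> M)"
    "\<And>h L b. h \<in> M \<Longrightarrow> b \<in> Basis \<Longrightarrow> is_divided_diff D h (\<lambda>z. of_real (inner (V z $ L) b))"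
  using assms by (simp_all add: is_component_stem_def)

text \<open>The parity of \<open>V\<close> follows from that of \<open>W\<close> and \<open>\<beta>\<^sub>M\<close> at points without real coordinates, and at the other
points by continuity.\<close>

lemma component_stem_exists:
  fixes D :: "'n::{finite,linorder} cvec set"
  assumes D: "open D" "invariant_set D" and F: "stem_function D F" "stem_holomorphic D F" and KM: "K \<subseteq> M"
  shows "\<exists>V. is_component_stem D M (\<lambda>z. tensor_mult (coord_stem K z) (F z)) V"
proof -
  define W where "W z = tensor_mult (coord_stem K z) (F z)" for z
  have W: "stem_function D W"
    unfolding W_def[abs_def] by (rule stem_function_tensor_mult[OF stem_function_coord_stem F(1)])
  have WL: "W z $ (L \<union> M) = (\<Sum>P\<in>Pow K. coord_coeff z K P *\<^sub>R F z $ (L \<union> (M - P)))"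
    if L: "L \<inter> M = {}" for z L
  proof -
    have "W z $ (L \<union> M) = (\<Sum>P\<in>Pow K. coord_coeff z K P *\<^sub>R F z $ ((L \<union> M) - P))"
      unfolding W_def by (rule tensor_mult_coord_stem) (use KM in auto)
    also have "\<dots> = (\<Sum>P\<in>Pow K. coord_coeff z K P *\<^sub>R F z $ (L \<union> (M - P)))"
    proof (rule sum.cong[OF refl])
      fix P assume "P \<in> Pow K"
      then have "(L \<union> M) - P = L \<union> (M - P)" using KM L by auto
      then show "coord_coeff z K P *\<^sub>R F z $ ((L \<union> M) - P)
        = coord_coeff z K P *\<^sub>R F z $ (L \<union> (M - P))" by simp
    qed
    finally show ?thesis .
  qed
  have "\<forall>L. \<exists>v. L \<inter> M = {} \<longrightarrow> continuous_on D v \<and>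
    (\<forall>z\<in>D. im_prod M z *\<^sub>R v z = W z $ (L \<union> M)) \<and>
    (\<forall>h\<in>M. \<forall>b\<in>Basis. is_divided_diff D h (\<lambda>z. of_real (inner (v z) b)))"
  proof
    fix L
    show "\<exists>v. L \<inter> M = {} \<longrightarrow> continuous_on D v \<and>
      (\<forall>z\<in>D. im_prod M z *\<^sub>R v z = W z $ (L \<union> M)) \<and>
      (\<forall>h\<in>M. \<forall>b\<in>Basis. is_divided_diff D h (\<lambda>z. of_real (inner (v z) b)))"
    proof (cases "L \<inter> M = {}")
      case True
      show ?thesis using component_extension[OF D F KM True] unfolding WL[OF True] by blast
    qed simp
  qed
  from choice[OF this] obtain v where v0: "\<forall>L. L \<inter> M = {} \<longrightarrow> continuous_on D (v L) \<and>
    (\<forall>z\<in>D. im_prod M z *\<^sub>R v L z = W z $ (L \<union> M)) \<and>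
    (\<forall>h\<in>M. \<forall>b\<in>Basis. is_divided_diff D h (\<lambda>z. of_real (inner (v L z) b)))" ..
  have v: "continuous_on D (v L)"
    "\<And>z. z \<in> D \<Longrightarrow> im_prod M z *\<^sub>R v L z = W z $ (L \<union> M)"
    "\<And>h b. h \<in> M \<Longrightarrow> b \<in> Basis \<Longrightarrow> is_divided_diff D h (\<lambda>z. of_real (inner (v L z) b))"
    if "L \<inter> M = {}" for L
    using v0 that by simp_all
  define V where "V z = (\<chi> L. if L \<inter> M = {} then v L z else 0)" for z
  have V: "V z $ L = (if L \<inter> M = {} then v L z else 0)" for z L by (simp add: V_def)
  have parity: "v L (conj_at h z) = (-1) ^ card (L \<inter> {h}) * v L z" if L: "L \<inter> M = {}" and z: "z \<in> D" for L h z
  proof (rule continuous_eq_from_nonreal[OF D(1) _ _ _ z, where M=M])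
    show "continuous_on D (\<lambda>z. v L (conj_at h z))"
      by (intro continuous_on_compose2[OF v(1)[OF L]] continuous_intros) (use D(2) in \<open>auto simp: invariant_set_def\<close>)
    show "continuous_on D (\<lambda>z. (-1) ^ card (L \<inter> {h}) * v L z)"
      by (intro continuous_intros v(1)[OF L])
    fix z assume zn: "z \<in> nonreal_part M D"
    then have z: "z \<in> D" and cz: "conj_at h z \<in> D" using D(2) by (auto simp: nonreal_part_def invariant_set_def)
    define \<beta> where "\<beta> = im_prod M z"
    have \<beta>: "\<beta> \<noteq> 0" using zn by (simp add: \<beta>_def nonreal_part_def)
    have Wc: "W (conj_at h z) $ (L \<union> M) = (-1) ^ card ((L \<union> M) \<inter> {h}) * W z $ (L \<union> M)"
      using W z by (simp add: stem_function_def)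
    have "((-1) ^ card (M \<inter> {h}) * \<beta>) *\<^sub>R v L (conj_at h z) = (-1) ^ card ((L \<union> M) \<inter> {h}) * W z $ (L \<union> M)"
      using v(2)[OF L cz] unfolding prod_Im_conj_at Wc \<beta>_def .
    also have "\<dots> = (-1) ^ card ((L \<union> M) \<inter> {h}) * (\<beta> *\<^sub>R v L z)"
      using v(2)[OF L z] by (simp add: \<beta>_def)
    finally show "v L (conj_at h z) = (-1) ^ card (L \<inter> {h}) * v L z"
      using \<beta> L unfolding Int_singleton_card by (cases "h \<in> L"; cases "h \<in> M") (auto simp flip: scaleR_minus_right)
  qed
  have "stem_function D V"
    unfolding stem_function_def
  proof (intro conjI ballI allI)
    have "continuous_on D (\<lambda>z. if L \<inter> M = {} then v L z else 0)" for L
      using v(1)[of L] by (cases "L \<inter> M = {}") auto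
    then show "continuous_on D V" unfolding V_def[abs_def] by (rule continuous_on_vec_lambda)
    show "V (conj_at h z) $ L = (-1) ^ card (L \<inter> {h}) * V z $ L" if "z \<in> D" for z L h
      using parity[OF _ that] by (simp add: V)
  qed
  moreover have "is_divided_diff D h (\<lambda>z. of_real (inner (V z $ L) b))"
    if "h \<in> M" "b \<in> Basis" for h L and b :: quat
  proof (cases "L \<inter> M = {}")
    case True
    then show ?thesis using v(3)[OF True that] by (simp add: V)
  next
    case False
    then show ?thesis
      unfolding is_divided_diff_def by (intro exI[of _ "\<lambda>_. 0"]) (simp add: V holo_in_def)
  qed
  ultimately have "is_component_stem D M W V"
    unfolding is_component_stem_def using v(2) by (simp add: V)
  then show ?thesis unfolding W_def[abs_def] by blast
qed

lemma circularization_nonreal_dense: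
  assumes D: "open D" and x: "x \<in> circularization D"
  obtains w where "\<And>j::nat. w j \<in> circularization (nonreal_part M D)" "w \<longlonglongrightarrow> x"
proof -
  obtain z J where zJ: "x = slice_point z J" "z \<in> D" "\<And>h. J h \<in> imag_units"
    using x by (rule mem_circularizationE) blast
  obtain v where v: "\<And>j::nat. v j \<in> nonreal_part M D" "v \<longlonglongrightarrow> z"
    using nonreal_part_dense[OF D zJ(2)] by blast
  have "slice_point (v j) J \<in> circularization (nonreal_part M D)" for j
    using v(1) zJ(3) by (auto simp: circularization_def)
  moreover have "(\<lambda>j. slice_point (v j) J) \<longlonglongrightarrow> slice_point z J"
    unfolding slice_point_def
    by (intro vec_tendstoI) (simp, intro tendsto_intros v(2))
  ultimately show ?thesis using that[of "\<lambda>j. slice_point (v j) J"] by (simp add: zJ(1))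
qed

text \<open>Both sides are continuous extensions of the same spherical derivative, which is defined on a dense
subset.\<close>

lemma spherical_component_eq_induced:
  fixes D :: "'n::{finite,linorder} cvec set"
  assumes D: "open D" "invariant_set D" and f: "has_stem D f F"
    and V: "is_component_stem D (first_idx m) (\<lambda>z. tensor_mult (coord_stem K z) (F z)) V"
    and x: "x \<in> circularization D"
  shows "spherical_component D m K f x = induced D V x"
proof -
  define M where "M = (first_idx m :: 'n set)"
  define g where "g = slice_mult D (coord_prod D K) f"
  note stemV = is_component_stemD(1)[OF V]
  have Vz: "V z $ L = 0" if "L \<inter> M \<noteq> {}" for z L using is_component_stemD(2)[OF V] that by (simp add: M_def)
  have VL: "im_prod M z *\<^sub>R V z $ L = tensor_mult (coord_stem K z) (F z) $ (L \<union> M)"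
    if "z \<in> D" "L \<inter> M = {}" for z L using is_component_stemD(3)[OF V that(1)] that by (simp add: M_def)
  have g: "has_stem D g (\<lambda>z. tensor_mult (coord_stem K z) (F z))"
    unfolding g_def by (rule has_stem_slice_mult[OF D(2) has_stem_coord_prod[OF D(2)] f])
  have inv: "invariant_set (nonreal_part M D)" by (rule invariant_nonreal_part[OF D(2)])
  define G where "G z = inverse (im_prod M z) *\<^sub>R (\<Sum>L\<in>Pow (- M). axis L (stem_of D g z $ (L \<union> M)))" for z
  have GV: "G z = V z" if z: "z \<in> nonreal_part M D" for z
  proof (subst vec_eq_iff, intro allI)
    fix L
    have zD: "z \<in> D" using z by (simp add: nonreal_part_def)
    have \<beta>: "im_prod M z \<noteq> 0" using z by (simp add: nonreal_part_def)
    have "(\<Sum>L\<in>Pow (- M). axis L (stem_of D g z $ (L \<union> M))) $ L = (\<Sum>L'\<in>Pow (- M). if L' = L then stem_of D g z $ (L \<union> M) else 0)"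
      unfolding sum_component by (rule sum.cong) (auto simp: axis_def)
    also have "\<dots> = (if L \<inter> M = {} then stem_of D g z $ (L \<union> M) else 0)"
      by (auto simp: sum.delta)
    also have "\<dots> = im_prod M z *\<^sub>R V z $ L"
      using VL[OF zD, of L] Vz[of L z] stem_of_eq(2)[OF g D(2) zD] by auto
    finally show "G z $ L = V z $ L" unfolding G_def using \<beta> by simp
  qed
  have stemVn: "stem_function (nonreal_part M D) V"
    by (rule stem_function_subset[OF stemV nonreal_part_subset])
  have deriv: "spherical_deriv D M g y = induced D V y" if y: "y \<in> circularization (nonreal_part M D)" for y
  proof -
    obtain z J where zJ: "y = slice_point z J" "z \<in> nonreal_part M D" "\<And>h. J h \<in> imag_units"
      using y by (rule mem_circularizationE) blast
    have "has_stem (nonreal_part M D) (induced (nonreal_part M D) V) G"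
      by (rule has_stem_cong[OF has_stem_induced[OF stemVn]]) (use GV inv in auto)
    then have stemG: "stem_function (nonreal_part M D) G" by (simp add: has_stem_def)
    have "spherical_deriv D M g y = induced (nonreal_part M D) G y"
      by (simp add: spherical_deriv_def G_def[abs_def])
    also have "\<dots> = (\<Sum>L\<in>UNIV. ordered_prod J L * G z $ L)"
      unfolding zJ(1) by (rule induced_slice_point[OF stemG inv zJ(2,3)])
    also have "\<dots> = induced D V y"
      unfolding zJ(1) GV[OF zJ(2)]
      by (rule induced_slice_point[OF stemV D(2) _ zJ(3), symmetric]) (use zJ(2) in \<open>simp add: nonreal_part_def\<close>)
    finally show ?thesis .
  qed
  have cont: "continuous_on (circularization D) (induced D V)"
    by (rule continuous_on_induced[OF stemV D(2)])
  define S where "S = spherical_component D m K f"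
  have S: "continuous_on (circularization D) S"
    "\<And>y. y \<in> circularization (nonreal_part M D) \<Longrightarrow> S y = spherical_deriv D M g y"
  proof -
    have "continuous_on (circularization D) S \<and> (\<forall>x\<in>circularization (nonreal_part (first_idx m) D).
        S x = spherical_deriv D (first_idx m) (slice_mult D (coord_prod D K) f) x)"
      unfolding S_def spherical_component_def
      by (rule someI[of _ "induced D V"]) (use cont deriv in \<open>simp add: M_def g_def\<close>)
    then show "continuous_on (circularization D) S"
      "\<And>y. y \<in> circularization (nonreal_part M D) \<Longrightarrow> S y = spherical_deriv D M g y"
      by (auto simp: M_def g_def)
  qed
  obtain w where w: "\<And>j::nat. w j \<in> circularization (nonreal_part M D)" "w \<longlonglongrightarrow> x"
    using circularization_nonreal_dense[OF D(1) x] by blast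
  have wD: "w j \<in> circularization D" for j
    using w(1)[of j] nonreal_part_subset[of M D] unfolding circularization_def by blast
  have "(\<lambda>j. S (w j)) \<longlonglongrightarrow> S x" "(\<lambda>j. induced D V (w j)) \<longlonglongrightarrow> induced D V x"
    by (auto intro!: continuous_on_tendsto_compose[OF S(1) w(2)] continuous_on_tendsto_compose[OF cont w(2)] simp: x wD)
  moreover have "S (w j) = induced D V (w j)" for j using S(2) deriv w(1) by simp
  ultimately have "S x = induced D V x" using LIMSEQ_unique by simp
  then show ?thesis by (simp add: S_def)
qed

section \<open>Recovering the function from its spherical components\<close>

lemma qcnj_slice_point:
  assumes "J h \<in> imag_units"
  shows "of_real (Re (z $ h)) - qcnj (slice_point z J $ h) = J h * of_real (Im (z $ h))"
proof -
  have "q_re (J h) = 0" using assms by (simp add: imag_units_iff)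
  then show ?thesis by (simp add: quat_eq_iff qcnj_def slice_point_def)
qed

lemma sum_Pow_complement:
  fixes M :: "'n::finite set"
  shows "(\<Sum>K\<in>Pow M. g K) = (\<Sum>T\<in>Pow M. g (M - T))"
  by (rule sum.reindex_bij_witness[where i="\<lambda>T. M - T" and j="\<lambda>T. M - T"]) (auto simp: double_diff)

lemma sum_Pow_Pow_swap:
  fixes M :: "'n::finite set"
  shows "(\<Sum>T\<in>Pow M. \<Sum>P\<in>Pow (M - T). g T (M - P)) = (\<Sum>Q\<in>Pow M. \<Sum>T\<in>Pow Q. g T Q)"
proof -
  have "(\<Sum>P\<in>Pow (M - T). g T (M - P)) = (\<Sum>Q\<in>Pow M. if T \<subseteq> Q then g T Q else 0)" if T: "T \<in> Pow M" for T
  proof -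
    have "(\<Sum>P\<in>Pow (M - T). g T (M - P)) = (\<Sum>Q\<in>{Q\<in>Pow M. T \<subseteq> Q}. g T Q)"
      by (rule sum.reindex_bij_witness[where i="\<lambda>Q. M - Q" and j="\<lambda>P. M - P"]) (use T in \<open>auto simp: double_diff\<close>)
    also have "\<dots> = (\<Sum>Q\<in>Pow M. if T \<subseteq> Q then g T Q else 0)"
      by (rule sum.inter_filter) simp
    finally show ?thesis .
  qed
  then have "(\<Sum>T\<in>Pow M. \<Sum>P\<in>Pow (M - T). g T (M - P)) = (\<Sum>T\<in>Pow M. \<Sum>Q\<in>Pow M. if T \<subseteq> Q then g T Q else 0)"
    by (rule sum.cong[OF refl])
  also have "\<dots> = (\<Sum>Q\<in>Pow M. \<Sum>T\<in>Pow M. if T \<subseteq> Q then g T Q else 0)" by (rule sum.swap)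
  also have "\<dots> = (\<Sum>Q\<in>Pow M. \<Sum>T\<in>Pow Q. g T Q)"
  proof (rule sum.cong[OF refl])
    fix Q assume Q: "Q \<in> Pow M"
    have "(\<Sum>T\<in>Pow M. if T \<subseteq> Q then g T Q else 0) = (\<Sum>T\<in>{T\<in>Pow M. T \<subseteq> Q}. g T Q)"
      by (rule sum.inter_filter[symmetric]) simp
    moreover have "{T\<in>Pow M. T \<subseteq> Q} = Pow Q" using Q by auto
    ultimately show "(\<Sum>T\<in>Pow M. if T \<subseteq> Q then g T Q else 0) = (\<Sum>T\<in>Pow Q. g T Q)" by simp
  qed
  finally show ?thesis .
qed

text \<open>Every index set is the disjoint union of its parts inside and outside \<open>M\<close>.\<close>

lemma sum_UNIV_split:
  fixes M :: "'n::finite set"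
  shows "(\<Sum>T\<in>UNIV. g T) = (\<Sum>L\<in>{L. L \<inter> M = {}}. \<Sum>Q\<in>Pow M. g (Q \<union> L))"
proof -
  have "(\<Sum>L\<in>{L. L \<inter> M = {}}. \<Sum>Q\<in>Pow M. g (Q \<union> L)) = (\<Sum>(L, Q)\<in>{L. L \<inter> M = {}} \<times> Pow M. g (Q \<union> L))"
    by (rule sum.cartesian_product)
  also have "\<dots> = (\<Sum>T\<in>UNIV. g T)"
    by (rule sum.reindex_bij_witness[where i="\<lambda>T. (T - M, T \<inter> M)" and j="\<lambda>(L, Q). Q \<union> L"])
       (auto intro!: arg_cong[where f=g])
  finally show ?thesis by simp
qed

text \<open>By continuity it is enough to consider points without real coordinates in \<open>M\<close>. There the components are
quotients by \<open>\<beta>\<^sub>M\<close>, and with \<open>T = M - K\<close> and \<open>Q = M - P\<close> the terms containing \<open>F\<^bsub>L \<union> Q\<^esub>\<close> have the coefficient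
\<open>1 / \<beta>\<^sub>Q\<close> times \<open>s * J\<^sub>L\<close>, where \<open>s\<close> is the sum over \<open>T \<subseteq> Q\<close> of \<open>(-1)^|T| * \<alpha>\<^bsub>Q - T\<^esub> * cnj x\<^sub>T\<close>. This \<open>s\<close> is the expansion of the ordered
product of the \<open>\<alpha>\<^sub>k - cnj x\<^sub>k = J\<^sub>k * \<beta>\<^sub>k\<close>, so the coefficient is \<open>J\<^sub>Q * J\<^sub>L\<close>. Since \<open>M\<close> is an initial segment of the
indices, \<open>J\<^sub>Q * J\<^sub>L = J\<^bsub>Q \<union> L\<^esub>\<close>, and the terms add up to \<open>f x\<close>.\<close>

lemma reconstruction:
  fixes D :: "'n::{finite,linorder} cvec set"
  assumes D: "open D" "invariant_set D" and f: "has_stem D f F"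
    and V: "\<And>K. K \<subseteq> first_idx m \<Longrightarrow> is_component_stem D (first_idx m) (\<lambda>z. tensor_mult (coord_stem K z) (F z)) (V K)"
    and x: "x \<in> circularization D"
  shows "f x = (\<Sum>K\<in>Pow (first_idx m). (-1) ^ card (first_idx m - K)
           * ordered_prod (\<lambda>k. qcnj (x $ k)) (first_idx m - K) * induced D (V K) x)"
proof -
  define M where "M = (first_idx m :: 'n set)"
  obtain z0 J where zJ: "x = slice_point z0 J" "z0 \<in> D" "\<And>h. J h \<in> imag_units"
    using x by (rule mem_circularizationE) blast
  define c where "c z T = ordered_prod (\<lambda>k. qcnj (slice_point z J $ k)) T" for z T
  let ?rhs = "\<lambda>z. \<Sum>K\<in>Pow M. (-1) ^ card (M - K) * c z (M - K) * (\<Sum>L\<in>UNIV. ordered_prod J L * V K z $ L)"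
  have F: "stem_function D F" using f by (simp add: has_stem_def)
  have stemV: "stem_function D (V K)" if "K \<in> Pow M" for K
    using is_component_stemD(1)[OF V, of K] that by (simp add: M_def)
  have "(\<Sum>T\<in>UNIV. ordered_prod J T * F z0 $ T)
     = ?rhs z0"
  proof (rule continuous_eq_from_nonreal[OF D(1) _ _ _ zJ(2), where M=M])
    show "continuous_on D (\<lambda>z. \<Sum>T\<in>UNIV. ordered_prod J T * F z $ T)"
      using F by (intro continuous_intros) (simp add: stem_function_def)
    have "continuous_on D (\<lambda>z. c z T)" for T
    proof -
      have q: "continuous_on D (\<lambda>z. qcnj (slice_point z J $ k))" for k
      proof -
        have "qcnj (slice_point z J $ k) = of_real (Re (z $ k)) - J k * of_real (Im (z $ k))" for z
          using qcnj_slice_point[of J k z] zJ(3)[of k] by (simp add: algebra_simps)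
        then show ?thesis by (simp, intro continuous_intros)
      qed
      show ?thesis
        unfolding c_def ordered_prod_def continuous_on_def
        by (intro ballI tendsto_prod_list) (use q in \<open>auto simp: continuous_on_def\<close>)
    qed
    moreover have "continuous_on D (V K)" if "K \<in> Pow M" for K
      using stemV[OF that] by (simp add: stem_function_def)
    ultimately show "continuous_on D (\<lambda>z. ?rhs z)"
      by (intro continuous_intros)
  next
    fix z assume zn: "z \<in> nonreal_part M D"
    then have z: "z \<in> D" by (simp add: nonreal_part_def)
    define \<beta> where "\<beta> Q = (\<Prod>k\<in>Q. Im (z $ k))" for Q
    define \<alpha> where "\<alpha> Q = (\<Prod>k\<in>Q. Re (z $ k))" for Q
    have \<beta>: "\<beta> Q \<noteq> 0" if "Q \<subseteq> M" for Q using zn that by (auto simp: \<beta>_def nonreal_part_def)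
    have VK: "V K z $ L = (\<Sum>P\<in>Pow K. (\<alpha> (K - P) / \<beta> (M - P)) *\<^sub>R F z $ (L \<union> (M - P)))"
      if K: "K \<subseteq> M" and L: "L \<inter> M = {}" for K L
    proof -
      have "\<beta> M *\<^sub>R V K z $ L = tensor_mult (coord_stem K z) (F z) $ (L \<union> M)"
        using is_component_stemD(3)[OF V, of K z L] K L z by (simp add: M_def \<beta>_def)
      also have "\<dots> = (\<Sum>P\<in>Pow K. (\<alpha> (K - P) * \<beta> P) *\<^sub>R F z $ ((L \<union> M) - P))"
        unfolding \<alpha>_def \<beta>_def by (rule tensor_mult_coord_stem) (use K in auto)
      also have "\<dots> = \<beta> M *\<^sub>R (\<Sum>P\<in>Pow K. (\<alpha> (K - P) / \<beta> (M - P)) *\<^sub>R F z $ (L \<union> (M - P)))"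
        unfolding scaleR_sum_right
      proof (rule sum.cong[OF refl])
        fix P assume P: "P \<in> Pow K"
        then have "(L \<union> M) - P = L \<union> (M - P)" using K L by auto
        moreover have "\<beta> M = \<beta> (M - P) * \<beta> P"
          unfolding \<beta>_def by (rule prod.subset_diff) (use P K in auto)
        ultimately show "(\<alpha> (K - P) * \<beta> P) *\<^sub>R F z $ ((L \<union> M) - P)
           = \<beta> M *\<^sub>R (\<alpha> (K - P) / \<beta> (M - P)) *\<^sub>R F z $ (L \<union> (M - P))"
          using \<beta>[of "M - P"] by simp
      qed
      finally show ?thesis using \<beta>[of M] by simp
    qed
    have V0: "V K z $ L = 0" if "K \<subseteq> M" "L \<inter> M \<noteq> {}" for K L
      using is_component_stemD(2)[OF V, of K L z] that by (simp add: M_def)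
    \<comment> \<open>the identity \<open>\<alpha>\<^sub>k - cnj x\<^sub>k = J\<^sub>k * \<beta>\<^sub>k\<close>, multiplied out over \<open>Q\<close>\<close>
    have telescoped: "(\<Sum>T\<in>Pow Q. ((-1) ^ card T * \<alpha> (Q - T)) *\<^sub>R c z T) = \<beta> Q *\<^sub>R ordered_prod J Q" for Q
    proof -
      have "(\<Sum>T\<in>Pow Q. ((-1) ^ card T * \<alpha> (Q - T)) *\<^sub>R c z T)
          = ordered_prod (\<lambda>k. of_real (Re (z $ k)) - qcnj (slice_point z J $ k)) Q"
        unfolding \<alpha>_def c_def by (rule ordered_prod_diff_expand[symmetric])
      also have "\<dots> = ordered_prod (\<lambda>k. J k * of_real (Im (z $ k))) Q"
        by (rule ordered_prod_cong) (rule qcnj_slice_point[OF zJ(3)])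
      also have "\<dots> = \<beta> Q *\<^sub>R ordered_prod J Q"
        unfolding \<beta>_def by (rule ordered_prod_scaled)
      finally show ?thesis .
    qed
    have inner_sum: "(\<Sum>L\<in>UNIV. ordered_prod J L * V K z $ L)
       = (\<Sum>L\<in>{L. L \<inter> M = {}}. ordered_prod J L * V K z $ L)" if "K \<in> Pow M" for K
      by (rule sum.mono_neutral_right) (use V0 that in auto)
    let ?s = "\<lambda>L. \<Sum>K\<in>Pow M. (-1) ^ card (M - K) * c z (M - K) * (ordered_prod J L * V K z $ L)"
    have "?rhs z
       = (\<Sum>K\<in>Pow M. \<Sum>L\<in>{L. L \<inter> M = {}}. (-1) ^ card (M - K) * c z (M - K) * (ordered_prod J L * V K z $ L))"
      by (rule sum.cong[OF refl]) (simp only: inner_sum sum_distrib_left)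
    also have "\<dots> = (\<Sum>L\<in>{L. L \<inter> M = {}}. ?s L)"
      by (rule sum.swap)
    also have "\<dots> = (\<Sum>L\<in>{L. L \<inter> M = {}}. \<Sum>Q\<in>Pow M. ordered_prod J (Q \<union> L) * F z $ (Q \<union> L))"
    proof (rule sum.cong[OF refl])
      fix L assume "L \<in> {L. L \<inter> M = {}}"
      then have L: "L \<inter> M = {}" by simp
      let ?g = "\<lambda>T Q. (((-1) ^ card T * \<alpha> (Q - T) / \<beta> Q) *\<^sub>R c z T) * (ordered_prod J L * F z $ (L \<union> Q))"
      have "?s L
         = (\<Sum>T\<in>Pow M. (-1) ^ card (M - (M - T)) * c z (M - (M - T)) * (ordered_prod J L * V (M - T) z $ L))"
        by (rule sum_Pow_complement)
      also have "\<dots> = (\<Sum>T\<in>Pow M. \<Sum>P\<in>Pow (M - T). ?g T (M - P))"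
      proof (rule sum.cong[OF refl])
        fix T assume T: "T \<in> Pow M"
        have MT: "M - (M - T) = T" using T by auto
        have "(-1) ^ card T * c z T * (ordered_prod J L * V (M - T) z $ L)
          = (\<Sum>P\<in>Pow (M - T). (-1) ^ card T * c z T * (ordered_prod J L * ((\<alpha> ((M - T) - P) / \<beta> (M - P)) *\<^sub>R F z $ (L \<union> (M - P)))))"
          by (subst VK[OF _ L]) (auto simp: sum_distrib_left)
        also have "\<dots> = (\<Sum>P\<in>Pow (M - T). ?g T (M - P))"
        proof (rule sum.cong[OF refl])
          fix P
          have "(M - T) - P = (M - P) - T" by auto
          then show "(-1) ^ card T * c z T * (ordered_prod J L * ((\<alpha> ((M - T) - P) / \<beta> (M - P)) *\<^sub>R F z $ (L \<union> (M - P))))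
            = ?g T (M - P)"
            by (cases "even (card T)") simp_all
        qed
        finally show "(-1) ^ card (M - (M - T)) * c z (M - (M - T)) * (ordered_prod J L * V (M - T) z $ L)
          = (\<Sum>P\<in>Pow (M - T). ?g T (M - P))" unfolding MT .
      qed
      also have "\<dots> = (\<Sum>Q\<in>Pow M. \<Sum>T\<in>Pow Q. ?g T Q)"
        by (rule sum_Pow_Pow_swap)
      also have "\<dots> = (\<Sum>Q\<in>Pow M. ordered_prod J (Q \<union> L) * F z $ (Q \<union> L))"
      proof (rule sum.cong[OF refl])
        fix Q assume Q: "Q \<in> Pow M"
        have "(\<Sum>T\<in>Pow Q. ((-1) ^ card T * \<alpha> (Q - T) / \<beta> Q) *\<^sub>R c z T)
            = (1 / \<beta> Q) *\<^sub>R (\<Sum>T\<in>Pow Q. ((-1) ^ card T * \<alpha> (Q - T)) *\<^sub>R c z T)"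
          by (simp add: scaleR_sum_right)
        also have "\<dots> = ordered_prod J Q" unfolding telescoped using \<beta> Q by simp
        finally have "(\<Sum>T\<in>Pow Q. ?g T Q)
            = ordered_prod J Q * (ordered_prod J L * F z $ (L \<union> Q))"
          by (simp only: sum_distrib_right[symmetric])
        moreover have "ordered_prod J (Q \<union> L) = ordered_prod J Q * ordered_prod J L"
          by (rule ordered_prod_Un) (use Q L in \<open>auto simp: M_def intro: first_idx_less\<close>)
        ultimately show "(\<Sum>T\<in>Pow Q. ?g T Q)
            = ordered_prod J (Q \<union> L) * F z $ (Q \<union> L)" by (simp add: mult.assoc Un_commute)
      qed
      finally show "?s L
         = (\<Sum>Q\<in>Pow M. ordered_prod J (Q \<union> L) * F z $ (Q \<union> L))" .
    qed
    also have "\<dots> = (\<Sum>T\<in>UNIV. ordered_prod J T * F z $ T)" by (rule sum_UNIV_split[symmetric])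
    finally show "(\<Sum>T\<in>UNIV. ordered_prod J T * F z $ T)
      = ?rhs z" by simp
  qed
  moreover have "induced D (V K) x = (\<Sum>L\<in>UNIV. ordered_prod J L * V K z0 $ L)" if "K \<in> Pow M" for K
    unfolding zJ(1) by (rule induced_slice_point[OF stemV[OF that] D(2) zJ(2,3)])
  moreover have "f x = (\<Sum>T\<in>UNIV. ordered_prod J T * F z0 $ T)"
    unfolding zJ(1) by (rule has_stem_eval[OF f D(2) zJ(2,3)])
  ultimately show ?thesis unfolding M_def[symmetric] c_def zJ(1) by simp
qed

section \<open>Mean values of the spherical components\<close>

lemma stem_point_upd: "stem_point (upd x h y) = upd (stem_point x) h (upper y)"
  by (simp add: vec_eq_iff stem_point_def upd_def)

text \<open>Only the \<open>J\<^sub>L\<close> with \<open>h \<notin> L\<close> occur in a spherical component. Hence, as a function of \<open>x\<^sub>h\<close> alone, it depends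
on \<open>upper x\<^sub>h\<close> only, and \<open>sphere_mean\<close> applies to every real coordinate of the \<open>V z $ L\<close>.\<close>

lemma component_sphere_mean:
  fixes D :: "'n::{finite,linorder} cvec set"
  assumes D: "open D" "invariant_set D" and V: "is_component_stem D M W V" and h: "h \<in> M"
    and r: "r \<ge> 0" and incl: "\<And>y. y \<in> cball (x $ h) r \<Longrightarrow> upd x h y \<in> circularization D"
  shows "(\<integral>y. induced D V (upd x h (x $ h + r *\<^sub>R y)) \<partial>sphere_measure) = induced D V x"
proof -
  define z where "z = stem_point x"
  define I where "I = (\<lambda>k. unit_of (x $ k))"
  note stemV = is_component_stemD(1)[OF V]
  have V0: "V w $ L = 0" if "h \<in> L" for w L by (rule is_component_stemD(2)[OF V]) (use that h in auto)
  have zD: "z \<in> D"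
    using incl[of "x $ h"] r stem_point_mem[OF D(2)] by (simp add: z_def)
  have updD: "upd z h (upper y) \<in> D" if "y \<in> cball (x $ h) r" for y
    using incl[OF that] stem_point_mem[OF D(2)] by (simp add: z_def stem_point_upd[symmetric])
  have ev: "induced D V (upd x h y) = (\<Sum>L\<in>UNIV. ordered_prod I L * V (upd z h (upper y)) $ L)"
    if "y \<in> cball (x $ h) r" for y
  proof -
    have "induced D V (upd x h y) = (\<Sum>L\<in>UNIV. ordered_prod (\<lambda>k. unit_of (upd x h y $ k)) L * V (upd z h (upper y)) $ L)"
      using induced_stem_point[OF stemV D(2) incl[OF that]] by (simp add: stem_point_upd z_def)
    also have "\<dots> = (\<Sum>L\<in>UNIV. ordered_prod I L * V (upd z h (upper y)) $ L)"
    proof (rule sum.cong[OF refl])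
      fix L
      show "ordered_prod (\<lambda>k. unit_of (upd x h y $ k)) L * V (upd z h (upper y)) $ L = ordered_prod I L * V (upd z h (upper y)) $ L"
      proof (cases "h \<in> L")
        case False
        then have "ordered_prod (\<lambda>k. unit_of (upd x h y $ k)) L = ordered_prod I L"
          by (intro ordered_prod_cong) (auto simp: I_def upd_nth)
        then show ?thesis by simp
      qed (simp add: V0)
    qed
    finally show ?thesis .
  qed
  have mem: "x $ h + r *\<^sub>R y \<in> cball (x $ h) r" if "norm y = 1" for y
    using r that by (simp add: dist_norm)
  define v where "v L y = V (upd z h (upper (x $ h + r *\<^sub>R y))) $ L" for L y
  have vcont: "continuous_on (sphere 0 1) (v L)" for L
  proof -
    have "continuous_on (sphere 0 1) (\<lambda>y. V (upd z h (upper (x $ h + r *\<^sub>R y))))"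
    proof (rule continuous_on_compose2[of D])
      show "continuous_on D V" using stemV by (simp add: stem_function_def)
      show "continuous_on (sphere 0 1) (\<lambda>y. upd z h (upper (x $ h + r *\<^sub>R y)))"
        by (intro continuous_intros continuous_on_compose2[OF continuous_on_upper[of UNIV]]) auto
      show "(\<lambda>y. upd z h (upper (x $ h + r *\<^sub>R y))) ` sphere 0 1 \<subseteq> D" using updD mem by auto
    qed
    then show ?thesis unfolding v_def by (intro continuous_intros)
  qed
  have vint: "integrable sphere_measure (v L)" for L
  proof -
    have "bounded (v L ` sphere 0 1)"
      by (rule compact_imp_bounded[OF compact_continuous_image[OF vcont compact_sphere]])
    then obtain B where B: "\<And>y. y \<in> sphere 0 1 \<Longrightarrow> norm (v L y) \<le> B"
      unfolding bounded_iff by blast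
    interpret prob_space sphere_measure by (rule prob_space_sphere_measure)
    show ?thesis
      by (rule integrable_const_bound[where B=B])
         (use B measurable_sphere_continuous[OF vcont] in \<open>auto simp: space_sphere_measure intro!: AE_I2\<close>)
  qed
  have vmean: "(\<integral>y. v L y \<partial>sphere_measure) = V z $ L" for L
  proof (rule euclidean_eqI)
    fix b :: quat assume b: "b \<in> Basis"
    from is_component_stemD(4)[OF V h b, of L, unfolded is_divided_diff_def] obtain U where "holo_in D h U \<and>
        (\<forall>z\<in>D. 2 * \<i> * of_real (Im (z $ h)) * of_real (inner (V z $ L) b) = U z - U (conj_at h z))" ..
    then have U: "holo_in D h U"
      "\<And>z. z \<in> D \<Longrightarrow> 2 * \<i> * of_real (Im (z $ h)) * of_real (inner (V z $ L) b) = U z - U (conj_at h z)"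
      by simp_all
    define S where "S = {\<zeta>. upd z h \<zeta> \<in> D}"
    have "(\<integral>y. complex_of_real (inner (V (upd z h (upper (x $ h + r *\<^sub>R y))) $ L) b) \<partial>sphere_measure)
        = of_real (inner (V (upd z h (upper (x $ h))) $ L) b)"
    proof (rule sphere_mean[where S=S and \<phi>="\<lambda>\<zeta>. U (upd z h \<zeta>)" and u="\<lambda>\<zeta>. complex_of_real (inner (V (upd z h \<zeta>) $ L) b)"])
      show "open S" unfolding S_def by (rule open_slice[OF D(1)])
      show "cnj \<zeta> \<in> S" if "\<zeta> \<in> S" for \<zeta>
        using that D(2) by (auto simp: S_def conj_at_upd[symmetric] invariant_set_def)
      show "(\<lambda>\<zeta>. U (upd z h \<zeta>)) holomorphic_on S" using U(1) zD by (simp add: holo_in_def S_def)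
      have "continuous_on S (\<lambda>\<zeta>. V (upd z h \<zeta>))"
        by (rule continuous_on_compose2[of D])
           (use stemV in \<open>auto simp: stem_function_def S_def intro!: continuous_intros\<close>)
      then show "continuous_on S (\<lambda>\<zeta>. complex_of_real (inner (V (upd z h \<zeta>) $ L) b))"
        by (intro continuous_intros)
      show "2 * \<i> * of_real (Im \<zeta>) * complex_of_real (inner (V (upd z h \<zeta>) $ L) b) = U (upd z h \<zeta>) - U (upd z h (cnj \<zeta>))"
        if "\<zeta> \<in> S" for \<zeta>
        using U(2)[of "upd z h \<zeta>"] that by (simp add: S_def upd_nth conj_at_upd)
      show "upper y \<in> S" if "y \<in> cball (x $ h) r" for y using updD[OF that] by (simp add: S_def)
    qed (rule r)
    moreover have "upd z h (upper (x $ h)) = z" by (simp add: z_def stem_point_upd[symmetric])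
    ultimately have "(\<integral>y. inner (v L y) b \<partial>sphere_measure) = inner (V z $ L) b"
      unfolding v_def by simp
    then show "inner (\<integral>y. v L y \<partial>sphere_measure) b = inner (V z $ L) b"
      using vint[of L] by simp
  qed
  have "(\<integral>y. induced D V (upd x h (x $ h + r *\<^sub>R y)) \<partial>sphere_measure)
      = (\<integral>y. (\<Sum>L\<in>UNIV. ordered_prod I L * v L y) \<partial>sphere_measure)"
    by (intro Bochner_Integration.integral_cong refl) (use ev mem in \<open>simp add: v_def space_sphere_measure\<close>)
  also have "\<dots> = (\<Sum>L\<in>UNIV. ordered_prod I L * (\<integral>y. v L y \<partial>sphere_measure))"
    using vint by simp
  also have "\<dots> = induced D V x"
    using ev[of "x $ h"] r by (simp add: vmean z_def stem_point_upd[symmetric])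
  finally show ?thesis .
qed

abbreviation sphere_product :: "'n set \<Rightarrow> ('n \<Rightarrow> quat) measure" where
  "sphere_product I \<equiv> Pi\<^sub>M I (\<lambda>_. sphere_measure)"

definition shifted :: "'n set \<Rightarrow> ('n \<Rightarrow> real) \<Rightarrow> ('n \<Rightarrow> quat) \<Rightarrow> 'n qvec \<Rightarrow> 'n::finite qvec" where
  "shifted I r lam x = (\<chi> i. if i \<in> I then x $ i + r i *\<^sub>R lam i else x $ i)"

text \<open>Fubini, one variable at a time: moving the coordinates in \<open>I\<close> along their spheres leads to another point
of the product of balls whose coordinate \<open>h\<close> is still \<open>a\<^sub>h\<close>, and the mean value property in \<open>x\<^sub>h\<close> holds
there.\<close>

lemma component_product_sphere_mean:
  fixes D :: "'n::{finite,linorder} cvec set"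
  assumes D: "open D" "invariant_set D" and V: "is_component_stem D M W V"
    and r: "\<And>i. 0 \<le> r i" and incl: "{x. \<forall>i. x $ i \<in> cball (a $ i) (r i)} \<subseteq> circularization D"
    and I: "I \<subseteq> M"
  shows "(\<integral>lam. induced D V (shifted I r lam a) \<partial>sphere_product I) = induced D V a"
proof -
  define P where "P = {x. \<forall>i. x $ i \<in> cball (a $ i) (r i)}"
  note stemV = is_component_stemD(1)[OF V]
  interpret \<sigma>: prob_space sphere_measure by (rule prob_space_sphere_measure)
  interpret product_prob_space "\<lambda>_::'n. sphere_measure" ..
  have cont: "continuous_on P (induced D V)"
    by (rule continuous_on_subset[OF continuous_on_induced[OF stemV D(2)]]) (use incl in \<open>simp add: P_def\<close>)
  have compact: "compact P"
  proof -
    have "closed P" unfolding P_def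
      by (intro closed_Collect_all) (simp add: continuous_intros closed_Collect_le)
    moreover have "bounded P"
    proof -
      have "norm (x - a) \<le> (\<Sum>i\<in>UNIV. r i)" if "x \<in> P" for x
      proof -
        have "norm (x - a) \<le> (\<Sum>i\<in>UNIV. norm ((x - a) $ i))"
          by (simp add: norm_vec_def L2_set_le_sum)
        also have "\<dots> \<le> (\<Sum>i\<in>UNIV. r i)"
          by (rule sum_mono) (use that in \<open>simp add: P_def dist_norm norm_minus_commute\<close>)
        finally show ?thesis .
      qed
      then have "P \<subseteq> cball a (\<Sum>i\<in>UNIV. r i)" by (auto simp: dist_norm norm_minus_commute)
      then show ?thesis using bounded_cball bounded_subset by blast
    qed
    ultimately show ?thesis by (simp add: compact_eq_bounded_closed)
  qed
  have shifted_meas: "(\<lambda>lam. shifted I r lam a) \<in> borel_measurable (sphere_product I)" for I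
  proof (subst borel_measurable_euclidean_space, intro ballI)
    fix e :: "'n qvec" assume "e \<in> Basis"
    then obtain i b where e: "e = axis i b" "b \<in> Basis" by (auto simp: Basis_vec_def)
    have id: "(\<lambda>y. y) \<in> borel_measurable sphere_measure" by (rule measurable_sphere_continuous) simp
    have "(\<lambda>lam. lam i) \<in> borel_measurable (sphere_product I)" if "i \<in> I"
      using measurable_compose[OF measurable_component_singleton[OF that] id] by simp
    then have "(\<lambda>lam. shifted I r lam a $ i) \<in> borel_measurable (sphere_product I)"
      by (cases "i \<in> I") (simp_all add: shifted_def)
    then show "(\<lambda>lam. inner (shifted I r lam a) e) \<in> borel_measurable (sphere_product I)"
      by (simp add: e inner_axis)
  qed
  have in_P: "shifted I r lam a \<in> P" if "lam \<in> space (sphere_product I)" for I lam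
  proof -
    have "norm (lam i) = 1" if "i \<in> I" for i
      using \<open>lam \<in> _\<close> that by (auto simp: space_PiM space_sphere_measure PiE_iff)
    then show ?thesis using r by (auto simp: P_def shifted_def dist_norm)
  qed
  have integrable: "integrable (sphere_product I) (\<lambda>lam. induced D V (shifted I r lam a))" for I
  proof -
    obtain B where B: "\<And>x. norm (indicator P x *\<^sub>R induced D V x) \<le> B"
      using compact_indicator_Borel_bounded(2)[OF compact cont] by blast
    have "(\<lambda>lam. indicator P (shifted I r lam a) *\<^sub>R induced D V (shifted I r lam a)) \<in> borel_measurable (sphere_product I)"
      by (rule measurable_compose[OF shifted_meas compact_indicator_Borel_bounded(1)[OF compact cont]])
    then have "integrable (sphere_product I) (\<lambda>lam. indicator P (shifted I r lam a) *\<^sub>R induced D V (shifted I r lam a))"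
      by (rule integrable_bounded_Borel[OF prob_space_PiM[OF prob_space_sphere_measure] _ B])
    then show ?thesis
      by (rule Bochner_Integration.integrable_cong[THEN iffD1, rotated -1]) (use in_P in auto)
  qed
  show ?thesis
    using finite[of I] I
  proof (induction I rule: finite_induct)
    case empty
    then show ?case by (simp add: PiM_empty shifted_def lebesgue_integral_count_space_finite)
  next
    case (insert h I)
    have "(\<integral>lam. induced D V (shifted (insert h I) r lam a) \<partial>sphere_product (insert h I))
       = (\<integral>lam. \<integral>y. induced D V (shifted (insert h I) r (lam(h := y)) a) \<partial>sphere_measure \<partial>sphere_product I)"
      by (rule product_integral_insert[OF insert(1,2) integrable])
    also have "\<dots> = (\<integral>lam. induced D V (shifted I r lam a) \<partial>sphere_product I)"
    proof (intro Bochner_Integration.integral_cong refl)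
      fix lam assume lam: "lam \<in> space (sphere_product I)"
      define x where "x = shifted I r lam a"
      have x: "x \<in> P" unfolding x_def by (rule in_P[OF lam])
      have xh: "x $ h = a $ h" using insert(2) by (simp add: x_def shifted_def)
      have "shifted (insert h I) r (lam(h := y)) a = upd x h (x $ h + r h *\<^sub>R y)" for y
        using insert(2) by (auto simp: vec_eq_iff x_def shifted_def upd_def)
      moreover have "(\<integral>y. induced D V (upd x h (x $ h + r h *\<^sub>R y)) \<partial>sphere_measure) = induced D V x"
      proof (rule component_sphere_mean[OF D V _ r])
        show "h \<in> M" using insert by simp
        show "upd x h y \<in> circularization D" if "y \<in> cball (x $ h) (r h)" for y
        proof -
          have "upd x h y \<in> P" using x that by (simp add: P_def upd_nth xh)
          then show ?thesis using incl by (auto simp: P_def)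
        qed
      qed
      ultimately show "(\<integral>y. induced D V (shifted (insert h I) r (lam(h := y)) a) \<partial>sphere_measure) = induced D V (shifted I r lam a)"
        by (simp add: x_def)
    qed
    also have "\<dots> = induced D V a" using insert by simp
    finally show ?case .
  qed
qed

theorem proposition4p9:
  fixes D :: "'n::{finite,linorder} cvec set"
    and f :: "'n qvec \<Rightarrow> quat"
    and a :: "'n qvec"
    and r :: "'n \<Rightarrow> real"
    and m :: nat
  assumes "open D" and "invariant_set D"
    and "slice_regular D f"
    and "a \<in> circularization D"
    and "\<And>i. 0 \<le> r i"
    and "{x. \<forall>i. x $ i \<in> cball (a $ i) (r i)} \<subseteq> circularization D"
    and "1 \<le> m" and "m \<le> CARD('n)"
  shows "f a = (\<Sum>K\<in>Pow (first_idx m).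
           (-1) ^ card (first_idx m - K)
           * ordered_prod (\<lambda>k. qcnj (a $ k)) (first_idx m - K)
           * (\<integral>lam. spherical_component D m K f
                 (\<chi> i. if i \<in> first_idx m then a $ i + r i *\<^sub>R lam i else a $ i)
               \<partial>Pi\<^sub>M (first_idx m) (\<lambda>_. sphere_measure)))"
proof -
  note D = assms(1,2)
  obtain F where F: "stem_function D F" "stem_holomorphic D F" "has_stem D f F"
    using assms(3) by (auto simp: slice_regular_def has_stem_def)
  have "\<forall>K. \<exists>V. K \<subseteq> first_idx m \<longrightarrow> is_component_stem D (first_idx m) (\<lambda>z. tensor_mult (coord_stem K z) (F z)) V"
    using component_stem_exists[OF D F(1,2)] by blast
  then obtain V where V: "\<And>K. K \<subseteq> first_idx m \<Longrightarrow>
      is_component_stem D (first_idx m) (\<lambda>z. tensor_mult (coord_stem K z) (F z)) (V K)"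
    by metis
  have "(\<integral>lam. spherical_component D m K f
                 (\<chi> i. if i \<in> first_idx m then a $ i + r i *\<^sub>R lam i else a $ i)
               \<partial>Pi\<^sub>M (first_idx m) (\<lambda>_. sphere_measure)) = induced D (V K) a"
    if K: "K \<in> Pow (first_idx m)" for K
  proof -
    have VK: "is_component_stem D (first_idx m) (\<lambda>z. tensor_mult (coord_stem K z) (F z)) (V K)"
      using V K by blast
    have "(\<integral>lam. spherical_component D m K f
                 (\<chi> i. if i \<in> first_idx m then a $ i + r i *\<^sub>R lam i else a $ i)
               \<partial>Pi\<^sub>M (first_idx m) (\<lambda>_. sphere_measure))
       = (\<integral>lam. induced D (V K) (shifted (first_idx m) r lam a) \<partial>Pi\<^sub>M (first_idx m) (\<lambda>_. sphere_measure))"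
    proof (intro Bochner_Integration.integral_cong refl)
      fix lam assume lam: "lam \<in> space (Pi\<^sub>M (first_idx m :: 'n set) (\<lambda>_. sphere_measure))"
      have "norm (lam i) = 1" if "i \<in> first_idx m" for i
        using lam that by (auto simp: space_PiM space_sphere_measure PiE_iff)
      then have "shifted (first_idx m) r lam a \<in> circularization D"
        using assms(5) by (intro subsetD[OF assms(6)]) (auto simp: shifted_def dist_norm)
      then show "spherical_component D m K f (\<chi> i. if i \<in> first_idx m then a $ i + r i *\<^sub>R lam i else a $ i)
          = induced D (V K) (shifted (first_idx m) r lam a)"
        using spherical_component_eq_induced[OF D F(3) VK] by (simp add: shifted_def)
    qed
    also have "\<dots> = induced D (V K) a"
      by (rule component_product_sphere_mean[OF D VK assms(5,6) order_refl])
    finally show ?thesis .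
  qed
  then show ?thesis
    using reconstruction[OF D F(3) V assms(4)] by simp
qed

end
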